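(* Assume that $\mathfrak g_0$ is semisimple, and let $p$ be the unique index with $s_p\neq 0$. Let $\chi_\ell(\alpha_p)$ be $1$ if $\alpha_p$ is long and $0$ otherwise. Then $$|\mathcal W_{ab}^{\sigma}| = a_0\,(\chi_\ell(\alpha_p)+1)\,k^{\,n-L}\,\frac{|W_f|}{|W_\sigma|}-\chi_\ell(\alpha_p),$$ where $L$ is the number of long roots in $\Pi_f=\{\alpha_1,\dots,\alpha_n\}$.
   Context: Setting. $\mathfrak g$ is a finite-dimensional complex simple Lie algebra of type $X_N$, $\sigma$ is an automorphism of $\mathfrak g$ of order $2$, and $\mathfrak g=\mathfrak g_0\oplus\mathfrak g_1$ is the corresponding $\mathbb Z_2$-gradation ($(+1)$- and $(-1)$-eigenspaces). Let $k\in\{1,2\}$ be the least positive integer such that $\sigma^k$ is inner, and let $\widehat{\mathfrak g}$ be the affine Kac-Moody algebra of type $X_N^{(k)}$ (nodes labelled $0,\dots,n$ as in Kac's book "Infinite dimensional Lie algebras", namely: if $k=1$, nodes $1,\dots,n$ form the finite Dynkin diagram of type $X_N$, their order being immaterial here, and $0$ is the additional node of the extended diagram, with label $a_0=1$; for $A_{2n}^{(2)}$ the diagram is the chain $0,1,\dots,n$ with labels $(a_0,\dots,a_n)=(2,\dots,2,1)$, $\alpha_0$ being the shortest and $\alpha_n$ the longest simple root; for $A_{2n-1}^{(2)}$, $n\ge3$, nodes $0$ and $1$ are both joined to node $2$, which starts the chain $2,\dots,n$, with labels $(1,1,2,\dots,2,1)$ and $\alpha_n$ the only long simple root; for $D_{n+1}^{(2)}$,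 $n\ge2$, the diagram is the chain $0,1,\dots,n$ with all labels $1$ and $\alpha_0,\alpha_n$ the short simple roots; for $E_6^{(2)}$ the diagram is the chain $0,1,2,3,4$ with labels $(1,2,3,2,1)$ and $\alpha_3,\alpha_4$ the long simple roots), with root system $\widehat\Delta$ (real and imaginary roots), simple roots $\widehat\Pi=\{\alpha_0,\dots,\alpha_n\}$, positive roots $\widehat\Delta^+$, Weyl group $\widehat W$, and labels $a_0,\dots,a_n$ of the affine Dynkin diagram. By Kac's classification, up to conjugation by an automorphism of $\mathfrak g$, $\sigma$ is the automorphism of type $(s_0,\dots,s_n;k)$ (the automorphism characterized by $E_i\mapsto(-1)^{s_i}E_i$, where $E_0,\dots,E_n\in\mathfrak g$ are the images at $t=1$ of the Chevalley generators $e_0,\dots,e_n$ of $\widehat{\mathfrak g}$ in its standard (twisted) loop realization), where the $s_i$ are coprime non-negative integers with $k\sum_{i=0}^n a_is_i=2$; we assume $\sigma$ is this automorphism. The algebra $\mathfrak g_0$ is semisimple if and only if exactly one $s_p$ is nonzero (then $s_p=1$ and $ka_p=2$). For $\alpha=\sum_{i=0}^n m_i\alpha_i\in\widehat\Delta$ put $ht_\sigma(\alpha)=\sum_{i=0}^n s_im_i$. Let $\widehat\Delta_0=\{\alpha\in\widehat\Delta: ht_\sigma(\alpha)=0\}$ (a finite root system, the root system of $\mathfrak g_0$), and let $W_\sigma$ be its Weyl group, generated by the simple reflections $s_{\alpha_i}$ with $s_i=0$. $W_f$ is the finite Weyl group generated by the reflections in the elements of $\Pi_f=\{\alpha_1,\dots,\alpha_n\}$.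 Long roots: a real root of $\widehat\Delta$ is long if it has maximal length among real roots; if all real roots have the same length, all are called long. For $w\in\widehat W$ let $N(w)=\{\beta\in\widehat\Delta^+: w^{-1}(\beta)\in-\widehat\Delta^+\}$. $\mathcal W_{ab}^\sigma$ is the set of $\sigma$-minuscule elements, i.e. of $w\in\widehat W$ such that $N(w)\subset\{\alpha\in\widehat\Delta: ht_\sigma(\alpha)=1\}$. *)

theory Defs
  imports Complex_Main
begin

section \<open>Complex Lie algebras\<close>

locale complex_lie_algebra = vector_space scale
  for scale :: "complex \<Rightarrow> 'g::ab_group_add \<Rightarrow> 'g" +
  fixes bracket :: "'g \<Rightarrow> 'g \<Rightarrow> 'g"
  assumes bracket_add_left: "bracket (x + y) z = bracket x z + bracket y z"
    and bracket_scale_left: "bracket (scale c x) z = scale c (bracket x z)"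
    and bracket_add_right: "bracket x (y + z) = bracket x y + bracket x z"
    and bracket_scale_right: "bracket x (scale c z) = scale c (bracket x z)"
    and bracket_self: "bracket x x = 0"
    and jacobi: "bracket x (bracket y z) + bracket y (bracket z x) + bracket z (bracket x y) = 0"
begin

definition subalgebra :: "'g set \<Rightarrow> bool" where
  "subalgebra L \<longleftrightarrow> subspace L \<and> (\<forall>x\<in>L. \<forall>y\<in>L. bracket x y \<in> L)"

definition ideal_of :: "'g set \<Rightarrow> 'g set \<Rightarrow> bool" where
  "ideal_of I L \<longleftrightarrow> subspace I \<and> I \<subseteq> L \<and> (\<forall>x\<in>L. \<forall>y\<in>I. bracket x y \<in> I)"

definition finite_dim_simple :: bool where
  "finite_dim_simple \<longleftrightarrow>
     (\<exists>B. finite B \<and> span B = UNIV) \<and>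
     (\<exists>x y. bracket x y \<noteq> 0) \<and>
     (\<forall>I. ideal_of I UNIV \<longrightarrow> I = {0} \<or> I = UNIV)"

definition derived_algebra :: "'g set \<Rightarrow> 'g set" where
  "derived_algebra L = span {bracket x y | x y. x \<in> L \<and> y \<in> L}"

definition solvable :: "'g set \<Rightarrow> bool" where
  "solvable L \<longleftrightarrow> (\<exists>m. (derived_algebra ^^ m) L = {0})"

definition semisimple :: "'g set \<Rightarrow> bool" where
  "semisimple L \<longleftrightarrow> subalgebra L \<and> (\<forall>I. ideal_of I L \<and> solvable I \<longrightarrow> I = {0})"

definition automorphism :: "('g \<Rightarrow> 'g) \<Rightarrow> bool" where
  "automorphism \<phi> \<longleftrightarrow> Vector_Spaces.linear scale scale \<phi> \<and> bij \<phi> \<and>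
     (\<forall>x y. \<phi> (bracket x y) = bracket (\<phi> x) (\<phi> y))"

definition fixed_points :: "('g \<Rightarrow> 'g) \<Rightarrow> 'g set" where
  "fixed_points \<phi> = {x. \<phi> x = x}"

definition ad_nilpotent :: "'g \<Rightarrow> bool" where
  "ad_nilpotent x \<longleftrightarrow> (\<exists>m. \<forall>y. (bracket x ^^ m) y = 0)"

text \<open>The exponential of ad x; only used for ad-nilpotent x, where the sum is finite.\<close>
definition exp_ad :: "'g \<Rightarrow> 'g \<Rightarrow> 'g" where
  "exp_ad x y =
     (\<Sum>m | (bracket x ^^ m) y \<noteq> 0. scale (1 / of_nat (fact m)) ((bracket x ^^ m) y))"

text \<open>The group generated by the exponentials of nilpotent inner derivations; it is closed under
  inverses because exp(ad (-x)) is inverse to exp(ad x).\<close>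
inductive_set inner_automorphisms :: "('g \<Rightarrow> 'g) set" where
  id_inner: "id \<in> inner_automorphisms"
| exp_inner: "\<lbrakk>ad_nilpotent x; \<phi> \<in> inner_automorphisms\<rbrakk> \<Longrightarrow> exp_ad x \<circ> \<phi> \<in> inner_automorphisms"

definition least_inner_power :: "('g \<Rightarrow> 'g) \<Rightarrow> nat \<Rightarrow> bool" where
  "least_inner_power \<phi> k \<longleftrightarrow>
     k > 0 \<and> \<phi> ^^ k \<in> inner_automorphisms \<and>
     (\<forall>j. 0 < j \<and> j < k \<longrightarrow> \<phi> ^^ j \<notin> inner_automorphisms)"

definition has_order :: "('g \<Rightarrow> 'g) \<Rightarrow> nat \<Rightarrow> bool" where
  "has_order \<phi> m \<longleftrightarrow> m > 0 \<and> \<phi> ^^ m = id \<and> (\<forall>j. 0 < j \<and> j < m \<longrightarrow> \<phi> ^^ j \<noteq> id)"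

text \<open>Chevalley generators of the subalgebra L for the Cartan matrix a with index set I. The Cartan
  elements are the brackets of E i with F i. For finite-dimensional L the Serre
  relations follow from the relations listed.\<close>
definition chevalley_generators ::
  "'g set \<Rightarrow> nat set \<Rightarrow> (nat \<Rightarrow> nat \<Rightarrow> int) \<Rightarrow> (nat \<Rightarrow> 'g) \<Rightarrow> (nat \<Rightarrow> 'g) \<Rightarrow> bool" where
  "chevalley_generators L I a E F \<longleftrightarrow>
     (\<forall>i\<in>I. E i \<in> L \<and> F i \<in> L \<and> E i \<noteq> 0) \<and>
     (\<forall>i\<in>I. \<forall>j\<in>I. i \<noteq> j \<longrightarrow> bracket (E i) (F j) = 0) \<and>
     (\<forall>i\<in>I. \<forall>j\<in>I. bracket (bracket (E i) (F i)) (bracket (E j) (F j)) = 0) \<and>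
     (\<forall>i\<in>I. \<forall>j\<in>I. bracket (bracket (E i) (F i)) (E j) = scale (of_int (a i j)) (E j)) \<and>
     (\<forall>i\<in>I. \<forall>j\<in>I. bracket (bracket (E i) (F i)) (F j) = scale (- of_int (a i j)) (F j)) \<and>
     subalgebra L \<and> (\<forall>M. subalgebra M \<and> E ` I \<union> F ` I \<subseteq> M \<longrightarrow> L \<subseteq> M)"

end

section \<open>Finite and affine Dynkin diagrams\<close>

text \<open>\<open>TypeE n\<close> is used for n = 6, 7, 8.\<close>
datatype finite_type =
  TypeA nat | TypeB nat | TypeC nat | TypeD nat | TypeE nat | TypeF4 | TypeG2

text \<open>\<open>Untwisted X\<close> is \<open>X\<^sup>(\<^sup>1\<^sup>)\<close>. In the notation \<open>X\<^sub>N\<^sup>(\<^sup>2\<^sup>)\<close>, the last four constructors stand for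
  \<open>A\<close> with N = 2n, \<open>A\<close> with N = 2n - 1, \<open>D\<close> with N = n + 1, and \<open>E\<close> with N = 6.
  The type \<open>D\<^sub>4\<^sup>(\<^sup>3\<^sup>)\<close> does not occur for automorphisms of order 2.\<close>
datatype affine_type =
  Untwisted finite_type | TwistedA_even nat | TwistedA_odd nat | TwistedD nat | TwistedE6

text \<open>The parameter ranges list every affine diagram exactly once.\<close>
fun valid_affine_type :: "affine_type \<Rightarrow> bool" where
  "valid_affine_type (Untwisted (TypeA n)) \<longleftrightarrow> n \<ge> 1"
| "valid_affine_type (Untwisted (TypeB n)) \<longleftrightarrow> n \<ge> 3"
| "valid_affine_type (Untwisted (TypeC n)) \<longleftrightarrow> n \<ge> 2"
| "valid_affine_type (Untwisted (TypeD n)) \<longleftrightarrow> n \<ge> 4"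
| "valid_affine_type (Untwisted (TypeE n)) \<longleftrightarrow> n \<in> {6, 7, 8}"
| "valid_affine_type (Untwisted TypeF4) \<longleftrightarrow> True"
| "valid_affine_type (Untwisted TypeG2) \<longleftrightarrow> True"
| "valid_affine_type (TwistedA_even n) \<longleftrightarrow> n \<ge> 1"
| "valid_affine_type (TwistedA_odd n) \<longleftrightarrow> n \<ge> 3"
| "valid_affine_type (TwistedD n) \<longleftrightarrow> n \<ge> 2"
| "valid_affine_type TwistedE6 \<longleftrightarrow> True"

fun finite_rank :: "finite_type \<Rightarrow> nat" where
  "finite_rank (TypeA n) = n"
| "finite_rank (TypeB n) = n"
| "finite_rank (TypeC n) = n"
| "finite_rank (TypeD n) = n"
| "finite_rank (TypeE n) = n"
| "finite_rank TypeF4 = 4"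
| "finite_rank TypeG2 = 2"

text \<open>The number n such that the nodes of the affine diagram are 0, ..., n.\<close>
fun affine_rank :: "affine_type \<Rightarrow> nat" where
  "affine_rank (Untwisted X) = finite_rank X"
| "affine_rank (TwistedA_even n) = n"
| "affine_rank (TwistedA_odd n) = n"
| "affine_rank (TwistedD n) = n"
| "affine_rank TwistedE6 = 4"

text \<open>For the type \<open>X\<^sub>N\<^sup>(\<^sup>k\<^sup>)\<close>: the number k and the finite type \<open>X\<^sub>N\<close>.\<close>
fun twist :: "affine_type \<Rightarrow> nat" where
  "twist (Untwisted X) = 1"
| "twist (TwistedA_even n) = 2"
| "twist (TwistedA_odd n) = 2"
| "twist (TwistedD n) = 2"
| "twist TwistedE6 = 2"

fun underlying_type :: "affine_type \<Rightarrow> finite_type" where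
  "underlying_type (Untwisted X) = X"
| "underlying_type (TwistedA_even n) = TypeA (2 * n)"
| "underlying_type (TwistedA_odd n) = TypeA (2 * n - 1)"
| "underlying_type (TwistedD n) = TypeD (n + 1)"
| "underlying_type TwistedE6 = TypeE 6"

definition path_edges :: "nat \<Rightarrow> nat \<Rightarrow> (nat \<times> nat) set" where
  "path_edges a b = {(i, Suc i) | i. a \<le> i \<and> i < b}"

text \<open>Bourbaki numbering of the finite diagrams in types A to \<open>F\<^sub>4\<close>; in type \<open>G\<^sub>2\<close>, node 1 is long.\<close>
fun finite_edges :: "finite_type \<Rightarrow> (nat \<times> nat) set" where
  "finite_edges (TypeA n) = path_edges 1 n"
| "finite_edges (TypeB n) = path_edges 1 n"
| "finite_edges (TypeC n) = path_edges 1 n"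
| "finite_edges (TypeD n) = path_edges 1 (n - 1) \<union> {(n - 2, n)}"
| "finite_edges (TypeE n) = {(1, 3), (2, 4)} \<union> path_edges 3 n"
| "finite_edges TypeF4 = path_edges 1 4"
| "finite_edges TypeG2 = path_edges 1 2"

fun extending_edges :: "finite_type \<Rightarrow> (nat \<times> nat) set" where
  "extending_edges (TypeA n) = {(0, 1), (0, n)}"
| "extending_edges (TypeB n) = {(0, 2)}"
| "extending_edges (TypeC n) = {(0, 1)}"
| "extending_edges (TypeD n) = {(0, 2)}"
| "extending_edges (TypeE n) = {(0, if n = 6 then 2 else if n = 7 then 1 else 8)}"
| "extending_edges TypeF4 = {(0, 1)}"
| "extending_edges TypeG2 = {(0, 1)}"

fun affine_edges :: "affine_type \<Rightarrow> (nat \<times> nat) set" where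
  "affine_edges (Untwisted X) = finite_edges X \<union> extending_edges X"
| "affine_edges (TwistedA_even n) = path_edges 0 n"
| "affine_edges (TwistedA_odd n) = path_edges 1 n \<union> {(0, 2)}"
| "affine_edges (TwistedD n) = path_edges 0 n"
| "affine_edges TwistedE6 = path_edges 0 4"

text \<open>Squared lengths of the simple roots, up to a common factor.\<close>
fun sqlen :: "affine_type \<Rightarrow> nat \<Rightarrow> int" where
  "sqlen (Untwisted (TypeA n)) i = 1"
| "sqlen (Untwisted (TypeB n)) i = (if i = n then 1 else 2)"
| "sqlen (Untwisted (TypeC n)) i = (if i = 0 \<or> i = n then 2 else 1)"
| "sqlen (Untwisted (TypeD n)) i = 1"
| "sqlen (Untwisted (TypeE n)) i = 1"
| "sqlen (Untwisted TypeF4) i = (if i \<le> 2 then 2 else 1)"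
| "sqlen (Untwisted TypeG2) i = (if i \<le> 1 then 3 else 1)"
| "sqlen (TwistedA_even n) i = (if i = 0 then 1 else if i = n then 4 else 2)"
| "sqlen (TwistedA_odd n) i = (if i = n then 2 else 1)"
| "sqlen (TwistedD n) i = (if i = 0 \<or> i = n then 1 else 2)"
| "sqlen TwistedE6 i = (if i \<ge> 3 then 2 else 1)"

text \<open>The labels \<open>a\<^sub>0, ..., a\<^sub>n\<close> (values at i > n are irrelevant).\<close>
fun label :: "affine_type \<Rightarrow> nat \<Rightarrow> nat" where
  "label (Untwisted (TypeA n)) i = 1"
| "label (Untwisted (TypeB n)) i = (if i \<le> 1 then 1 else 2)"
| "label (Untwisted (TypeC n)) i = (if i = 0 \<or> i = n then 1 else 2)"
| "label (Untwisted (TypeD n)) i = (if i \<le> 1 \<or> i = n - 1 \<or> i = n then 1 else 2)"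
| "label (Untwisted (TypeE n)) i =
     (if n = 6 then [1, 1, 2, 2, 3, 2, 1] ! i
      else if n = 7 then [1, 2, 2, 3, 4, 3, 2, 1] ! i
      else [1, 2, 3, 4, 6, 5, 4, 3, 2] ! i)"
| "label (Untwisted TypeF4) i = [1, 2, 3, 4, 2] ! i"
| "label (Untwisted TypeG2) i = [1, 2, 3] ! i"
| "label (TwistedA_even n) i = (if i = n then 1 else 2)"
| "label (TwistedA_odd n) i = (if i \<le> 1 \<or> i = n then 1 else 2)"
| "label (TwistedD n) i = 1"
| "label TwistedE6 i = [1, 2, 3, 2, 1] ! i"

text \<open>The Cartan integer \<open>a\<^sub>i\<^sub>j = 2 (\<alpha>\<^sub>i | \<alpha>\<^sub>j) / (\<alpha>\<^sub>i | \<alpha>\<^sub>i)\<close>. For two joined nodes one of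
  \<open>a\<^sub>i\<^sub>j\<close> and \<open>a\<^sub>j\<^sub>i\<close> is -1, so the squared lengths determine both entries; the only exception is
  \<open>A\<^sub>1\<^sup>(\<^sup>1\<^sup>)\<close>, where both are -2.\<close>
definition cartan :: "affine_type \<Rightarrow> nat \<Rightarrow> nat \<Rightarrow> int" where
  "cartan t i j =
     (if i = j then 2
      else if (i, j) \<in> affine_edges t \<or> (j, i) \<in> affine_edges t then
        (if t = Untwisted (TypeA 1) then -2 else - (max (sqlen t i) (sqlen t j) div sqlen t i))
      else 0)"

text \<open>The Cartan matrix of the finite type X, on the nodes 1, ..., \<open>finite_rank X\<close>.\<close>
definition finite_cartan :: "finite_type \<Rightarrow> nat \<Rightarrow> nat \<Rightarrow> int" where
  "finite_cartan X = cartan (Untwisted X)"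


section \<open>Affine root systems and Weyl groups\<close>

text \<open>An element \<open>m\<^sub>0 \<alpha>\<^sub>0 + ... + m\<^sub>n \<alpha>\<^sub>n\<close> of the root lattice is the function \<open>i \<mapsto> m\<^sub>i\<close>, zero for
  i > n. Weyl group elements are represented as maps on all functions of this type; they leave the
  coordinates beyond n unchanged, so that equality of maps is equality in the Weyl group (which acts
  faithfully on the root lattice).\<close>
type_synonym root_vec = "nat \<Rightarrow> int"

definition simple_root :: "nat \<Rightarrow> root_vec" where
  "simple_root i = (\<lambda>j. if j = i then 1 else 0)"

definition simple_reflection :: "affine_type \<Rightarrow> nat \<Rightarrow> root_vec \<Rightarrow> root_vec" where
  "simple_reflection t i v = v(i := v i - (\<Sum>j\<le>affine_rank t. cartan t i j * v j))"

text \<open>The group generated by the simple reflections with index in J. These are involutions, so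
  closure under products suffices.\<close>
inductive_set weyl_subgroup :: "affine_type \<Rightarrow> nat set \<Rightarrow> (root_vec \<Rightarrow> root_vec) set"
  for t :: affine_type and J :: "nat set" where
  weyl_id: "id \<in> weyl_subgroup t J"
| weyl_step: "\<lbrakk>i \<in> J; w \<in> weyl_subgroup t J\<rbrakk> \<Longrightarrow> simple_reflection t i \<circ> w \<in> weyl_subgroup t J"

definition affine_weyl_group :: "affine_type \<Rightarrow> (root_vec \<Rightarrow> root_vec) set" where
  "affine_weyl_group t = weyl_subgroup t {0..affine_rank t}"

definition W_f :: "affine_type \<Rightarrow> (root_vec \<Rightarrow> root_vec) set" where
  "W_f t = weyl_subgroup t {1..affine_rank t}"

definition W_sigma :: "affine_type \<Rightarrow> (nat \<Rightarrow> nat) \<Rightarrow> (root_vec \<Rightarrow> root_vec) set" where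
  "W_sigma t s = weyl_subgroup t {i. i \<le> affine_rank t \<and> s i = 0}"

definition real_roots :: "affine_type \<Rightarrow> root_vec set" where
  "real_roots t = {w (simple_root i) | w i. w \<in> affine_weyl_group t \<and> i \<le> affine_rank t}"

definition delta :: "affine_type \<Rightarrow> root_vec" where
  "delta t = (\<lambda>i. if i \<le> affine_rank t then int (label t i) else 0)"

definition imaginary_roots :: "affine_type \<Rightarrow> root_vec set" where
  "imaginary_roots t = {(\<lambda>i. m * delta t i) | m. m \<noteq> 0}"

definition affine_roots :: "affine_type \<Rightarrow> root_vec set" where
  "affine_roots t = real_roots t \<union> imaginary_roots t"

definition positive_roots :: "affine_type \<Rightarrow> root_vec set" where
  "positive_roots t = {\<alpha> \<in> affine_roots t. \<forall>i. \<alpha> i \<ge> 0}"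

text \<open>The invariant bilinear form, scaled so that \<open>(\<alpha>\<^sub>i | \<alpha>\<^sub>i)\<close> is twice \<open>sqlen t i\<close>.\<close>
definition inv_form :: "affine_type \<Rightarrow> root_vec \<Rightarrow> root_vec \<Rightarrow> int" where
  "inv_form t v w =
     (\<Sum>i\<le>affine_rank t. \<Sum>j\<le>affine_rank t. sqlen t i * cartan t i j * v i * w j)"

definition long_root :: "affine_type \<Rightarrow> root_vec \<Rightarrow> bool" where
  "long_root t \<alpha> \<longleftrightarrow>
     \<alpha> \<in> real_roots t \<and> (\<forall>\<beta>\<in>real_roots t. inv_form t \<beta> \<beta> \<le> inv_form t \<alpha> \<alpha>)"

definition chi_long :: "affine_type \<Rightarrow> root_vec \<Rightarrow> nat" where
  "chi_long t \<alpha> = (if long_root t \<alpha> then 1 else 0)"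

definition Pi_f :: "affine_type \<Rightarrow> root_vec set" where
  "Pi_f t = simple_root ` {1..affine_rank t}"

definition num_long_simple :: "affine_type \<Rightarrow> nat" where
  "num_long_simple t = card {\<alpha> \<in> Pi_f t. long_root t \<alpha>}"

definition ht_sigma :: "affine_type \<Rightarrow> (nat \<Rightarrow> nat) \<Rightarrow> root_vec \<Rightarrow> int" where
  "ht_sigma t s \<alpha> = (\<Sum>i\<le>affine_rank t. int (s i) * \<alpha> i)"

definition inversion_set :: "affine_type \<Rightarrow> (root_vec \<Rightarrow> root_vec) \<Rightarrow> root_vec set" where
  "inversion_set t w = {\<beta> \<in> positive_roots t. (\<lambda>i. - inv w \<beta> i) \<in> positive_roots t}"

definition W_ab :: "affine_type \<Rightarrow> (nat \<Rightarrow> nat) \<Rightarrow> (root_vec \<Rightarrow> root_vec) set" where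
  "W_ab t s = {w \<in> affine_weyl_group t.
     inversion_set t w \<subseteq> {\<alpha> \<in> affine_roots t. ht_sigma t s \<alpha> = 1}}"


section \<open>Automorphisms of type (s; k)\<close>

text \<open>The node whose Chevalley generator has degree 1 in the twisted loop realization; it is n for
  \<open>A\<^sub>2\<^sub>n\<^sup>(\<^sup>2\<^sup>)\<close> and 0 otherwise.\<close>
fun loop_node :: "affine_type \<Rightarrow> nat" where
  "loop_node (TwistedA_even n) = n"
| "loop_node (Untwisted X) = 0"
| "loop_node (TwistedA_odd n) = 0"
| "loop_node (TwistedD n) = 0"
| "loop_node TwistedE6 = 0"

context complex_lie_algebra
begin

text \<open>A diagram automorphism of order k of the Lie algebra of type \<open>X\<^sub>N\<close>, where t is \<open>X\<^sub>N\<^sup>(\<^sup>k\<^sup>)\<close>; for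
  k = 1 it is the identity.\<close>
definition diagram_automorphism :: "affine_type \<Rightarrow> ('g \<Rightarrow> 'g) \<Rightarrow> bool" where
  "diagram_automorphism t \<mu> \<longleftrightarrow>
     automorphism \<mu> \<and> has_order \<mu> (twist t) \<and>
     (let X = underlying_type t; I = {1..finite_rank X} in
      \<exists>E' F' \<pi>. chevalley_generators UNIV I (finite_cartan X) E' F' \<and> bij_betw \<pi> I I \<and>
        (\<forall>i\<in>I. \<mu> (E' i) = E' (\<pi> i) \<and> \<mu> (F' i) = F' (\<pi> i)))"

text \<open>The images at \<open>t = 1\<close> of the Chevalley generators \<open>e\<^sub>0, ..., e\<^sub>n\<close> in the loop realization
  attached to \<open>\<mu>\<close>. Writing \<open>\<epsilon>\<close> for the loop node, \<open>e\<^sub>i = 1 \<otimes> E\<^sub>i\<close> for \<open>i \<noteq> \<epsilon>\<close>, where these \<open>E\<^sub>i\<close> are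
  Chevalley generators of the fixed algebra of \<open>\<mu>\<close>, and \<open>e\<^sub>\<epsilon> = t \<otimes> E\<^sub>\<epsilon>\<close>, where \<open>E\<^sub>\<epsilon>\<close> is a lowest weight
  vector of the eigenspace of \<open>\<mu>\<close> for \<open>exp (2 \<pi> \<i> / k)\<close>, an irreducible module over the fixed
  algebra. For k = 1 the latter is a lowest root vector of the whole algebra.\<close>
definition loop_generators :: "affine_type \<Rightarrow> (nat \<Rightarrow> 'g) \<Rightarrow> bool" where
  "loop_generators t E \<longleftrightarrow>
     (let \<epsilon> = loop_node t; I = {0..affine_rank t} - {\<epsilon>} in
      \<exists>\<mu> F. diagram_automorphism t \<mu> \<and>
        chevalley_generators (fixed_points \<mu>) I (cartan t) E F \<and>
        E \<epsilon> \<noteq> 0 \<and> \<mu> (E \<epsilon>) = scale (cis (2 * pi / real (twist t))) (E \<epsilon>) \<and>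
        (\<forall>i\<in>I. bracket (F i) (E \<epsilon>) = 0))"

definition automorphism_of_type ::
  "affine_type \<Rightarrow> (nat \<Rightarrow> nat) \<Rightarrow> ('g \<Rightarrow> 'g) \<Rightarrow> bool" where
  "automorphism_of_type t s \<sigma> \<longleftrightarrow> automorphism \<sigma> \<and>
     (\<exists>E. loop_generators t E \<and> (\<forall>i\<le>affine_rank t. \<sigma> (E i) = scale ((-1) ^ s i) (E i)))"

end

end

(*
  Let p be the marked node, so that k a_p = 2, and let ht denote
  the p-th coordinate. Write kappa = k delta, a vector of height 2; adding multiples of kappa permutes
  the real roots. The roots of even height form an affine root system, whose fundamental chamber is a
  union of alcoves; let X be the corresponding set of Weyl group elements. The affine Weyl group
  factors uniquely both as T' W_sigma X, with T' the translations by k times the coroot lattice of the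
  roots of height 0, and as T' R W_f, with R a set of representatives of the full translation lattice
  modulo T'. Hence |W_sigma| |X| = |R| |W_f|, and |R| is an index of two explicit lattices.

  The sigma-minuscule elements are the w in X for which w^{-1} does not make kappa + alpha_p negative.
  If alpha_p is short, this excludes nothing. If alpha_p is long, it excludes exactly one element: for
  such a w the sign of w^{-1} on a root b + q kappa with b of height 1 is forced to be that of
  q - <b, alpha_p^vee> (zero counting as positive), so w is unique, and it exists because the
  corresponding chamber contains a point.
*)
theory Submission
  imports Defs "HOL-Library.Function_Algebras" "HOL-Library.FuncSet"
begin

text \<open>The factor \<open>a_0 (chi + 1) k^(n-L)\<close> of the formula is exactly |R|. The
  simple coroots satisfy one relation, with coefficients proportional to \<open>a i * sq i\<close>;
  leaving out node p instead of node 0 costs its p-th coefficient (scaled to 1 at node 0), and each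
  node i \<ge> 1 costs k divided by the least multiple \<open>r i\<close> of its coroot in the
  translation lattice. Length matters because for short \<open>\<alpha> p\<close> a positive
  multiple of \<open>\<kappa> + \<alpha> p\<close> is a sum of roots of height 2 and multiples of
  \<open>\<delta>\<close>, which no element of X makes negative. Two obstacles shape the setup. Real
  roots are given as orbits, where invariance under adding \<open>\<kappa>\<close> is invisible, so
  they are redescribed by norm and divisibility. Alcoves and points never appear as geometry: an
  element w is known by the signs of its inverse on roots, and a point is an integer functional that
  finitely many simple reflections make dominant.\<close>

definition smul :: "int \<Rightarrow> root_vec \<Rightarrow> root_vec"  (infixr "*\<^sub>s" 75) where
  "c *\<^sub>s v = (\<lambda>i. c * v i)"

lemma smul_apply [simp]: "(c *\<^sub>s v) i = c * v i"
  by (simp add: smul_def)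

lemma uminus_vec_apply [simp]: "(- v) i = - (v i :: int)" for v :: root_vec
  by (simp add: fun_Compl_def)

lemma minus_vec_apply [simp]: "(v - w) i = v i - (w i :: int)" for v w :: root_vec
  by (simp add: fun_diff_def)

lemma smul_simps [simp]:
  "1 *\<^sub>s v = v" "0 *\<^sub>s v = 0" "(- 1) *\<^sub>s v = - v" "c *\<^sub>s (0 :: root_vec) = 0"
  by (auto simp: fun_eq_iff)

text \<open>Separates the diagonal from the rest, which is counted twice;
  \<open>form_divisible\<close> needs this factor 2.\<close>

lemma symmetric_double_sum:
  fixes g :: "nat \<Rightarrow> nat \<Rightarrow> int"
  assumes "\<And>i j. i \<le> n \<Longrightarrow> j \<le> n \<Longrightarrow> g i j = g j i"
  shows "(\<Sum>i\<le>n. \<Sum>j\<le>n. g i j) = (\<Sum>i\<le>n. g i i) + 2 * (\<Sum>i\<le>n. \<Sum>j<i. g i j)"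
  using assms
proof (induction n)
  case (Suc n)
  have "(\<Sum>i\<le>n. g i (Suc n)) = (\<Sum>j\<le>n. g (Suc n) j)"
    by (rule sum.cong) (auto intro: Suc.prems)
  then show ?case
    using Suc by (simp add: sum.distrib lessThan_Suc_atMost)
qed simp

section \<open>The invariant form\<close>

text \<open>The general argument works from such properties, and the tables return only in the final
  case distinction. Connectedness is stated as an induction principle: what holds at one node and
  passes along edges holds everywhere.\<close>

locale affine_diagram =
  fixes t :: affine_type
  assumes sq_pos: "i \<le> affine_rank t \<Longrightarrow> 0 < sqlen t i"
    and label_pos: "i \<le> affine_rank t \<Longrightarrow> 0 < label t i"
    and cartan_nonpos: "i \<le> affine_rank t \<Longrightarrow> j \<le> affine_rank t \<Longrightarrow> i \<noteq> j \<Longrightarrow> cartan t i j \<le> 0"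
    and cartan_sym: "i \<le> affine_rank t \<Longrightarrow> j \<le> affine_rank t \<Longrightarrow>
      sqlen t i * cartan t i j = sqlen t j * cartan t j i"
    and cartan_label: "i \<le> affine_rank t \<Longrightarrow> (\<Sum>j\<le>affine_rank t. cartan t i j * int (label t j)) = 0"
    and connected: "\<lbrakk>S \<subseteq> {..affine_rank t}; S \<noteq> {};
      \<And>i j. i \<in> S \<Longrightarrow> j \<le> affine_rank t \<Longrightarrow> cartan t i j \<noteq> 0 \<Longrightarrow> j \<in> S\<rbrakk> \<Longrightarrow> S = {..affine_rank t}"
begin

abbreviation n where "n \<equiv> affine_rank t"
abbreviation sq where "sq \<equiv> sqlen t"
abbreviation A where "A \<equiv> cartan t"
abbreviation B where "B \<equiv> inv_form t"
abbreviation \<alpha> where "\<alpha> \<equiv> simple_root"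
abbreviation \<delta> where "\<delta> \<equiv> delta t"
abbreviation refl_simple where "refl_simple \<equiv> simple_reflection t"
abbreviation W where "W \<equiv> weyl_subgroup t"
abbreviation a where "a i \<equiv> int (label t i)"

definition pairing :: "nat \<Rightarrow> root_vec \<Rightarrow> int" where
  "pairing i v = (\<Sum>j\<le>n. A i j * v j)"

lemma cartan_diag [simp]: "A i i = 2"
  by (simp add: cartan_def)

lemma pairing_add [simp]: "pairing i (u + v) = pairing i u + pairing i v"
  by (simp add: pairing_def algebra_simps sum.distrib)

lemma pairing_diff [simp]: "pairing i (u - v) = pairing i u - pairing i v"
  by (simp add: pairing_def algebra_simps sum_subtractf)

lemma pairing_uminus [simp]: "pairing i (- v) = - pairing i v"
  by (simp add: pairing_def sum_negf)

lemma pairing_smul [simp]: "pairing i (c *\<^sub>s v) = c * pairing i v"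
  by (simp add: pairing_def sum_distrib_left mult_ac)

lemma pairing_simple: "j \<le> n \<Longrightarrow> pairing i (\<alpha> j) = A i j"
  by (simp add: pairing_def simple_root_def if_distrib cong: if_cong)

lemma pairing_delta [simp]: "i \<le> n \<Longrightarrow> pairing i \<delta> = 0"
  using cartan_label[of i] by (simp add: pairing_def delta_def)

lemma simple_reflection_eq: "refl_simple i v = v - pairing i v *\<^sub>s \<alpha> i"
  by (auto simp: simple_reflection_def pairing_def simple_root_def fun_eq_iff)

lemma form_eq: "B v w = (\<Sum>i\<le>n. sq i * v i * pairing i w)"
  by (simp add: inv_form_def pairing_def sum_distrib_left mult_ac)

lemma form_add_right [simp]: "B u (v + w) = B u v + B u w"
  by (simp add: form_eq algebra_simps sum.distrib)
lemma form_add_left [simp]: "B (u + v) w = B u w + B v w"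
  by (simp add: form_eq algebra_simps sum.distrib)
lemma form_diff_right [simp]: "B u (v - w) = B u v - B u w"
  by (simp add: form_eq algebra_simps sum_subtractf)
lemma form_diff_left [simp]: "B (u - v) w = B u w - B v w"
  by (simp add: form_eq algebra_simps sum_subtractf)
lemma form_smul_right [simp]: "B u (c *\<^sub>s w) = c * B u w"
  by (simp add: form_eq sum_distrib_left mult_ac)
lemma form_smul_left [simp]: "B (c *\<^sub>s u) w = c * B u w"
  by (simp add: form_eq sum_distrib_left mult_ac)
lemma form_uminus_left [simp]: "B (- u) w = - B u w"
  by (simp add: form_eq sum_negf)
lemma form_uminus_right [simp]: "B u (- w) = - B u w"
  by (simp add: form_eq sum_negf)

lemma form_sym: "B u v = B v u"
proof -
  have "B u v = (\<Sum>j\<le>n. \<Sum>i\<le>n. sq i * A i j * u i * v j)"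
    unfolding inv_form_def by (rule sum.swap)
  also have "\<dots> = B v u"
    unfolding inv_form_def by (intro sum.cong refl) (simp add: cartan_sym mult_ac)
  finally show ?thesis .
qed

lemma form_simple: "i \<le> n \<Longrightarrow> B (\<alpha> i) v = sq i * pairing i v"
  by (simp add: form_eq simple_root_def if_distrib if_distribR cong: if_cong)

lemma form_delta_right [simp]: "B v \<delta> = 0"
  by (simp add: form_eq)
lemma form_delta_left [simp]: "B \<delta> v = 0"
  using form_sym[of \<delta> v] by simp

lemma form_simple_reflection: "i \<le> n \<Longrightarrow> B (refl_simple i u) (refl_simple i v) = B u v"
  using form_sym[of u "\<alpha> i"]
  by (simp add: simple_reflection_eq form_simple pairing_simple algebra_simps)

text \<open>The symmetrised Cartan matrix has nonpositive entries off the diagonal and annihilates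
  the labels, so the form is a weighted sum of squared differences of the ratios
  \<open>v i / label t i\<close>. Semidefiniteness, the radical and the finiteness statements are
  read off from this.\<close>

lemma form_as_squares:
  "2 * real_of_int (B v v) = (\<Sum>i\<le>n. \<Sum>j\<le>n. - real_of_int (sq i * A i j) * real (label t i) * real (label t j) *
     (v i / label t i - v j / label t j)\<^sup>2)"
proof -
  define b where "b i j = real_of_int (sq i * A i j)" for i j
  define l where "l i = real (label t i)" for i
  define u where "u i = v i / l i" for i
  have l: "l i > 0" if "i \<le> n" for i
    using label_pos[OF that] by (simp add: l_def)
  have vi: "real_of_int (v i) = l i * u i" if "i \<le> n" for i
    using l[OF that] by (simp add: u_def)
  have b_sym: "b i j = b j i" if "i \<le> n" "j \<le> n" for i j
    using cartan_sym[OF that] by (simp only: b_def)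
  have row: "(\<Sum>j\<le>n. b i j * l j) = 0" if "i \<le> n" for i
  proof -
    have "(\<Sum>j\<le>n. b i j * l j) = real_of_int (sq i * (\<Sum>j\<le>n. A i j * a j))"
      by (simp add: b_def l_def sum_distrib_left mult_ac)
    then show ?thesis
      using cartan_label[OF that] by simp
  qed
  have e1: "(\<Sum>i\<le>n. \<Sum>j\<le>n. b i j * l i * l j * (u i)\<^sup>2) = 0"
  proof (rule sum.neutral, safe)
    fix i assume "i \<le> n"
    have "(\<Sum>j\<le>n. b i j * l i * l j * (u i)\<^sup>2) = l i * (u i)\<^sup>2 * (\<Sum>j\<le>n. b i j * l j)"
      by (simp add: sum_distrib_left mult_ac)
    then show "(\<Sum>j\<le>n. b i j * l i * l j * (u i)\<^sup>2) = 0"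
      using row[OF \<open>i \<le> n\<close>] by simp
  qed
  have "(\<Sum>i\<le>n. \<Sum>j\<le>n. b i j * l i * l j * (u j)\<^sup>2) = (\<Sum>j\<le>n. \<Sum>i\<le>n. b i j * l i * l j * (u j)\<^sup>2)"
    by (rule sum.swap)
  also have "\<dots> = (\<Sum>i\<le>n. \<Sum>j\<le>n. b i j * l i * l j * (u i)\<^sup>2)"
    by (intro sum.cong refl) (simp add: b_sym mult_ac)
  finally have e2: "(\<Sum>i\<le>n. \<Sum>j\<le>n. b i j * l i * l j * (u j)\<^sup>2) = 0"
    using e1 by simp
  have e3: "(\<Sum>i\<le>n. \<Sum>j\<le>n. b i j * l i * l j * (u i * u j)) = real_of_int (B v v)"
    unfolding inv_form_def by (simp add: b_def vi mult_ac)
  have "(\<Sum>i\<le>n. \<Sum>j\<le>n. - b i j * l i * l j * (u i - u j)\<^sup>2) =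
      - (\<Sum>i\<le>n. \<Sum>j\<le>n. b i j * l i * l j * (u i)\<^sup>2)
      - (\<Sum>i\<le>n. \<Sum>j\<le>n. b i j * l i * l j * (u j)\<^sup>2)
      + 2 * (\<Sum>i\<le>n. \<Sum>j\<le>n. b i j * l i * l j * (u i * u j))"
    by (simp add: sum_distrib_left sum_negf[symmetric] sum_subtractf[symmetric]
        sum.distrib[symmetric] power2_eq_square algebra_simps)
  then show ?thesis
    unfolding e1 e2 e3 by (simp add: b_def l_def u_def)
qed

lemma form_term_nonneg:
  assumes "i \<le> n" "j \<le> n"
  shows "0 \<le> - real_of_int (sq i * A i j) * real (label t i) * real (label t j) *
     (v i / label t i - v j / label t j)\<^sup>2"
proof (cases "i = j")
  case False
  have "0 \<le> sq i * - A i j"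
    using sq_pos[OF assms(1)] cartan_nonpos[OF assms False] by (intro mult_nonneg_nonneg) auto
  then have "0 \<le> - real_of_int (sq i * A i j)"
    by (metis mult_minus_right of_int_0_le_iff of_int_minus)
  then show ?thesis
    by (intro mult_nonneg_nonneg) auto
qed simp

lemma form_term_le:
  assumes "i \<le> n" "j \<le> n"
  shows "- real_of_int (sq i * A i j) * real (label t i) * real (label t j) *
     (v i / label t i - v j / label t j)\<^sup>2 \<le> 2 * real_of_int (B v v)" (is "?g i j \<le> _")
proof -
  have "?g i j \<le> (\<Sum>j\<le>n. ?g i j)"
    using assms by (intro member_le_sum[where f = "?g i"] form_term_nonneg) auto
  also have "\<dots> \<le> (\<Sum>i\<le>n. \<Sum>j\<le>n. ?g i j)"
    using assms by (intro member_le_sum[where f = "\<lambda>i. \<Sum>j\<le>n. ?g i j"] sum_nonneg form_term_nonneg) auto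
  finally show ?thesis
    by (simp add: form_as_squares)
qed

lemma form_nonneg: "0 \<le> B v v"
proof -
  have "0 \<le> 2 * real_of_int (B v v)"
    unfolding form_as_squares by (intro sum_nonneg form_term_nonneg) auto
  then show ?thesis by simp
qed

text \<open>The weight of an edge in \<open>form_as_squares\<close> is a positive integer, so a
  single edge is bounded by the whole form.\<close>

lemma adjacent_diff_bound:
  assumes "i \<le> n" "j \<le> n" "A i j \<noteq> 0" "i \<noteq> j"
  shows "(v i / label t i - v j / label t j)\<^sup>2 \<le> 2 * real_of_int (B v v)"
proof -
  let ?x = "(v i / label t i - v j / label t j)\<^sup>2"
  let ?c = "- real_of_int (sq i * A i j) * real (label t i) * real (label t j)"
  have "1 \<le> sq i * - A i j * (a i * a j)"
    using sq_pos[OF assms(1)] cartan_nonpos[OF assms(1,2,4)] assms(3) label_pos[OF assms(1)] label_pos[OF assms(2)]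
    by (metis add_0 int_one_le_iff_zero_less less_le mult_pos_pos neg_0_less_iff_less of_nat_0_less_iff)
  then have "1 \<le> real_of_int (sq i * - A i j * (a i * a j))"
    by (metis of_int_1_le_iff)
  then have "1 \<le> ?c"
    by (simp add: mult_ac)
  then have "?x \<le> ?c * ?x"
    by (metis mult_right_mono mult_1 zero_le_power2)
  then show ?thesis
    using form_term_le[OF assms(1,2), of v] by linarith
qed

text \<open>No edge may contribute, so the ratios to the labels agree across edges and hence
  everywhere: the radical is the line of \<open>\<delta>\<close>.\<close>

lemma form_null:
  assumes "B v v = 0" "i \<le> n" "j \<le> n"
  shows "v i * a j = v j * a i"
proof -
  define S where "S = {j. j \<le> n \<and> v i / label t i = v j / label t j}"
  have "S = {..n}"
  proof (rule connected)
    fix j l assume "j \<in> S" "l \<le> n" "A j l \<noteq> 0"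
    show "l \<in> S"
    proof (cases "j = l")
      case False
      then have "(v j / label t j - v l / label t l)\<^sup>2 \<le> 0"
        using adjacent_diff_bound[of j l v] \<open>j \<in> S\<close> \<open>l \<le> n\<close> \<open>A j l \<noteq> 0\<close> assms(1) by (simp add: S_def)
      then show ?thesis
        using \<open>j \<in> S\<close> \<open>l \<le> n\<close> by (simp add: S_def)
    qed (use \<open>j \<in> S\<close> in simp)
  qed (use assms(2) in \<open>auto simp: S_def\<close>)
  then have "v i / label t i = v j / label t j"
    using assms(3) by (auto simp: S_def)
  then have "real_of_int (v i * a j) = real_of_int (v j * a i)"
    using label_pos[OF assms(2)] label_pos[OF assms(3)] by (simp add: field_simps)
  then show ?thesis
    by (simp only: of_int_eq_iff)
qed

lemma form_null_zero:
  assumes "B v v = 0" "q \<le> n" "v q = 0" "\<And>i. i > n \<Longrightarrow> v i = 0"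
  shows "v = 0"
proof
  fix i
  show "v i = 0 i"
    using form_null[OF assms(1,2), of i] assms(3,4) label_pos[OF assms(2)] by (cases "i \<le> n") auto
qed

text \<open>One bounded coordinate bounds one ratio to the labels, and a bounded form lets the ratio
  change only by a bounded amount along each edge.\<close>

lemma bounded_vectors_finite:
  assumes "q \<le> n"
  shows "finite {v. (\<forall>i>n. v i = 0) \<and> \<bar>v q\<bar> \<le> c \<and> B v v \<le> N}" (is "finite ?V")
proof -
  define S where "S = {i. i \<le> n \<and> (\<exists>C::real. \<forall>v\<in>?V. \<bar>v i / label t i\<bar> \<le> C)}"
  have "S = {..n}"
  proof (rule connected)
    have "\<bar>v q / label t q\<bar> \<le> c / label t q" if "v \<in> ?V" for v
    proof -
      have "real_of_int \<bar>v q\<bar> \<le> c" using that by (simp only: of_int_le_iff) simp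
      then show ?thesis by (simp add: divide_right_mono)
    qed
    then have "q \<in> S" using assms by (auto simp: S_def)
    then show "S \<noteq> {}" by auto
  next
    fix j l assume jl: "j \<in> S" "l \<le> n" "A j l \<noteq> 0"
    show "l \<in> S"
    proof (cases "j = l")
      case False
      obtain C where C: "\<And>v. v \<in> ?V \<Longrightarrow> \<bar>v j / label t j\<bar> \<le> C" and "j \<le> n"
        using jl(1) by (auto simp: S_def)
      have "\<bar>v l / label t l\<bar> \<le> C + sqrt (2 * real_of_int N)" if v: "v \<in> ?V" for v
      proof -
        have "(v j / label t j - v l / label t l)\<^sup>2 \<le> 2 * real_of_int (B v v)"
          by (rule adjacent_diff_bound[OF \<open>j \<le> n\<close> jl(2,3) False])
        also have "\<dots> \<le> 2 * real_of_int N" using v by simp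
        finally have "\<bar>v j / label t j - v l / label t l\<bar> \<le> sqrt (2 * real_of_int N)"
          by (metis real_sqrt_abs real_sqrt_le_mono)
        then show ?thesis using C[OF v] by linarith
      qed
      then show ?thesis using jl(2) by (auto simp: S_def)
    qed (use jl in simp)
  qed (auto simp: S_def)
  then have "\<forall>i\<in>{..n}. \<exists>C::real. \<forall>v\<in>?V. \<bar>v i / label t i\<bar> \<le> C" unfolding S_def by blast
  then obtain C :: "nat \<Rightarrow> real" where C: "\<forall>i\<in>{..n}. \<forall>v\<in>?V. \<bar>v i / label t i\<bar> \<le> C i"
    using bchoice[of "{..n}" "\<lambda>i C. \<forall>v\<in>?V. \<bar>v i / label t i\<bar> \<le> C"] by blast
  define D where "D = (\<Sum>i\<le>n. \<lceil>\<bar>C i * label t i\<bar>\<rceil>)"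
  have D: "v i \<in> {-D..D}" if "v \<in> ?V" "i \<le> n" for v i
  proof -
    have "\<bar>v i / label t i\<bar> \<le> C i" using C that by auto
    then have "\<bar>real_of_int (v i)\<bar> \<le> C i * label t i"
      using label_pos[OF that(2)] by (simp add: field_simps)
    then have "\<bar>v i\<bar> \<le> \<lceil>\<bar>C i * label t i\<bar>\<rceil>" by linarith
    also have "\<dots> \<le> D"
      unfolding D_def using that(2) by (intro member_le_sum) auto
    finally show ?thesis by auto
  qed
  have "?V \<subseteq> {v. \<forall>i. (i \<in> {..n} \<longrightarrow> v i \<in> {-D..D}) \<and> (i \<notin> {..n} \<longrightarrow> v i = 0)}"
    using D by auto
  then show ?thesis
    by (rule finite_subset) (rule finite_set_of_finite_funs; simp)
qed

section \<open>The Weyl group\<close>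

lemma simple_reflection_simple: "i \<le> n \<Longrightarrow> refl_simple i (\<alpha> i) = - \<alpha> i"
  by (simp add: simple_reflection_eq pairing_simple fun_eq_iff)

lemma simple_reflection_invol: "i \<le> n \<Longrightarrow> refl_simple i \<circ> refl_simple i = id"
  by (simp add: simple_reflection_eq pairing_simple fun_eq_iff)

lemma weyl_bij: "w \<in> W J \<Longrightarrow> J \<subseteq> {..n} \<Longrightarrow> bij w"
proof (induction rule: weyl_subgroup.induct)
  case (weyl_step i w)
  then have "bij (refl_simple i)"
    using o_bij[OF simple_reflection_invol simple_reflection_invol] by blast
  then show ?case using weyl_step by (metis bij_comp)
qed simp

lemma weyl_comp: "v \<in> W J \<Longrightarrow> w \<in> W J \<Longrightarrow> v \<circ> w \<in> W J"
proof (induction rule: weyl_subgroup.induct)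
  case (weyl_step i v)
  then show ?case by (metis comp_assoc weyl_subgroup.weyl_step)
qed simp

lemma weyl_gen: "i \<in> J \<Longrightarrow> refl_simple i \<in> W J"
  using weyl_step[OF _ weyl_id] by simp

lemma weyl_mono: "w \<in> W J \<Longrightarrow> J \<subseteq> K \<Longrightarrow> w \<in> W K"
  by (induction rule: weyl_subgroup.induct) (auto intro: weyl_subgroup.intros)

lemma weyl_inv:
  assumes "w \<in> W J" "J \<subseteq> {..n}"
  shows "inv w \<in> W J"
  using assms(1)
proof (induction rule: weyl_subgroup.induct)
  case (weyl_step i w)
  have "i \<le> n" using weyl_step(1) assms(2) by auto
  then have s: "bij (refl_simple i)" "inv (refl_simple i) = refl_simple i"
    using weyl_bij[OF weyl_gen[OF weyl_step(1)] assms(2)] simple_reflection_invol[of i]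
      inv_unique_comp by auto
  have "inv (refl_simple i \<circ> w) = inv w \<circ> refl_simple i"
    using o_inv_distrib[OF s(1) weyl_bij[OF weyl_step(2) assms(2)]] s(2) by simp
  then show ?case
    using weyl_comp[OF weyl_step(3) weyl_gen[OF weyl_step(1)]] by (simp only:)
next
  case weyl_id
  show ?case by (subst inv_id) (rule weyl_subgroup.weyl_id)
qed

lemma simple_reflection_add: "refl_simple i (u + v) = refl_simple i u + refl_simple i v"
  by (simp add: simple_reflection_eq fun_eq_iff algebra_simps)

lemma simple_reflection_smul: "refl_simple i (c *\<^sub>s v) = c *\<^sub>s refl_simple i v"
  by (simp add: simple_reflection_eq fun_eq_iff algebra_simps)

lemma weyl_add: "w \<in> W J \<Longrightarrow> w (u + v) = w u + w v"
  by (induction rule: weyl_subgroup.induct) (simp_all only: id_apply comp_apply simple_reflection_add)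

lemma weyl_smul: "w \<in> W J \<Longrightarrow> w (c *\<^sub>s v) = c *\<^sub>s w v"
  by (induction rule: weyl_subgroup.induct) (simp_all only: id_apply comp_apply simple_reflection_smul)

lemma weyl_uminus: "w \<in> W J \<Longrightarrow> w (- v) = - w v"
  using weyl_smul[of w J "- 1" v] by simp

lemma weyl_diff: "w \<in> W J \<Longrightarrow> w (u - v) = w u - w v"
  using weyl_add[of w J u "- v"] weyl_uminus[of w J v] by simp

lemma weyl_form: "w \<in> W J \<Longrightarrow> J \<subseteq> {..n} \<Longrightarrow> B (w u) (w v) = B u v"
  by (induction rule: weyl_subgroup.induct) (auto simp: form_simple_reflection)

lemma weyl_delta: "w \<in> W J \<Longrightarrow> J \<subseteq> {..n} \<Longrightarrow> w \<delta> = \<delta>"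
  by (induction rule: weyl_subgroup.induct) (auto simp: simple_reflection_eq)

lemma weyl_coord: "w \<in> W J \<Longrightarrow> q \<notin> J \<Longrightarrow> w v q = v q"
  by (induction rule: weyl_subgroup.induct) (auto simp: simple_reflection_eq simple_root_def)

lemma weyl_inv_apply [simp]:
  assumes "w \<in> W J" "J \<subseteq> {..n}"
  shows "inv w (w v) = v" "w (inv w v) = v"
  using weyl_bij[OF assms] by (simp_all add: bij_is_inj bij_is_surj surj_f_inv_f)

lemma vec_expand:
  assumes "\<And>i. i > n \<Longrightarrow> v i = 0"
  shows "v = (\<lambda>j. \<Sum>i\<le>n. v i * \<alpha> i j)"
proof
  fix j
  show "v j = (\<Sum>i\<le>n. v i * \<alpha> i j)"
    using assms[of j] by (cases "j \<le> n") (simp_all add: simple_root_def if_distrib cong: if_cong)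
qed

lemma weyl_sum:
  assumes "w \<in> W J" "finite S"
  shows "w (\<lambda>j. \<Sum>i\<in>S. c i * u i j) = (\<lambda>j. \<Sum>i\<in>S. c i * w (u i) j)"
  using assms(2)
proof (induction S rule: finite_induct)
  case empty
  show ?case using weyl_smul[OF assms(1), of 0 "\<lambda>_. 0"] by (simp add: zero_fun_def)
next
  case (insert i S)
  have "w (\<lambda>j. \<Sum>i\<in>insert i S. c i * u i j) = w (c i *\<^sub>s u i + (\<lambda>j. \<Sum>i\<in>S. c i * u i j))"
    using insert by (intro arg_cong[of _ _ w]) (auto simp: fun_eq_iff)
  then show ?case
    using insert by (auto simp: weyl_add[OF assms(1)] weyl_smul[OF assms(1)] fun_eq_iff)
qed

lemma weyl_expand:
  assumes "w \<in> W J" "\<And>i. i > n \<Longrightarrow> v i = 0"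
  shows "w v = (\<lambda>j. \<Sum>i\<le>n. v i * w (\<alpha> i) j)"
proof -
  have "w v = w (\<lambda>j. \<Sum>i\<le>n. v i * \<alpha> i j)"
    using vec_expand[of v] assms(2) by simp
  then show ?thesis
    using weyl_sum[OF assms(1), of "{..n}" v \<alpha>] by simp
qed

lemma weyl_beyond:
  assumes "w \<in> W J" "J \<subseteq> {..n}" "\<And>i. i \<le> n \<Longrightarrow> v i = 0"
  shows "w v = v"
  using assms(1)
proof (induction rule: weyl_subgroup.induct)
  case (weyl_step i w)
  have "pairing i v = 0" using assms(3) by (simp add: pairing_def)
  then show ?case using weyl_step by (simp add: simple_reflection_eq)
qed simp

text \<open>Group elements are maps on all functions: the part beyond \<open>n\<close> is fixed, and
  the rest is a combination of simple roots.\<close>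

lemma weyl_eqI:
  assumes "v \<in> W J" "w \<in> W K" "J \<subseteq> {..n}" "K \<subseteq> {..n}" "\<And>i. i \<le> n \<Longrightarrow> v (\<alpha> i) = w (\<alpha> i)"
  shows "v = w"
proof
  fix x
  define x1 x2 :: root_vec where "x1 = (\<lambda>i. if i \<le> n then x i else 0)" and "x2 = (\<lambda>i. if i \<le> n then 0 else x i)"
  have x: "x = x1 + x2" by (auto simp: x1_def x2_def fun_eq_iff)
  have "v x1 = w x1"
    using weyl_expand[OF assms(1), of x1] weyl_expand[OF assms(2), of x1] assms(5)
    by (simp add: x1_def)
  moreover have "v x2 = w x2"
    using weyl_beyond[OF assms(1,3), of x2] weyl_beyond[OF assms(2,4), of x2] by (simp add: x2_def)
  ultimately show "v x = w x"
    unfolding x weyl_add[OF assms(1)] weyl_add[OF assms(2)] by simp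
qed

text \<open>Elements of \<open>W J\<close> preserve the form and the coordinate \<open>q\<close>, so
  the images of the simple roots, which determine the element, stay in a finite set.\<close>

lemma weyl_subgroup_finite:
  assumes "J \<subseteq> {..n}" "q \<le> n" "q \<notin> J"
  shows "finite (W J)"
proof -
  define N where "N = (\<Sum>i\<le>n. 2 * sq i)"
  define V where "V = {v. (\<forall>i>n. v i = 0) \<and> \<bar>v q\<bar> \<le> 1 \<and> B v v \<le> N}"
  have fin: "finite V" unfolding V_def by (rule bounded_vectors_finite[OF assms(2)])
  define \<Phi> where "\<Phi> w = (\<lambda>i. if i \<in> {..n} then w (\<alpha> i) else 0)" for w :: "root_vec \<Rightarrow> root_vec"
  have "\<Phi> ` W J \<subseteq> {f. \<forall>i. (i \<in> {..n} \<longrightarrow> f i \<in> V) \<and> (i \<notin> {..n} \<longrightarrow> f i = 0)}"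
  proof -
    have "w (\<alpha> i) \<in> V" if "w \<in> W J" "i \<le> n" for w i
    proof -
      have "B (w (\<alpha> i)) (w (\<alpha> i)) = 2 * sq i"
        using weyl_form[OF that(1) assms(1)] that(2) by (simp add: form_simple pairing_simple)
      also have "\<dots> \<le> N"
        unfolding N_def using that(2) sq_pos by (intro member_le_sum) (auto simp: less_imp_le)
      finally have "B (w (\<alpha> i)) (w (\<alpha> i)) \<le> N" .
      moreover have "w (\<alpha> i) q = \<alpha> i q"
        by (rule weyl_coord[OF that(1) assms(3)])
      moreover have "w (\<alpha> i) j = 0" if "j > n" for j
      proof -
        have "j \<notin> J" using assms(1) that by auto
        then have "w (\<alpha> i) j = \<alpha> i j" by (rule weyl_coord[OF \<open>w \<in> W J\<close>])
        then show ?thesis using that \<open>i \<le> n\<close> by (simp add: simple_root_def[of i])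
      qed
      ultimately show ?thesis
        by (simp add: V_def) (simp add: simple_root_def)
    qed
    then show ?thesis by (auto simp: \<Phi>_def)
  qed
  then have "finite (\<Phi> ` W J)"
    by (rule finite_subset) (rule finite_set_of_finite_funs; simp add: fin)
  moreover have "inj_on \<Phi> (W J)"
  proof (rule inj_onI)
    fix v w assume vw: "v \<in> W J" "w \<in> W J" "\<Phi> v = \<Phi> w"
    show "v = w"
    proof (rule weyl_eqI[OF vw(1,2) assms(1,1)])
      fix i assume "i \<le> n"
      then show "v (\<alpha> i) = w (\<alpha> i)" using fun_cong[OF vw(3), of i] by (simp add: \<Phi>_def)
    qed
  qed
  ultimately show ?thesis by (rule finite_imageD)
qed

section \<open>Real roots\<close>

text \<open>Real roots, characterised by their half norm \<open>m\<close> and by divisibility of their coordinates;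
  this description makes it visible which multiples of \<open>\<delta>\<close> may be added to a real root.\<close>
definition root_of_norm :: "int \<Rightarrow> root_vec \<Rightarrow> bool" where
  "root_of_norm m v \<longleftrightarrow> 0 < m \<and> (\<forall>i>n. v i = 0) \<and> B v v = 2 * m \<and> (\<forall>i\<le>n. m dvd sq i * v i)"

definition root :: "root_vec \<Rightarrow> bool" where
  "root v \<longleftrightarrow> (\<exists>m. root_of_norm m v)"

text \<open>The integer 2 (v | b) / (b | b). For a root \<open>b\<close> both divisions are exact,
  by the divisibility condition in \<open>root_of_norm\<close>.\<close>

definition coroot :: "root_vec \<Rightarrow> root_vec \<Rightarrow> int" where
  "coroot b v = B v b div (B b b div 2)"

definition reflection :: "root_vec \<Rightarrow> root_vec \<Rightarrow> root_vec" where
  "reflection b v = v - coroot b v *\<^sub>s b"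

definition pos :: "root_vec \<Rightarrow> bool" where
  "pos v \<longleftrightarrow> root v \<and> (\<forall>i. 0 \<le> v i)"

lemma root_of_norm_coroot:
  assumes "root_of_norm m b"
  shows "B v b = coroot b v * m"
proof -
  have "m dvd B b v"
    using assms unfolding form_eq root_of_norm_def by (auto intro!: dvd_sum)
  then show ?thesis
    using assms form_sym[of b v] by (simp add: coroot_def root_of_norm_def)
qed

lemma coroot_eqI:
  assumes "root_of_norm m b" "B v b = c * m"
  shows "coroot b v = c"
  using root_of_norm_coroot[OF assms(1), of v] assms by (simp add: root_of_norm_def)

lemma root_coroot_simps [simp]:
  assumes "root b"
  shows "coroot b (u + v) = coroot b u + coroot b v"
    "coroot b (u - v) = coroot b u - coroot b v"
    "coroot b (- v) = - coroot b v"
    "coroot b (c *\<^sub>s v) = c * coroot b v"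
    "coroot b b = 2" "coroot b \<delta> = 0"
proof -
  obtain m where m: "root_of_norm m b" using assms by (auto simp: root_def)
  show "coroot b (u + v) = coroot b u + coroot b v"
    "coroot b (u - v) = coroot b u - coroot b v"
    "coroot b (- v) = - coroot b v"
    "coroot b (c *\<^sub>s v) = c * coroot b v"
    by (rule coroot_eqI[OF m],
      simp only: form_add_left form_diff_left form_uminus_left form_smul_left,
      simp add: root_of_norm_coroot[OF m] algebra_simps)+
  show "coroot b \<delta> = 0"
    by (rule coroot_eqI[OF m]) simp
  show "coroot b b = 2"
    using m by (intro coroot_eqI[OF m]) (simp add: root_of_norm_def)
qed

lemma root_of_norm_uminus [simp]: "root_of_norm m (- v) \<longleftrightarrow> root_of_norm m v"
  by (simp add: root_of_norm_def)

lemma root_uminus [simp]: "root (- v) \<longleftrightarrow> root v"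
  by (simp add: root_def)

lemma root_of_norm_simple: "i \<le> n \<Longrightarrow> root_of_norm (sq i) (\<alpha> i)"
  using sq_pos[of i] unfolding root_of_norm_def
  by (simp add: form_simple pairing_simple) (simp add: simple_root_def)

lemma root_simple [simp]: "i \<le> n \<Longrightarrow> root (\<alpha> i)"
  using root_of_norm_simple by (auto simp: root_def)

lemma coroot_simple: "i \<le> n \<Longrightarrow> coroot (\<alpha> i) v = pairing i v"
  by (rule coroot_eqI[OF root_of_norm_simple]) (simp_all add: form_sym[of v] form_simple)

lemma reflection_simple: "i \<le> n \<Longrightarrow> reflection (\<alpha> i) = refl_simple i"
  by (simp add: reflection_def simple_reflection_eq coroot_simple fun_eq_iff)

lemma root_of_norm_simple_reflection:
  assumes "i \<le> n" "root_of_norm m v"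
  shows "root_of_norm m (refl_simple i v)"
proof -
  have "m dvd sq i * pairing i v"
    using root_of_norm_coroot[OF assms(2), of "\<alpha> i"] form_simple[OF assms(1)] by simp
  then have "m dvd sq j * refl_simple i v j" if "j \<le> n" for j
    using assms(2) that
    by (cases "j = i") (auto simp: root_of_norm_def simple_reflection_eq simple_root_def algebra_simps)
  then show ?thesis
    using assms form_simple_reflection[OF assms(1), of v v]
    by (auto simp: root_of_norm_def simple_reflection_eq simple_root_def)
qed

lemma root_of_norm_weyl: "w \<in> W J \<Longrightarrow> J \<subseteq> {..n} \<Longrightarrow> root_of_norm m v \<Longrightarrow> root_of_norm m (w v)"
  by (induction rule: weyl_subgroup.induct) (auto intro: root_of_norm_simple_reflection)

lemma root_weyl: "w \<in> W J \<Longrightarrow> J \<subseteq> {..n} \<Longrightarrow> root v \<Longrightarrow> root (w v)"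
  unfolding root_def using root_of_norm_weyl by blast

text \<open>Diagonal terms have a factor 2 from the Cartan matrix, the others occur twice by
  symmetry. So in this divisibility class no form value lies strictly between 0 and 2m.\<close>

lemma form_divisible:
  assumes "\<And>i. i \<le> n \<Longrightarrow> m dvd sq i * v i"
  shows "2 * m dvd B v v"
proof -
  have "B v v = (\<Sum>i\<le>n. sq i * A i i * v i * v i) + 2 * (\<Sum>i\<le>n. \<Sum>j<i. sq i * A i j * v i * v j)"
    unfolding inv_form_def by (rule symmetric_double_sum) (simp add: cartan_sym mult_ac)
  moreover have "2 * m dvd (\<Sum>i\<le>n. sq i * A i i * v i * v i)"
  proof (rule dvd_sum)
    fix i assume "i \<in> {..n}"
    then have "2 * m dvd (2 * (sq i * v i)) * v i"
      by (intro dvd_mult2[of "2 * m" "2 * (sq i * v i)"]) (simp add: assms)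
    then show "2 * m dvd sq i * A i i * v i * v i" by (simp add: mult_ac)
  qed
  moreover have "m dvd (\<Sum>i\<le>n. \<Sum>j<i. sq i * A i j * v i * v j)"
  proof (intro dvd_sum)
    fix i j assume "i \<in> {..n}"
    then have "m dvd sq i * v i * (A i j * v j)"
      by (intro dvd_mult2[of m "sq i * v i"]) (simp add: assms)
    then show "m dvd sq i * A i j * v i * v j" by (simp add: mult_ac)
  qed
  ultimately show ?thesis by (simp add: dvd_add)
qed

lemma root_nonzero: "root v \<Longrightarrow> v \<noteq> 0"
  by (auto simp: root_def root_of_norm_def form_eq)

text \<open>A root of mixed sign would split as \<open>v\<^sub>+ - v\<^sub>-\<close> into two vectors of the same divisibility class,
  each of which has at least the norm of the root.\<close>
lemma root_sign:
  assumes "root v"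
  shows "(\<forall>i. 0 \<le> v i) \<or> (\<forall>i. v i \<le> 0)"
proof (rule ccontr)
  assume neg: "\<not> ?thesis"
  obtain m where m: "root_of_norm m v" using assms by (auto simp: root_def)
  then have supp: "\<And>i. i > n \<Longrightarrow> v i = 0" and m0: "m > 0" by (auto simp: root_of_norm_def)
  define x where "x = (\<lambda>i. max (v i) 0)"
  define y where "y = (\<lambda>i. max (- v i) 0)"
  have v: "v = x - y" by (auto simp: x_def y_def fun_eq_iff)
  have xy: "B x y \<le> 0"
    unfolding inv_form_def
  proof (intro sum_nonpos)
    fix i j assume "i \<in> {..n}" "j \<in> {..n}"
    then show "sq i * A i j * x i * y j \<le> 0"
      using cartan_nonpos[of i j] sq_pos[of i]
      by (cases "i = j") (auto simp: x_def y_def max_def mult_le_0_iff zero_le_mult_iff)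
  qed
  have dvd: "\<And>i. i \<le> n \<Longrightarrow> m dvd sq i * x i" "\<And>i. i \<le> n \<Longrightarrow> m dvd sq i * y i"
    using m by (auto simp: root_of_norm_def x_def y_def max_def)
  obtain i j where ij: "v i < 0" "v j > 0" using neg by (auto simp: not_le)
  then have le: "i \<le> n" "j \<le> n" using supp by (auto simp: not_less[symmetric])
  have "x i = 0" "x j \<noteq> 0" "y j = 0" "y i \<noteq> 0" "\<And>l. l > n \<Longrightarrow> x l = 0" "\<And>l. l > n \<Longrightarrow> y l = 0"
    using ij supp by (simp_all add: x_def y_def)
  note xy0 = this
  have "B x x \<noteq> 0"
    using form_null_zero[of x i] xy0 le by (metis zero_fun_apply)
  then have "B x x \<ge> 2 * m"
    using form_nonneg[of x] form_divisible[of m x] dvd by (auto simp: zdvd_imp_le)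
  moreover have "B y y \<noteq> 0"
    using form_null_zero[of y j] xy0 le by (metis zero_fun_apply)
  then have "B y y \<ge> 2 * m"
    using form_nonneg[of y] form_divisible[of m y] dvd by (auto simp: zdvd_imp_le)
  ultimately have "B v v \<ge> 4 * m"
    using xy form_sym[of x y] unfolding v by simp
  then show False using m m0 by (simp add: root_of_norm_def)
qed

lemma pos_or_neg: "root v \<Longrightarrow> pos v \<or> pos (- v)"
  using root_sign[of v] by (auto simp: pos_def)

lemma not_pos_and_neg: "pos v \<Longrightarrow> \<not> pos (- v)"
proof
  assume "pos v" "pos (- v)"
  then have "0 \<le> v i" "0 \<le> (- v) i" for i unfolding pos_def by blast+
  then have "v = 0" by (auto simp: fun_eq_iff intro: order_antisym)
  then show False using \<open>pos v\<close> root_nonzero by (auto simp: pos_def)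
qed

text \<open>Descent on the height. Since \<open>B v v\<close> is positive, some simple reflection
  lowers a positive coordinate; by \<open>root_sign\<close> the result is again positive, or else
  \<open>v\<close> was a multiple of one simple root. Only nodes of the support are used, which
  keeps the element in \<open>W J\<close>.\<close>

lemma positive_root_conjugate:
  assumes "root_of_norm m v" "\<And>i. 0 \<le> v i" "\<And>i. i \<notin> J \<Longrightarrow> v i = 0" "J \<subseteq> {..n}"
  shows "\<exists>w\<in>W J. \<exists>i\<in>J. v = w (\<alpha> i) \<and> sq i = m"
  using assms(1-3)
proof (induction "\<Sum>i\<le>n. nat (v i)" arbitrary: v rule: less_induct)
  case less
  have m: "m > 0" "B v v = 2 * m" using less.prems(1) by (auto simp: root_of_norm_def)
  have "\<exists>i\<le>n. 0 < sq i * v i * pairing i v"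
  proof (rule ccontr)
    assume "\<not> ?thesis"
    then have "B v v \<le> 0" unfolding form_eq by (intro sum_nonpos) (auto simp: not_less)
    then show False using m by simp
  qed
  then obtain i where i: "i \<le> n" "0 < sq i * v i * pairing i v" by blast
  have vi: "v i > 0" "pairing i v > 0"
    using i(2) sq_pos[OF i(1)] less.prems(2)[of i]
    by (auto simp: zero_less_mult_iff mult_less_0_iff)
  have "i \<in> J" using vi less.prems(3) by force
  define u where "u = refl_simple i v"
  have u: "root_of_norm m u" unfolding u_def by (rule root_of_norm_simple_reflection[OF i(1) less.prems(1)])
  have u_coord: "u j = (if j = i then v i - pairing i v else v j)" for j
    by (simp add: u_def simple_reflection_eq simple_root_def)
  have v_refl: "v = refl_simple i u"
    using fun_cong[OF simple_reflection_invol[OF i(1)], of v] by (simp add: u_def)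
  consider "\<forall>j. 0 \<le> u j" | "\<forall>j. u j \<le> 0" using root_sign[of u] u by (auto simp: root_def)
  then show ?case
  proof cases
    case 1
    have "(\<Sum>j\<le>n. nat (u j)) < (\<Sum>j\<le>n. nat (v j))"
      using i(1) vi by (intro sum_strict_mono_ex1) (auto simp: u_coord)
    then obtain w j where "w \<in> W J" "j \<in> J" "u = w (\<alpha> j)" "sq j = m"
      using less.hyps[OF _ u] 1 less.prems(3) \<open>i \<in> J\<close> by (force simp: u_coord)
    then show ?thesis
      using weyl_step[OF \<open>i \<in> J\<close>, of w t] v_refl by (metis comp_apply)
  next
    case 2
    have v0: "v j = 0" if "j \<noteq> i" for j
      using 2 less.prems(2)[of j] that by (auto simp: u_coord intro: order_antisym dest: spec[of _ j])
    then have v: "v = v i *\<^sub>s \<alpha> i" by (auto simp: fun_eq_iff simple_root_def)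
    \<comment> \<open>Divisibility excludes proper multiples of a simple root, which the norm
      condition alone would allow.\<close>
    obtain l where l: "sq i * v i = m * l"
      using less.prems(1) i(1) by (auto simp: root_of_norm_def dvd_def)
    have "pairing i v = v i * 2"
      by (subst v) (simp add: pairing_simple[OF i(1)])
    then have "B v v = v i * (sq i * (v i * 2))"
      by (subst (1) v) (simp add: form_simple[OF i(1)])
    then have "m * (v i * l) = m * 1"
      using m(2) l by (simp add: algebra_simps)
    then have "v i * l = 1" using m(1) by simp
    then have "v i = 1" using vi(1) by (simp add: pos_zmult_eq_1_iff)
    then have "v = id (\<alpha> i)" "sq i = m"
      using v l \<open>v i * l = 1\<close> by auto
    then show ?thesis using \<open>i \<in> J\<close> weyl_id by blast
  qed
qed

lemma root_conjugate:
  assumes "root_of_norm m v" "\<And>i. i \<notin> J \<Longrightarrow> v i = 0" "J \<subseteq> {..n}"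
  shows "\<exists>w\<in>W J. \<exists>i\<in>J. v = w (\<alpha> i) \<and> sq i = m"
proof -
  consider "\<forall>i. 0 \<le> v i" | "\<forall>i. v i \<le> 0" using root_sign[of v] assms(1) by (auto simp: root_def)
  then show ?thesis
  proof cases
    case 1
    then show ?thesis using positive_root_conjugate[OF assms(1)] assms by blast
  next
    case 2
    then obtain w i where w: "w \<in> W J" "i \<in> J" "- v = w (\<alpha> i)" "sq i = m"
      using positive_root_conjugate[of m "- v" J] assms by auto
    have "(w \<circ> refl_simple i) (\<alpha> i) = v"
      using w assms(3) by (auto simp: simple_reflection_simple weyl_uminus[OF w(1)] subset_iff w(3)[symmetric])
    then show ?thesis using weyl_comp[OF w(1) weyl_gen[OF w(2)]] w by blast
  qed
qed

lemma affine_weyl_eq: "affine_weyl_group t = W {..n}"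
  by (simp add: affine_weyl_group_def atLeast0AtMost)

lemma real_roots_eq: "real_roots t = {v. root v}"
proof safe
  fix v assume "v \<in> real_roots t"
  then show "root v"
    using root_weyl[of _ "{..n}"] by (auto simp: real_roots_def affine_weyl_eq)
next
  fix v assume "root v"
  then obtain m where m: "root_of_norm m v" by (auto simp: root_def)
  then obtain w i where "w \<in> W {..n}" "i \<le> n" "v = w (\<alpha> i)"
    using root_conjugate[OF m, of "{..n}"] by (auto simp: root_of_norm_def)
  then show "v \<in> real_roots t" by (auto simp: real_roots_def affine_weyl_eq)
qed

lemma root_norm_bound:
  assumes "root_of_norm m v"
  shows "\<exists>i\<le>n. sq i = m"
  using root_conjugate[OF assms, of "{..n}"] assms by (auto simp: root_of_norm_def)

lemma weyl_coroot:
  assumes "w \<in> W J" "J \<subseteq> {..n}" "root b"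
  shows "coroot (w b) (w v) = coroot b v"
  by (simp add: coroot_def weyl_form[OF assms(1,2)])

lemma reflection_conj:
  assumes "w \<in> W J" "J \<subseteq> {..n}" "root b"
  shows "reflection (w b) \<circ> w = w \<circ> reflection b"
  by (rule ext) (simp add: reflection_def weyl_coroot[OF assms] weyl_diff[OF assms(1)] weyl_smul[OF assms(1)])

text \<open>The control of the support is the point: it puts the reflections in roots of height 0
  into \<open>W J\<^sub>0\<close> and the reflection in \<open>\<theta>\<close> into
  \<open>W {1..n}\<close>.\<close>

lemma reflection_in_weyl:
  assumes "root b" "\<And>i. i \<notin> J \<Longrightarrow> b i = 0" "J \<subseteq> {..n}"
  shows "reflection b \<in> W J"
proof -
  obtain m where m: "root_of_norm m b" using assms(1) by (auto simp: root_def)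
  then obtain w i where w: "w \<in> W J" "i \<in> J" "b = w (\<alpha> i)"
    using root_conjugate[OF m] assms by blast
  have i: "i \<le> n" using w(2) assms(3) by auto
  have "reflection b = reflection b \<circ> w \<circ> inv w"
    by (simp add: fun_eq_iff weyl_inv_apply(2)[OF w(1) assms(3)])
  also have "\<dots> = w \<circ> refl_simple i \<circ> inv w"
    using reflection_conj[OF w(1) assms(3) root_simple[OF i]] w(3) reflection_simple[OF i] by simp
  also have "\<dots> \<in> W J"
    by (intro weyl_comp w(1) weyl_gen w(2) weyl_inv assms(3))
  finally show ?thesis .
qed

lemma root_beyond: "root b \<Longrightarrow> i > n \<Longrightarrow> b i = 0"
  by (auto simp: root_def root_of_norm_def)

lemma reflection_in_affine_weyl: "root b \<Longrightarrow> reflection b \<in> W {..n}"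
  by (rule reflection_in_weyl) (auto simp: root_beyond)

lemma root_reflection: "root b \<Longrightarrow> root v \<Longrightarrow> root (reflection b v)"
  using root_weyl[OF reflection_in_affine_weyl] by blast

text \<open>A positive root other than \<open>\<alpha> i\<close> has a positive coordinate
  elsewhere, which the reflection leaves alone; \<open>root_sign\<close> then decides.\<close>

lemma simple_reflection_pos:
  assumes "i \<le> n" "pos v" "v \<noteq> \<alpha> i"
  shows "pos (refl_simple i v)"
proof -
  have r: "root (refl_simple i v)"
    using assms root_weyl[OF weyl_gen[of i "{..n}"]] by (auto simp: pos_def)
  have "\<exists>j. j \<noteq> i \<and> v j > 0"
  proof (rule ccontr)
    assume "\<not> ?thesis"
    then have v0: "v j = 0" if "j \<noteq> i" for j
      using that assms(2) by (auto simp: pos_def not_less intro: order_antisym)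
    obtain m where m: "root_of_norm m v" using assms(2) by (auto simp: pos_def root_def)
    obtain w l where "w \<in> W {i}" "l \<in> {i}" "v = w (\<alpha> l)"
      using positive_root_conjugate[OF m, of "{i}"] v0 assms by (auto simp: pos_def)
    have v: "v = v i *\<^sub>s \<alpha> i" using v0 by (auto simp: fun_eq_iff simple_root_def)
    have "sq i = m"
      using positive_root_conjugate[OF m, of "{i}"] v0 assms by (auto simp: pos_def)
    moreover have "B v v = v i * (v i * (2 * sq i))"
      by (subst (1 2) v) (simp add: form_simple[OF assms(1)] pairing_simple[OF assms(1)])
    ultimately have "v i * v i = 1"
      using m by (auto simp: root_of_norm_def)
    then have "v i = 1"
      using assms(2) zmult_eq_1_iff[of "v i" "v i"] by (auto simp: pos_def dest: spec[of _ i])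
    then show False using v assms(3) by simp
  qed
  then obtain j where j: "j \<noteq> i" "v j > 0" by blast
  then have "refl_simple i v j > 0" by (simp add: simple_reflection_eq simple_root_def)
  then have "\<not> (\<forall>l. refl_simple i v l \<le> 0)" by (metis not_less)
  then show ?thesis using root_sign[OF r] r by (auto simp: pos_def)
qed

lemma root_affine_weyl [simp]: "w \<in> W {..n} \<Longrightarrow> root (w v) \<longleftrightarrow> root v"
  using root_weyl[of w "{..n}" v] root_weyl[OF weyl_inv[of w "{..n}"], of "w v"] by auto

lemma root_inv_affine_weyl [simp]: "w \<in> W {..n} \<Longrightarrow> root (inv w v) \<longleftrightarrow> root v"
  using root_affine_weyl[OF weyl_inv[of w "{..n}"]] by simp

lemma pos_root: "pos v \<Longrightarrow> root v"
  by (simp add: pos_def)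

lemma pos_simple [simp]: "i \<le> n \<Longrightarrow> pos (\<alpha> i)"
  unfolding pos_def by (simp add: root_simple) (simp add: simple_root_def)

lemma posI: "root v \<Longrightarrow> v i > 0 \<Longrightarrow> pos v"
  using root_sign[of v] unfolding pos_def by (metis not_less)

lemma not_pos_iff: "root v \<Longrightarrow> \<not> pos v \<longleftrightarrow> pos (- v)"
  using pos_or_neg not_pos_and_neg by blast

section \<open>Exchange and dominance\<close>

primrec word :: "nat list \<Rightarrow> root_vec \<Rightarrow> root_vec" where
  "word [] = id"
| "word (i # is) = refl_simple i \<circ> word is"

lemma word_in_weyl: "set is \<subseteq> J \<Longrightarrow> word is \<in> W J"
  by (induction "is") (auto intro: weyl_subgroup.intros)

lemma weyl_has_word: "w \<in> W J \<Longrightarrow> \<exists>is. set is \<subseteq> J \<and> w = word is"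
proof (induction rule: weyl_subgroup.induct)
  case (weyl_step i w)
  then obtain "is" where "set is \<subseteq> J" "w = word is" by blast
  then show ?case using weyl_step(1) by (intro exI[of _ "i # is"]) auto
qed (auto intro: exI[of _ "[]"])

text \<open>Strong exchange. As \<open>b\<close> is moved inwards through the word, its sign must
  change at some letter; there it is the simple root of that letter, and the reflection in
  \<open>b\<close> deletes the letter.\<close>

lemma word_exchange:
  assumes "set is \<subseteq> {..n}" "pos b" "b = word is g" "pos (- g)"
  shows "\<exists>js. set js \<subseteq> set is \<and> length js < length is \<and> reflection b \<circ> word is = word js"
  using assms
proof (induction "is" arbitrary: b)
  case Nil
  then have "b = g" by simp
  then show ?case using not_pos_and_neg[of g] Nil.prems by blast
next
  case (Cons i "is")
  have i: "i \<le> n" using Cons.prems(1) by simp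
  define b' where "b' = word is g"
  have b: "b = refl_simple i b'" using Cons.prems(3) by (simp add: b'_def)
  have b': "b' = refl_simple i b"
    using fun_cong[OF simple_reflection_invol[OF i], of b'] by (simp add: b)
  show ?case
  proof (cases "b = \<alpha> i")
    case True
    have "reflection b \<circ> word (i # is) = (refl_simple i \<circ> refl_simple i) \<circ> word is"
      by (simp only: True reflection_simple[OF i] word.simps comp_assoc)
    also have "\<dots> = word is" by (simp only: simple_reflection_invol[OF i] id_comp)
    finally have "reflection b \<circ> word (i # is) = word is" .
    moreover have "set is \<subseteq> set (i # is)" "length is < length (i # is)" by auto
    ultimately show ?thesis by blast
  next
    case False
    then have "pos b'" using simple_reflection_pos[OF i Cons.prems(2)] b' by simp
    then obtain js where js: "set js \<subseteq> set is" "length js < length is"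
        "reflection b' \<circ> word is = word js"
      using Cons.IH[OF _ \<open>pos b'\<close> b'_def Cons.prems(4)] Cons.prems(1) by (metis insert_subset list.simps(15))
    have "reflection b \<circ> refl_simple i = refl_simple i \<circ> reflection b'"
      using reflection_conj[OF weyl_gen[of i "{..n}"], of b'] i pos_root[OF \<open>pos b'\<close>] b by simp
    then have "reflection b \<circ> word (i # is) = refl_simple i \<circ> (reflection b' \<circ> word is)"
      by (simp only: word.simps comp_assoc[symmetric])
    then have "reflection b \<circ> word (i # is) = word (i # js)"
      by (simp only: js(3) word.simps)
    moreover have "set (i # js) \<subseteq> set (i # is)" "length (i # js) < length (i # is)" using js by auto
    ultimately show ?thesis by blast
  qed
qed

text \<open>If a shortest word of the inverse began with a letter i, its tail would make the
  positive root \<open>w (\<alpha> i)\<close> negative, and exchange would produce a shorter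
  word.\<close>

lemma weyl_trivial:
  assumes w: "w \<in> W J" "J \<subseteq> {..n}" and "\<And>i. i \<in> J \<Longrightarrow> pos (w (\<alpha> i))"
  shows "w = id"
proof -
  let ?P = "\<lambda>is. set is \<subseteq> J \<and> inv w = word is"
  obtain is0 where "?P is0" using weyl_has_word[OF weyl_inv[OF w]] by blast
  then obtain "is" where "is": "?P is" and minimal: "\<And>js. ?P js \<Longrightarrow> length is \<le> length js"
    using ex_has_least_nat[of ?P is0 length] by blast
  show ?thesis
  proof (cases "is")
    case Nil
    then have "inv w = id" using "is" by simp
    then have "w v = v" for v using weyl_inv_apply(1)[OF w, of v] by simp
    then show ?thesis by (auto simp: fun_eq_iff)
  next
    case (Cons i is')
    then have i: "i \<in> J" "i \<le> n" using "is" w(2) by auto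
    have inv: "inv w = refl_simple i \<circ> word is'" using "is" Cons by simp
    have "refl_simple i (word is' (w (\<alpha> i))) = \<alpha> i"
      using fun_cong[OF inv, of "w (\<alpha> i)"] weyl_inv_apply(1)[OF w] by simp
    then have "word is' (w (\<alpha> i)) = - \<alpha> i"
      using fun_cong[OF simple_reflection_invol[OF i(2)], of "word is' (w (\<alpha> i))"]
        simple_reflection_simple[OF i(2)] by simp
    then have "\<alpha> i = word is' (- w (\<alpha> i))"
      using weyl_uminus[OF word_in_weyl[of is' "set is'"]] by simp
    then obtain js where "set js \<subseteq> set is'" "length js < length is'" "reflection (\<alpha> i) \<circ> word is' = word js"
      using word_exchange[of is' "\<alpha> i" "- w (\<alpha> i)"] "is" Cons i w(2) assms(3)[OF i(1)] by auto
    then have "?P js" "length js < length is"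
      using inv "is" Cons reflection_simple[OF i(2)] by auto
    then show ?thesis using minimal[of js] by simp
  qed
qed

text \<open>The signs determine the alcove: \<open>inv v \<circ> w\<close> keeps every simple root
  positive, so \<open>weyl_trivial\<close> applies.\<close>

lemma weyl_eq_of_signs:
  assumes v: "v \<in> W {..n}" and w: "w \<in> W {..n}"
    and "\<And>b. pos b \<Longrightarrow> pos (inv v b) \<longleftrightarrow> pos (inv w b)"
  shows "v = w"
proof -
  have "inv v \<circ> w = id"
  proof (rule weyl_trivial[OF weyl_comp[OF weyl_inv[OF v] w]])
    fix i assume "i \<in> {..n}"
    then have i: "pos (\<alpha> i)" "root (w (\<alpha> i))" using w by auto
    consider "pos (w (\<alpha> i))" | "pos (- w (\<alpha> i))" using pos_or_neg[OF i(2)] by blast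
    then show "pos ((inv v \<circ> w) (\<alpha> i))"
    proof cases
      case 1
      then show ?thesis using assms(3)[OF 1] i weyl_inv_apply(1)[OF w] by simp
    next
      case 2
      have "inv w (- w (\<alpha> i)) = - \<alpha> i"
        using weyl_uminus[OF weyl_inv[OF w]] weyl_inv_apply(1)[OF w] by simp
      then have "\<not> pos (inv v (- w (\<alpha> i)))"
        using assms(3)[OF 2] i(1) not_pos_and_neg by auto
      then have "\<not> pos (- inv v (w (\<alpha> i)))" using weyl_uminus[OF weyl_inv[OF v]] by simp
      then show ?thesis using not_pos_iff[of "inv v (w (\<alpha> i))"] v w i by auto
    qed
  qed auto
  then have "v (inv v (w x)) = v x" for x by (metis comp_apply id_apply)
  then show ?thesis using weyl_inv_apply(2)[OF v] by auto
qed

text \<open>Reflecting in a simple root of negative value takes that root out of the finite set of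
  negatively valued positive roots and adds no new one. This replaces the choice of an alcove around
  a given point.\<close>

lemma dominant_conjugate:
  assumes add: "\<And>u v. f (u - v) = f u - (f v :: int)" and smul: "\<And>c v. f (c *\<^sub>s v) = c * f v"
    and "finite {b. pos b \<and> f b < 0}"
  shows "\<exists>w\<in>W {..n}. \<forall>i\<le>n. 0 \<le> f (w (\<alpha> i))"
  using assms
proof (induction "card {b. pos b \<and> f b < 0}" arbitrary: f rule: less_induct)
  case less
  show ?case
  proof (cases "\<forall>i\<le>n. 0 \<le> f (\<alpha> i)")
    case True
    then show ?thesis using weyl_id by (metis id_apply)
  next
    case False
    then obtain i where i: "i \<le> n" "f (\<alpha> i) < 0" by auto
    let ?s = "refl_simple i"
    let ?N = "{b. pos b \<and> f b < 0}" and ?N' = "{b. pos b \<and> (f \<circ> ?s) b < 0}"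
    have s: "?s \<in> W {..n}" using i(1) by (intro weyl_gen) auto
    have ss: "?s (?s v) = v" for v using fun_cong[OF simple_reflection_invol[OF i(1)], of v] by simp
    have f0: "f 0 = 0" using less.prems(1)[of 0 0] by simp
    have fneg: "f (- v) = - f v" for v using less.prems(1)[of 0 v] f0 by simp
    have "?N' \<subseteq> ?s ` (?N - {\<alpha> i})"
    proof
      fix b assume "b \<in> ?N'"
      then have b: "pos b" "f (?s b) < 0" by auto
      then have "b \<noteq> \<alpha> i" using i fneg by (auto simp: simple_reflection_simple)
      moreover have "?s b \<noteq> \<alpha> i"
        using ss[of b] b(1) simple_reflection_simple[OF i(1)] pos_simple[OF i(1)] not_pos_and_neg by metis
      ultimately have "?s b \<in> ?N - {\<alpha> i}" using simple_reflection_pos[OF i(1) b(1)] b by auto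
      then show "b \<in> ?s ` (?N - {\<alpha> i})" using ss[of b] by (metis imageI)
    qed
    then have fin: "finite ?N'"
      by (rule finite_subset) (intro finite_imageI finite_Diff less.prems(3))
    have "card ?N' \<le> card (?N - {\<alpha> i})"
      by (rule surj_card_le[OF finite_Diff[OF less.prems(3)] \<open>?N' \<subseteq> _\<close>])
    moreover have "card (?N - {\<alpha> i}) < card ?N"
      by (rule card_Diff1_less[OF less.prems(3)]) (use i pos_simple in blast)
    ultimately have "card ?N' < card ?N" by simp
    then have "\<exists>w\<in>W {..n}. \<forall>i\<le>n. 0 \<le> (f \<circ> ?s) (w (\<alpha> i))"
      by (rule less.hyps)
        (simp_all only: comp_apply weyl_diff[OF s] weyl_smul[OF s] less.prems(1,2) fin[unfolded comp_apply])
    then obtain w where "w \<in> W {..n}" "\<forall>i\<le>n. 0 \<le> (f \<circ> ?s) (w (\<alpha> i))" by blast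
    then show ?thesis using weyl_comp[OF s] by (metis comp_apply)
  qed
qed

section \<open>Translations\<close>

text \<open>Pairing with the coroot combination that has coefficients \<open>c\<close>. All nodes
  including 0 are allowed, so different coefficients can give the same functional;
  \<open>level_zero_null\<close> and \<open>level_zero_label\<close> describe this
  ambiguity.\<close>

definition level_zero :: "(nat \<Rightarrow> int) \<Rightarrow> root_vec \<Rightarrow> int" where
  "level_zero c v = (\<Sum>i\<le>n. c i * pairing i v)"

text \<open>The usual translation of the affine Weyl group in its action on the root lattice, where
  only the multiple of \<open>\<delta>\<close> changes.\<close>

definition translation :: "(nat \<Rightarrow> int) \<Rightarrow> root_vec \<Rightarrow> root_vec" where
  "translation c v = v - level_zero c v *\<^sub>s \<delta>"

text \<open>The coefficients of the image of a coroot combination under the i-th simple reflection;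
  only the i-th one changes.\<close>

definition twist_coeffs :: "nat \<Rightarrow> (nat \<Rightarrow> int) \<Rightarrow> nat \<Rightarrow> int" where
  "twist_coeffs i c = c(i := c i - (\<Sum>j\<le>n. c j * A j i))"

lemma level_zero_simps [simp]:
  "level_zero c (u + v) = level_zero c u + level_zero c v"
  "level_zero c (u - v) = level_zero c u - level_zero c v"
  "level_zero c (- v) = - level_zero c v"
  "level_zero c (x *\<^sub>s v) = x * level_zero c v"
  "level_zero c \<delta> = 0"
  by (simp_all add: level_zero_def sum.distrib sum_subtractf sum_negf sum_distrib_left algebra_simps)

lemma level_zero_coeffs:
  "level_zero (\<lambda>i. c i + d i) v = level_zero c v + level_zero d v"
  "level_zero (\<lambda>i. - c i) v = - level_zero c v"
  "level_zero (\<lambda>i. x * c i) v = x * level_zero c v"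
  "level_zero (\<lambda>_. 0) v = 0"
  by (simp_all add: level_zero_def sum.distrib sum_negf sum_distrib_left algebra_simps)

lemma translation_comp: "translation c \<circ> translation d = translation (\<lambda>i. c i + d i)"
  by (rule ext) (simp add: translation_def level_zero_coeffs fun_eq_iff algebra_simps)

lemma translation_zero: "translation (\<lambda>_. 0) = id"
  by (rule ext) (simp add: translation_def level_zero_coeffs)

lemma translation_inverse:
  "translation c \<circ> translation (\<lambda>i. - c i) = id" "translation (\<lambda>i. - c i) \<circ> translation c = id"
  by (simp_all add: translation_comp translation_zero)

lemma level_zero_twist:
  assumes "i \<le> n"
  shows "level_zero (twist_coeffs i c) v = level_zero c (refl_simple i v)"
proof -
  have "level_zero (twist_coeffs i c) v = (\<Sum>j\<le>n. c j * pairing j v - (if j = i then (\<Sum>l\<le>n. c l * A l i) * pairing i v else 0))"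
    unfolding level_zero_def by (intro sum.cong refl) (auto simp: twist_coeffs_def algebra_simps)
  also have "\<dots> = level_zero c v - (\<Sum>l\<le>n. c l * A l i) * pairing i v"
    using assms by (simp add: sum_subtractf level_zero_def)
  also have "\<dots> = level_zero c (refl_simple i v)"
    by (simp add: simple_reflection_eq) (simp add: level_zero_def pairing_simple[OF assms])
  finally show ?thesis .
qed

lemma simple_reflection_translation:
  assumes "i \<le> n"
  shows "refl_simple i \<circ> translation c = translation (twist_coeffs i c) \<circ> refl_simple i"
proof
  fix v
  have s: "refl_simple i \<in> W {..n}" using assms by (intro weyl_gen) auto
  have "(refl_simple i \<circ> translation c) v = refl_simple i v - level_zero c v *\<^sub>s \<delta>"
    by (simp add: translation_def weyl_diff[OF s] weyl_smul[OF s] weyl_delta[OF s])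
  moreover have "level_zero (twist_coeffs i c) (refl_simple i v) = level_zero c v"
    using fun_cong[OF simple_reflection_invol[OF assms], of v] by (simp add: level_zero_twist[OF assms])
  ultimately show "(refl_simple i \<circ> translation c) v = (translation (twist_coeffs i c) \<circ> refl_simple i) v"
    by (simp add: translation_def)
qed

lemma weyl_translation:
  assumes "w \<in> W J" "J \<subseteq> {..n}" "\<And>i c. i \<in> J \<Longrightarrow> c \<in> L \<Longrightarrow> twist_coeffs i c \<in> L" "c \<in> L"
  shows "\<exists>d\<in>L. w \<circ> translation c = translation d \<circ> w"
  using assms(1)
proof (induction rule: weyl_subgroup.induct)
  case (weyl_step i w)
  then obtain d where d: "d \<in> L" "w \<circ> translation c = translation d \<circ> w" by blast
  have i: "i \<le> n" using weyl_step(1) assms(2) by auto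
  have "(refl_simple i \<circ> w) \<circ> translation c = (refl_simple i \<circ> translation d) \<circ> w"
    by (simp only: comp_assoc d(2))
  also have "\<dots> = translation (twist_coeffs i d) \<circ> (refl_simple i \<circ> w)"
    by (simp only: comp_assoc simple_reflection_translation[OF i])
  finally show ?case using assms(3)[OF weyl_step(1) d(1)] by blast
qed (use assms(4) in auto)

text \<open>\<open>twist_coeffs\<close> carries the coefficients along the word. What is needed
  later is that they are integers supported in \<open>J\<close>.\<close>

lemma coroot_as_level_zero:
  assumes "w \<in> W J" "J \<subseteq> {..n}" "i \<in> J"
  shows "\<exists>c. (\<forall>j. j \<notin> J \<longrightarrow> c j = 0) \<and> (\<forall>v. coroot (w (\<alpha> i)) v = level_zero c v)"
  using assms(1)
proof (induction rule: weyl_subgroup.induct)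
  case weyl_id
  have "i \<le> n" using assms by auto
  then have "coroot (\<alpha> i) v = level_zero (\<lambda>j. if j = i then 1 else 0) v" for v
    by (simp add: coroot_simple level_zero_def if_distrib if_distribR cong: if_cong)
  then show ?case using assms(3) by (intro exI[of _ "\<lambda>j. if j = i then 1 else 0"]) auto
next
  case (weyl_step j w)
  then obtain c where c: "\<forall>l. l \<notin> J \<longrightarrow> c l = 0" "\<forall>v. coroot (w (\<alpha> i)) v = level_zero c v" by blast
  have j: "j \<le> n" "i \<le> n" using weyl_step(1) assms by auto
  have "root (w (\<alpha> i))" using root_weyl[OF weyl_step(2) assms(2)] j by auto
  then have "coroot (refl_simple j (w (\<alpha> i))) v = coroot (w (\<alpha> i)) (refl_simple j v)" for v
    using weyl_coroot[OF weyl_gen[of j "{..n}"], of "w (\<alpha> i)" "refl_simple j v"] j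
      fun_cong[OF simple_reflection_invol[OF j(1)], of v] by simp
  then have "coroot ((refl_simple j \<circ> w) (\<alpha> i)) v = level_zero (twist_coeffs j c) v" for v
    by (simp add: c(2) level_zero_twist[OF j(1)])
  moreover have "\<forall>l. l \<notin> J \<longrightarrow> twist_coeffs j c l = 0"
    using c(1) weyl_step(1) by (auto simp: twist_coeffs_def)
  ultimately show ?case by blast
qed

text \<open>Two reflections in parallel mirrors compose to a translation along the coroot.\<close>

lemma reflection_shift:
  assumes "root b" "root (b + q *\<^sub>s \<delta>)" "\<And>v. coroot b v = level_zero c v"
  shows "reflection (b + q *\<^sub>s \<delta>) = translation (\<lambda>i. - q * c i) \<circ> reflection b"
proof
  fix v
  have cr: "coroot (b + q *\<^sub>s \<delta>) v = coroot b v" by (simp add: coroot_def)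
  have "level_zero c (reflection b v) = - level_zero c v"
    unfolding assms(3)[symmetric] by (simp add: reflection_def assms(1))
  then have "level_zero (\<lambda>i. - q * c i) (reflection b v) = q * coroot b v"
    using level_zero_coeffs(3)[of "- q" c "reflection b v"] by (simp add: assms(3))
  then show "reflection (b + q *\<^sub>s \<delta>) v = (translation (\<lambda>i. - q * c i) \<circ> reflection b) v"
    by (simp add: translation_def reflection_def cr fun_eq_iff algebra_simps)
qed

text \<open>The reflections in \<open>\<alpha> i\<close> and in the parallel root \<open>b\<close>
  are composed. The factor \<open>c\<close> admits shifts that are only proportional to a root: for
  \<open>TwistedA_even\<close>, the vector \<open>\<alpha> n + \<delta>\<close> is twice a
  root.\<close>

lemma translation_in_affine_weyl:
  assumes "i \<le> n" "\<alpha> i + q *\<^sub>s \<delta> = c *\<^sub>s b" "root_of_norm m b" "sq i = c * c * m"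
  shows "translation (\<lambda>j. if j = i then q else 0) \<in> W {..n}"
proof -
  have b: "root b" using assms(3) by (auto simp: root_def)
  have m: "m > 0" using assms(3) by (simp add: root_of_norm_def)
  have cr: "coroot b v = c * pairing i v" for v
  proof (rule coroot_eqI[OF assms(3)])
    have c0: "c \<noteq> 0" using assms(4) sq_pos[OF assms(1)] by auto
    have "c * B v b = B v (c *\<^sub>s b)" by simp
    also have "\<dots> = B v (\<alpha> i)" by (simp only: assms(2)[symmetric] form_add_right form_smul_right form_delta_right mult_zero_right add_0_right)
    also have "\<dots> = c * (c * pairing i v * m)"
      using form_sym[of v "\<alpha> i"] by (simp add: form_simple[OF assms(1)] assms(4))
    finally show "B v b = c * pairing i v * m" using c0 by simp
  qed
  have "(refl_simple i \<circ> reflection b) v = translation (\<lambda>j. if j = i then q else 0) v" for v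
  proof -
    have s: "refl_simple i \<in> W {..n}" using assms(1) by (intro weyl_gen) auto
    have "coroot b v *\<^sub>s b = pairing i v *\<^sub>s (c *\<^sub>s b)" by (simp add: cr fun_eq_iff)
    then have "reflection b v = v - pairing i v *\<^sub>s (\<alpha> i + q *\<^sub>s \<delta>)" by (simp add: reflection_def assms(2))
    then have "refl_simple i (reflection b v) = refl_simple i v - pairing i v *\<^sub>s (refl_simple i (\<alpha> i) + q *\<^sub>s \<delta>)"
      by (simp add: weyl_diff[OF s] weyl_smul[OF s] weyl_add[OF s] weyl_delta[OF s])
    also have "\<dots> = v - (q * pairing i v) *\<^sub>s \<delta>"
      by (simp add: simple_reflection_simple[OF assms(1)] simple_reflection_eq[of i v] fun_eq_iff algebra_simps)
    finally show ?thesis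
      using assms(1) by (simp add: translation_def level_zero_def if_distrib if_distribR cong: if_cong)
  qed
  then have "refl_simple i \<circ> reflection b = translation (\<lambda>j. if j = i then q else 0)" by blast
  then show ?thesis
    using weyl_comp[OF weyl_gen[of i "{..n}"] reflection_in_affine_weyl[OF b]] assms(1) by simp
qed

text \<open>Dividing coordinate i by \<open>sq i\<close> turns a vanishing coroot combination into a
  null vector of the form, which \<open>form_null\<close> determines up to a scalar.
  \<open>N\<close> only clears denominators.\<close>

lemma level_zero_null:
  assumes "\<And>v. level_zero c v = 0" "i \<le> n" "j \<le> n"
  shows "c i * (a j * sq j) = c j * (a i * sq i)"
proof -
  define N where "N = (\<Prod>i\<le>n. sq i)"
  define u where "u i = c i * (N div sq i)" for i
  have N0: "N > 0" using sq_pos by (auto simp: N_def intro!: prod_pos)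
  have N: "sq l * (N div sq l) = N" if "l \<le> n" for l
    using that by (intro dvd_mult_div_cancel) (auto simp: N_def intro!: dvd_prodI)
  have "B u u = N * level_zero c u"
    unfolding form_eq level_zero_def sum_distrib_left
  proof (intro sum.cong refl)
    fix l assume "l \<in> {..n}"
    then have "sq l * u l = N * c l" using N[of l] by (simp add: u_def algebra_simps)
    then show "sq l * u l * pairing l u = N * (c l * pairing l u)" by simp
  qed
  then have "u i * a j = u j * a i" using form_null[of u i j] assms by simp
  then have "sq i * sq j * (u i * a j) = sq i * sq j * (u j * a i)" by simp
  then have "(sq i * (N div sq i)) * (c i * (a j * sq j)) = (sq j * (N div sq j)) * (c j * (a i * sq i))"
    by (simp add: u_def algebra_simps)
  then show ?thesis using N0 assms(2,3) by (simp add: N)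
qed

text \<open>Up to the factor \<open>x\<close> this is the pairing with \<open>\<delta>\<close>,
  which lies in the radical.\<close>

lemma level_zero_label:
  assumes "\<And>i. i \<le> n \<Longrightarrow> x * e i = a i * sq i" "x \<noteq> 0"
  shows "level_zero e v = 0"
proof -
  have "x * level_zero e v = B \<delta> v"
    unfolding level_zero_def form_eq sum_distrib_left
  proof (intro sum.cong refl)
    fix i assume "i \<in> {..n}"
    then have "x * e i * pairing i v = a i * sq i * pairing i v" using assms(1)[of i] by simp
    then show "x * (e i * pairing i v) = sq i * \<delta> i * pairing i v"
      using \<open>i \<in> {..n}\<close> by (simp add: delta_def mult_ac)
  qed
  then show ?thesis using assms(2) by simp
qed

end

section \<open>The subgroup of reflections in roots of even height\<close>

text \<open>Both \<open>X\<close> and \<open>Y\<close> represent the cosets of the group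
  \<open>T\<close> in \<open>G\<close>, and matching elements of the same coset is a bijection. In
  the application \<open>G\<close> is infinite, so no group orders can be divided.\<close>

lemma transversals_same_card:
  assumes id: "id \<in> T" and comp: "\<And>s t. s \<in> T \<Longrightarrow> t \<in> T \<Longrightarrow> s \<circ> t \<in> T"
    and inv: "\<And>t. t \<in> T \<Longrightarrow> \<exists>s\<in>T. s \<circ> t = id"
    and "X \<subseteq> G" "Y \<subseteq> G"
    and X: "\<And>g. g \<in> G \<Longrightarrow> \<exists>t\<in>T. \<exists>x\<in>X. g = t \<circ> x"
    and Y: "\<And>g. g \<in> G \<Longrightarrow> \<exists>t\<in>T. \<exists>y\<in>Y. g = t \<circ> y"
    and X_unique: "\<And>x x' t. x \<in> X \<Longrightarrow> x' \<in> X \<Longrightarrow> t \<in> T \<Longrightarrow> x = t \<circ> x' \<Longrightarrow> x = x'"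
    and Y_unique: "\<And>y y' t. y \<in> Y \<Longrightarrow> y' \<in> Y \<Longrightarrow> t \<in> T \<Longrightarrow> y = t \<circ> y' \<Longrightarrow> y = y'"
  shows "card X = card Y"
proof -
  have flip: "\<exists>s\<in>T. h = s \<circ> g" if t: "t \<in> T" "g = t \<circ> h" for g h t
  proof -
    obtain s where "s \<in> T" "s \<circ> t = id" using inv[OF t(1)] by blast
    then have "h = s \<circ> g" by (simp only: t(2) comp_assoc[symmetric] id_comp)
    then show ?thesis using \<open>s \<in> T\<close> by blast
  qed
  obtain f where f: "\<And>x. x \<in> X \<Longrightarrow> f x \<in> Y \<and> (\<exists>t\<in>T. x = t \<circ> f x)"
    using Y \<open>X \<subseteq> G\<close> by (metis subsetD)
  have "bij_betw f X Y"
  proof (rule bij_betwI')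
    fix x x' assume x: "x \<in> X" "x' \<in> X"
    show "(f x = f x') = (x = x')"
    proof
      assume eq: "f x = f x'"
      obtain t t' where t: "t \<in> T" "x = t \<circ> f x" "t' \<in> T" "x' = t' \<circ> f x'"
        using f[OF x(1)] f[OF x(2)] by blast
      obtain s where s: "s \<in> T" "f x' = s \<circ> x'" using flip[OF t(3,4)] by blast
      have "x = (t \<circ> s) \<circ> x'" using t(2) s(2) eq by (metis comp_assoc)
      then show "x = x'" using X_unique[OF x comp[OF t(1) s(1)]] by blast
    qed auto
  next
    fix x assume "x \<in> X"
    then show "f x \<in> Y" using f by blast
  next
    fix y assume y: "y \<in> Y"
    then obtain t x where t: "t \<in> T" "x \<in> X" "y = t \<circ> x" using X \<open>Y \<subseteq> G\<close> by blast
    obtain s where s: "s \<in> T" "x = s \<circ> f x" using f[OF t(2)] by blast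
    have "y = (t \<circ> s) \<circ> f x" using t(3) s(2) by (metis comp_assoc)
    then have "y = f x" using Y_unique[OF y _ comp[OF t(1) s(1)]] f[OF t(2)] by blast
    then show "\<exists>x\<in>X. y = f x" using t(2) by blast
  qed
  then show ?thesis by (rule bij_betw_same_card)
qed

lemma image_prodE:
  assumes "x \<in> (\<lambda>(u, v). f u v) ` (A \<times> B)"
  obtains u v where "u \<in> A" "v \<in> B" "x = f u v"
  using assms by auto

lemma card_multiples_below:
  assumes "0 < (d :: int)" "d dvd m" "0 \<le> m"
  shows "card {x. d dvd x \<and> 0 \<le> x \<and> x < m} = nat (m div d)"
proof -
  have "{x. d dvd x \<and> 0 \<le> x \<and> x < m} = (\<lambda>y. d * y) ` {0..<m div d}"
    using assms by (auto simp: dvd_def zero_le_mult_iff image_iff)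
  moreover have "inj_on (\<lambda>y. d * y) {0..<m div d}" using assms by (auto simp: inj_on_def)
  ultimately show ?thesis by (simp add: card_image)
qed

text \<open>The numbers \<open>r i\<close> describe the translation lattice of the affine Weyl group: it is spanned by
  the multiples \<open>r i\<close> of the simple coroots with \<open>i \<ge> 1\<close>.\<close>
locale graded_diagram = affine_diagram t for t +
  fixes p :: nat and r :: "nat \<Rightarrow> int"
  assumes p_le: "p \<le> affine_rank t"
    and twist_label: "twist t * label t p = 2"
    and twist_divides: "i \<le> affine_rank t \<Longrightarrow> j \<le> affine_rank t \<Longrightarrow>
      sqlen t j dvd int (twist t) * int (label t i) * sqlen t i"
    and r_pos: "i \<in> {1..affine_rank t} \<Longrightarrow> 0 < r i"
    and r_dvd_twist: "i \<in> {1..affine_rank t} \<Longrightarrow> r i dvd int (twist t)"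
    and r_dvd_cartan: "i \<in> {1..affine_rank t} \<Longrightarrow> j \<in> {1..affine_rank t} \<Longrightarrow> r j dvd r i * cartan t i j"
    and theta_dvd: "i \<in> {1..affine_rank t} \<Longrightarrow>
      int (label t 0) * int (label t 0) * sqlen t 0 * r i dvd int (label t i) * sqlen t i"
    and label_sq_dvd: "i \<le> affine_rank t \<Longrightarrow> int (label t 0) * sqlen t 0 dvd int (label t i) * sqlen t i"
    and r_root: "i \<in> {1..affine_rank t} \<Longrightarrow> \<exists>c m. sqlen t i = c * c * m \<and> 0 < m \<and>
      (\<forall>j\<le>affine_rank t. c dvd simple_root i j + r i * int (label t j) \<and>
        c * m dvd (simple_root i j + r i * int (label t j)) * sqlen t j)"
begin

abbreviation k :: int where "k \<equiv> int (twist t)"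
abbreviation W\<^sub>a where "W\<^sub>a \<equiv> W {..n}"
abbreviation J\<^sub>0 where "J\<^sub>0 \<equiv> {..n} - {p}"

lemma k_label: "k * a p = 2"
  using twist_label by (metis of_nat_mult of_nat_numeral)

lemma k_pos: "0 < k" and a_p_pos: "0 < a p"
  using twist_label by (auto intro: Nat.gr0I)

definition \<kappa> :: root_vec where "\<kappa> = k *\<^sub>s \<delta>"

lemma kappa_p: "\<kappa> p = 2"
  using p_le k_label by (simp add: \<kappa>_def delta_def)

lemma weyl_kappa:
  assumes "w \<in> W\<^sub>a"
  shows "w \<kappa> = \<kappa>"
  by (simp only: \<kappa>_def weyl_smul[OF assms] weyl_delta[OF assms order_refl])

lemma form_kappa [simp]: "B v \<kappa> = 0" "B \<kappa> v = 0"
  by (simp_all add: \<kappa>_def)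

lemma kappa_beyond: "i > n \<Longrightarrow> \<kappa> i = 0"
  by (simp add: \<kappa>_def delta_def)

text \<open>The form does not see \<open>\<kappa>\<close>, and divisibility survives because
  \<open>twist_divides\<close> makes every half norm of a root divide
  \<open>k * a i * sq i\<close>.\<close>

lemma root_shift:
  assumes "root v"
  shows "root (v + q *\<^sub>s \<kappa>)"
proof -
  obtain m where m: "root_of_norm m v" using assms by (auto simp: root_def)
  then obtain j where j: "j \<le> n" "sq j = m" using root_norm_bound by blast
  have "m dvd sq i * (v + q *\<^sub>s \<kappa>) i" if "i \<le> n" for i
  proof -
    have "m dvd q * (k * a i * sq i)" using twist_divides[OF that j(1)] j(2) by simp
    then have "m dvd sq i * (q *\<^sub>s \<kappa>) i" using that by (simp add: \<kappa>_def delta_def mult_ac)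
    then show ?thesis using m that by (auto simp: root_of_norm_def distrib_left)
  qed
  then have "root_of_norm m (v + q *\<^sub>s \<kappa>)"
    using m by (simp add: root_of_norm_def kappa_beyond)
  then show ?thesis by (auto simp: root_def)
qed

lemma coroot_kappa [simp]: "root b \<Longrightarrow> coroot b \<kappa> = 0" "coroot (b + q *\<^sub>s \<kappa>) v = coroot b v"
  by (simp add: \<kappa>_def) (simp add: coroot_def)

lemma even_root_reduce:
  assumes "root v" "even (v p)"
  obtains u where "root u" "u p = 0" "v = u + (v p div 2) *\<^sub>s \<kappa>"
proof -
  let ?u = "v + (- (v p div 2)) *\<^sub>s \<kappa>"
  have "?u p = 0" using assms(2) by (auto simp: kappa_p elim: evenE)
  moreover have "v = ?u + (v p div 2) *\<^sub>s \<kappa>" by (auto simp: fun_eq_iff)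
  ultimately show ?thesis using that root_shift[OF assms(1)] by blast
qed

lemma grade_zero_support: "root b \<Longrightarrow> b p = 0 \<Longrightarrow> i \<notin> J\<^sub>0 \<Longrightarrow> b i = 0"
  using root_beyond by (cases "i = p") auto

lemma grade_zero_null: "root b \<Longrightarrow> root c \<Longrightarrow> b p + c p = 0 \<Longrightarrow> B (b + c) (b + c) = 0 \<Longrightarrow> b + c = 0"
  using form_null_zero[of "b + c" p] p_le by (simp add: root_beyond)

section \<open>The coroot lattice of the roots of height 0\<close>

lemma coroot_reflection:
  assumes "root b" "root c"
  shows "coroot (reflection c b) v = coroot b (reflection c v)"
proof -
  have "reflection c (reflection c v) = v"
    by (simp add: reflection_def assms fun_eq_iff)
  then show ?thesis
    using weyl_coroot[OF reflection_in_affine_weyl[OF assms(2)] _ assms(1), of "reflection c v"] by simp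
qed

text \<open>With \<open>b\<close> at least as long as \<open>c\<close>, the integer
  \<open>coroot b c\<close> is -1 or -2. In the first case the sum of the coroots is the coroot of
  \<open>reflection c b\<close>; in the second \<open>b + c\<close> is a null vector of height 0,
  hence 0, and the coroots cancel.\<close>

lemma coroot_merge_aux:
  assumes b: "root_of_norm m b" and c: "root_of_norm m' c" and "m' \<le> m"
    and p: "b p = 0" "c p = 0" and neg: "coroot c b < 0"
  shows "(\<forall>v. coroot b v + coroot c v = 0) \<or>
    (\<exists>g. root g \<and> g p = 0 \<and> (\<forall>v. coroot b v + coroot c v = coroot g v))"
proof -
  have roots: "root b" "root c" using b c by (auto simp: root_def)
  have m: "m > 0" "m' > 0" "B b b = 2 * m" "B c c = 2 * m'" using b c by (auto simp: root_of_norm_def)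
  have bc: "B b c = coroot c b * m'" "B c b = coroot b c * m"
    using root_of_norm_coroot[OF c] root_of_norm_coroot[OF b] by auto
  have lt: "coroot b c < 0"
    using bc form_sym[of b c] m neg by (metis mult_less_0_iff not_less_iff_gr_or_eq zero_less_mult_iff)
  have sum: "B (b + c) (b + c) = 2 * m' + 2 * m * (1 + coroot b c)"
    using bc form_sym[of b c] m by (simp add: algebra_simps)
  have "coroot b c \<ge> -2"
  proof (rule ccontr)
    assume "\<not> ?thesis"
    then have "m * (1 + coroot b c) \<le> m * (- 2)" using m by (intro mult_left_mono) auto
    then show False using sum form_nonneg[of "b + c"] \<open>m' \<le> m\<close> m by linarith
  qed
  then consider "coroot b c = -1" | "coroot b c = -2" using lt by linarith
  then show ?thesis
  proof cases
    case 1
    have "coroot (reflection c b) v = coroot b v + coroot c v" for v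
      using roots 1 by (simp add: coroot_reflection) (simp add: reflection_def)
    moreover have "root (reflection c b)" "reflection c b p = 0"
      using roots root_reflection p by (auto simp: reflection_def)
    ultimately show ?thesis by metis
  next
    case 2
    then have "B (b + c) (b + c) = 0" using sum form_nonneg[of "b + c"] \<open>m' \<le> m\<close> by simp
    then have "b + c = 0" using grade_zero_null roots p by simp
    then have "c = - b" by (simp add: eq_neg_iff_add_eq_0 add.commute)
    then have "m' = m" using m by simp
    have "coroot c v = - coroot b v" for v
      using root_of_norm_coroot[OF b, of v] \<open>m' = m\<close>
      by (intro coroot_eqI[OF c]) (simp add: \<open>c = - b\<close>)
    then show ?thesis by simp
  qed
qed

lemma coroot_merge:
  assumes "root b" "root c" "b p = 0" "c p = 0" "coroot c b < 0"
  shows "(\<forall>v. coroot b v + coroot c v = 0) \<or>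
    (\<exists>g. root g \<and> g p = 0 \<and> (\<forall>v. coroot b v + coroot c v = coroot g v))"
proof -
  obtain m m' where m: "root_of_norm m b" "root_of_norm m' c" using assms by (auto simp: root_def)
  have "coroot b c < 0"
    using root_of_norm_coroot[OF m(2), of b] root_of_norm_coroot[OF m(1), of c] form_sym[of b c] m assms(5)
    by (metis mult_less_0_iff not_less_iff_gr_or_eq root_of_norm_def zero_less_mult_iff)
  then show ?thesis
    using coroot_merge_aux[OF m] coroot_merge_aux[OF m(2,1)] assms
    by (cases "m' \<le> m") (auto simp: add.commute)
qed

text \<open>A list, so that coroots may be repeated and an expression has a length to
  minimise.\<close>

definition coroot_sum :: "(root_vec \<Rightarrow> int) \<Rightarrow> root_vec list \<Rightarrow> bool" where
  "coroot_sum f bs \<longleftrightarrow> (\<forall>b\<in>set bs. root b \<and> b p = 0) \<and> (\<forall>v. f v = (\<Sum>b\<leftarrow>bs. coroot b v))"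

lemma coroot_sum_append:
  "coroot_sum f bs \<Longrightarrow> coroot_sum g cs \<Longrightarrow> coroot_sum (\<lambda>v. f v + g v) (bs @ cs)"
  by (auto simp: coroot_sum_def)

lemma coroot_sum_level_zero:
  assumes "\<And>i. i \<notin> J\<^sub>0 \<Longrightarrow> e i = 0"
  shows "\<exists>bs. coroot_sum (level_zero e) bs"
proof -
  have pairing: "\<exists>bs. coroot_sum (\<lambda>v. c * pairing i v) bs" if i: "i \<in> J\<^sub>0" for i and c :: int
  proof -
    have grade: "root (\<alpha> i)" "\<alpha> i p = 0" using i by simp (use i in \<open>simp add: simple_root_def\<close>)
    have minus: "coroot (- \<alpha> i) v = - pairing i v" for v
      using i by (intro coroot_eqI[of "sq i"]) (simp_all add: root_of_norm_simple form_sym[of v] form_simple)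
    have "coroot_sum (\<lambda>v. int x * pairing i v) (replicate x (\<alpha> i))"
      "coroot_sum (\<lambda>v. - int x * pairing i v) (replicate x (- \<alpha> i))" for x
      using grade i minus by (auto simp: coroot_sum_def sum_list_replicate map_replicate coroot_simple)
    then have "\<exists>bs. coroot_sum (\<lambda>v. int x * pairing i v) bs" "\<exists>bs. coroot_sum (\<lambda>v. - int x * pairing i v) bs" for x
      by blast+
    then show ?thesis by (cases c rule: int_cases2) (simp_all only:)
  qed
  have "\<exists>bs. coroot_sum (\<lambda>v. \<Sum>i\<in>I. e i * pairing i v) bs" if "finite I" "I \<subseteq> J\<^sub>0" for I
    using that
  proof (induction I rule: finite_induct)
    case empty
    show ?case by (intro exI[of _ "[]"]) (simp add: coroot_sum_def)
  next
    case (insert i I)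
    obtain bs cs where "coroot_sum (\<lambda>v. \<Sum>i\<in>I. e i * pairing i v) bs" "coroot_sum (\<lambda>v. e i * pairing i v) cs"
      using insert pairing[of i "e i"] by auto
    then have "coroot_sum (\<lambda>v. e i * pairing i v + (\<Sum>i\<in>I. e i * pairing i v)) (cs @ bs)"
      by (rule coroot_sum_append[rotated])
    then show ?case using insert(1,2) by auto
  qed
  moreover have "level_zero e = (\<lambda>v. \<Sum>i\<in>J\<^sub>0. e i * pairing i v)"
    unfolding level_zero_def using assms by (intro ext sum.mono_neutral_right) auto
  ultimately show ?thesis by auto
qed

text \<open>The coroot lattice contains no nonzero minuscule element: in a shortest expression of such an
  element as a sum of coroots, some two summands can be merged.\<close>
lemma no_minuscule:
  assumes "\<And>i. i \<notin> J\<^sub>0 \<Longrightarrow> e i = 0" "\<And>b. root b \<Longrightarrow> b p = 0 \<Longrightarrow> level_zero e b \<le> 1"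
  shows "level_zero e v = 0"
proof -
  obtain bs0 where "coroot_sum (level_zero e) bs0" using coroot_sum_level_zero assms(1) by blast
  then obtain bs where bs: "coroot_sum (level_zero e) bs"
    and minimal: "\<And>cs. coroot_sum (level_zero e) cs \<Longrightarrow> length bs \<le> length cs"
    using ex_has_least_nat[of "coroot_sum (level_zero e)" bs0 length] by blast
  show ?thesis
  proof (cases bs)
    case Nil
    then show ?thesis using bs by (simp add: coroot_sum_def)
  next
    case (Cons b bs')
    then have b: "root b" "b p = 0" using bs by (auto simp: coroot_sum_def)
    \<comment> \<open>The head takes the value 2 on its own root while the whole sum is at most 1,
      so some other summand is negative on \<open>b\<close> and can be merged with the head.\<close>
    have "level_zero e b = 2 + (\<Sum>c\<leftarrow>bs'. coroot c b)"
      using bs Cons b by (simp add: coroot_sum_def)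
    then have "(\<Sum>c\<leftarrow>bs'. coroot c b) < 0" using assms(2)[OF b] by simp
    then have "\<exists>c\<in>set bs'. coroot c b < 0"
      using sum_list_nonneg[of "map (\<lambda>c. coroot c b) bs'"] by (force simp: not_less)
    then obtain c where c: "c \<in> set bs'" "coroot c b < 0" by blast
    then have c': "root c" "c p = 0" using bs Cons by (auto simp: coroot_sum_def)
    let ?rest = "remove1 c bs'"
    have rest: "level_zero e v = (coroot b v + coroot c v) + (\<Sum>b\<leftarrow>?rest. coroot b v)" for v
      using bs Cons sum_list_map_remove1[OF c(1), of "\<lambda>b. coroot b v"] by (simp add: coroot_sum_def)
    have len: "length bs = Suc (Suc (length ?rest))"
      using Cons c(1) by (simp add: length_remove1) (metis Suc_pred length_pos_if_in_set)
    have set_rest: "\<forall>b\<in>set ?rest. root b \<and> b p = 0"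
      using bs Cons set_remove1_subset[of c bs'] by (auto simp: coroot_sum_def)
    consider "\<forall>v. coroot b v + coroot c v = 0"
      | g where "root g" "g p = 0" "\<forall>v. coroot b v + coroot c v = coroot g v"
      using coroot_merge[OF b(1) c'(1) b(2) c'(2) c(2)] by blast
    then show ?thesis
    proof cases
      case 1
      then have "coroot_sum (level_zero e) ?rest" using rest set_rest by (simp add: coroot_sum_def)
      then show ?thesis using minimal[of ?rest] len by simp
    next
      case 2
      then have "coroot_sum (level_zero e) (g # ?rest)" using rest set_rest by (simp add: coroot_sum_def)
      then show ?thesis using minimal[of "g # ?rest"] len by simp
    qed
  qed
qed

section \<open>Translation lattices and the factorisation over \<open>W {1..n}\<close>\<close>

definition L\<^sub>f :: "(nat \<Rightarrow> int) set" where
  "L\<^sub>f = {c. (\<forall>i. i \<notin> {1..n} \<longrightarrow> c i = 0) \<and> (\<forall>i\<in>{1..n}. r i dvd c i)}"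

text \<open>\<open>L\<^sub>f\<close> holds the coefficients of all translations of the affine Weyl
  group, \<open>L\<^sub>0\<close> those of T'. Omitting one node (0 or p) makes coefficients unique
  within each lattice, but a common translation may have different coefficients in the two.\<close>

definition L\<^sub>0 :: "(nat \<Rightarrow> int) set" where
  "L\<^sub>0 = {c. (\<forall>i. i \<notin> J\<^sub>0 \<longrightarrow> c i = 0) \<and> (\<forall>i. k dvd c i)}"

lemma L_f_twist: "i \<in> {1..n} \<Longrightarrow> c \<in> L\<^sub>f \<Longrightarrow> twist_coeffs i c \<in> L\<^sub>f"
proof -
  assume i: "i \<in> {1..n}" and c: "c \<in> L\<^sub>f"
  have "r i dvd (\<Sum>j\<le>n. c j * A j i)"
  proof (rule dvd_sum)
    fix j assume "j \<in> {..n}"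
    show "r i dvd c j * A j i"
    proof (cases "j = 0")
      case True
      then show ?thesis using c by (simp add: L\<^sub>f_def)
    next
      case False
      then have j: "j \<in> {1..n}" using \<open>j \<in> {..n}\<close> by auto
      then have "r j dvd c j" using c by (simp add: L\<^sub>f_def)
      then obtain x where "c j = r j * x" by (elim dvdE)
      then have "c j * A j i = (r j * A j i) * x" by simp
      then show ?thesis using dvd_mult2[OF r_dvd_cartan[OF j i], of x] by (simp only:)
    qed
  qed
  then show ?thesis using i c by (auto simp: L\<^sub>f_def twist_coeffs_def)
qed

lemma L_0_twist: "i \<in> J\<^sub>0 \<Longrightarrow> c \<in> L\<^sub>0 \<Longrightarrow> twist_coeffs i c \<in> L\<^sub>0"
  by (auto simp: L\<^sub>0_def twist_coeffs_def intro!: dvd_diff dvd_sum)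

lemma L_0_closed:
  "c \<in> L\<^sub>0 \<Longrightarrow> d \<in> L\<^sub>0 \<Longrightarrow> (\<lambda>i. c i + d i) \<in> L\<^sub>0" "c \<in> L\<^sub>0 \<Longrightarrow> (\<lambda>i. - c i) \<in> L\<^sub>0" "(\<lambda>_. 0) \<in> L\<^sub>0"
  by (auto simp: L\<^sub>0_def)

lemma L_f_closed: "c \<in> L\<^sub>f \<Longrightarrow> d \<in> L\<^sub>f \<Longrightarrow> (\<lambda>i. c i + d i) \<in> L\<^sub>f" "(\<lambda>_. 0) \<in> L\<^sub>f"
  by (auto simp: L\<^sub>f_def)

lemma a0_sq0_pos: "0 < a 0 * sq 0"
  using label_pos[of 0] sq_pos[of 0] by simp

lemma a0_sq0_nonzero: "a 0 * sq 0 \<noteq> 0"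
  by (rule less_imp_neq[OF a0_sq0_pos, symmetric])

text \<open>Kac's \<theta>: modulo \<open>\<delta>\<close> it is proportional to
  \<open>\<alpha> 0\<close>, and node 0 does not occur in it. Its half norm contains the square of
  \<open>a 0\<close>, which is 2 for \<open>TwistedA_even\<close>.\<close>

definition \<theta> :: root_vec where "\<theta> = \<delta> - a 0 *\<^sub>s \<alpha> 0"

lemma theta_coord: "\<theta> i = (if i \<in> {1..n} then a i else 0)"
  by (cases "i = 0") (auto simp: \<theta>_def delta_def simple_root_def)

lemma theta_dvd': "i \<in> {1..n} \<Longrightarrow> a 0 * a 0 * sq 0 dvd a i * sq i"
  using theta_dvd dvd_mult_left by blast

lemma theta_norm: "root_of_norm (a 0 * a 0 * sq 0) \<theta>"
proof -
  have "a 0 * a 0 * sq 0 dvd sq i * \<theta> i" if "i \<le> n" for i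
    using theta_dvd'[of i] by (auto simp: theta_coord mult_ac)
  moreover have "B \<theta> \<theta> = 2 * (a 0 * a 0 * sq 0)"
    by (simp add: \<theta>_def form_simple pairing_simple)
  ultimately show ?thesis
    using label_pos[of 0] sq_pos[of 0] by (auto simp: root_of_norm_def theta_coord)
qed

lemma theta_reflection: "reflection \<theta> \<in> W {1..n}"
  using theta_norm by (intro reflection_in_weyl) (auto simp: root_def theta_coord)

text \<open>The coefficients of the coroot of \<open>\<theta>\<close> in the simple coroots. The
  divisor is the half norm of \<open>\<theta>\<close>; by \<open>theta_dvd\<close> the quotient is
  exact and divisible by \<open>r i\<close>.\<close>

definition theta_coeffs :: "nat \<Rightarrow> int" where
  "theta_coeffs i = (if i \<in> {1..n} then a i * sq i div (a 0 * a 0 * sq 0) else 0)"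

lemma theta_coeffs_in_L_f: "theta_coeffs \<in> L\<^sub>f"
proof -
  have "r i dvd a i * sq i div (a 0 * a 0 * sq 0)" if i: "i \<in> {1..n}" for i
  proof -
    obtain x where "a i * sq i = (a 0 * a 0 * sq 0) * (r i * x)"
      using theta_dvd[OF i] by (auto simp: dvd_def mult.assoc)
    then show ?thesis using theta_norm by (simp add: root_of_norm_def)
  qed
  then show ?thesis by (auto simp: L\<^sub>f_def theta_coeffs_def)
qed

lemma coroot_theta: "coroot \<theta> v = level_zero theta_coeffs v"
proof (rule coroot_eqI[OF theta_norm])
  have "B \<theta> v = (\<Sum>i\<le>n. theta_coeffs i * pairing i v * (a 0 * a 0 * sq 0))"
    unfolding form_eq
  proof (intro sum.cong refl)
    fix i assume "i \<in> {..n}"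
    show "sq i * \<theta> i * pairing i v = theta_coeffs i * pairing i v * (a 0 * a 0 * sq 0)"
    proof (cases "i \<in> {1..n}")
      case True
      then have "theta_coeffs i * (a 0 * a 0 * sq 0) = a i * sq i"
        using theta_dvd'[OF True] True by (simp add: theta_coeffs_def)
      moreover have "sq i * \<theta> i * pairing i v = (a i * sq i) * pairing i v"
        using True by (simp add: theta_coord)
      ultimately have "sq i * \<theta> i * pairing i v = theta_coeffs i * (a 0 * a 0 * sq 0) * pairing i v"
        by (simp only:)
      then show ?thesis by (simp only: mult_ac)
    next
      case False
      then show ?thesis by (simp only: theta_coord theta_coeffs_def if_False mult_zero_left mult_zero_right)
    qed
  qed
  then show "B v \<theta> = level_zero theta_coeffs v * (a 0 * a 0 * sq 0)"
    by (simp add: form_sym[of v] level_zero_def sum_distrib_right)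
qed

text \<open>The mirrors of \<open>\<alpha> 0\<close> and \<open>\<theta>\<close> are parallel. Since
  \<open>\<delta> - \<theta>\<close> is \<open>a 0\<close> times \<open>\<alpha> 0\<close>, one
  factor \<open>a 0\<close> passes to the coroot side, where it turns
  \<open>coroot \<theta> v\<close> into \<open>- pairing 0 v\<close>.\<close>

lemma simple_reflection_0: "refl_simple 0 = translation theta_coeffs \<circ> reflection \<theta>"
proof
  fix v
  have root: "root \<theta>" using theta_norm by (auto simp: root_def)
  have "B v \<theta> = - pairing 0 v * (a 0 * sq 0)"
    using form_sym[of v "\<alpha> 0"] by (simp add: \<theta>_def form_simple)
  then have "(coroot \<theta> v * a 0) * (a 0 * sq 0) = - pairing 0 v * (a 0 * sq 0)"
    using root_of_norm_coroot[OF theta_norm, of v] by (simp only: mult_ac)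
  then have cr: "coroot \<theta> v * a 0 = - pairing 0 v"
    by (simp only: mult_right_cancel[OF a0_sq0_nonzero])
  have "level_zero theta_coeffs (reflection \<theta> v) = - coroot \<theta> v"
    unfolding coroot_theta[symmetric] by (simp add: reflection_def root)
  then have "(translation theta_coeffs \<circ> reflection \<theta>) v = reflection \<theta> v - (- coroot \<theta> v) *\<^sub>s \<delta>"
    by (simp only: translation_def comp_apply)
  also have "\<dots> = v + coroot \<theta> v *\<^sub>s (\<delta> - \<theta>)"
    by (simp add: reflection_def fun_eq_iff algebra_simps)
  also have "\<dots> = v + (coroot \<theta> v * a 0) *\<^sub>s \<alpha> 0" by (simp add: \<theta>_def fun_eq_iff)
  also have "\<dots> = refl_simple 0 v" by (simp add: cr simple_reflection_eq fun_eq_iff)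
  finally show "refl_simple 0 v = (translation theta_coeffs \<circ> reflection \<theta>) v" by simp
qed

text \<open>Only the letter 0 needs an argument: it is a translation in \<open>L\<^sub>f\<close>
  after the reflection in \<open>\<theta>\<close>, which lies in \<open>W {1..n}\<close> and
  normalises these translations.\<close>

lemma decompose_f: "w \<in> W\<^sub>a \<Longrightarrow> \<exists>c\<in>L\<^sub>f. \<exists>y\<in>W {1..n}. w = translation c \<circ> y"
proof (induction rule: weyl_subgroup.induct)
  case weyl_id
  show ?case using L_f_closed(2) translation_zero weyl_subgroup.weyl_id by (metis comp_id)
next
  case (weyl_step i w)
  then obtain c y where cy: "c \<in> L\<^sub>f" "y \<in> W {1..n}" "w = translation c \<circ> y" by blast
  show ?case
  proof (cases "i = 0")
    case True
    obtain d where d: "d \<in> L\<^sub>f" "reflection \<theta> \<circ> translation c = translation d \<circ> reflection \<theta>"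
      using weyl_translation[OF theta_reflection _ L_f_twist cy(1)] by auto
    have "refl_simple i \<circ> w = translation theta_coeffs \<circ> (reflection \<theta> \<circ> translation c) \<circ> y"
      by (simp only: True simple_reflection_0 cy(3) comp_assoc)
    also have "\<dots> = (translation theta_coeffs \<circ> translation d) \<circ> (reflection \<theta> \<circ> y)"
      by (simp only: d(2) comp_assoc)
    finally show ?thesis
      using L_f_closed(1)[OF theta_coeffs_in_L_f d(1)] weyl_comp[OF theta_reflection cy(2)]
      unfolding translation_comp by blast
  next
    case False
    then have i: "i \<in> {1..n}" "i \<le> n" using weyl_step(1) by auto
    have "refl_simple i \<circ> w = translation (twist_coeffs i c) \<circ> (refl_simple i \<circ> y)"
      by (simp only: cy(3) comp_assoc[symmetric] simple_reflection_translation[OF i(2)])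
    then show ?thesis using L_f_twist[OF i(1) cy(1)] weyl_subgroup.weyl_step[OF i(1) cy(2)] by blast
  qed
qed

text \<open>By \<open>r_root\<close>, \<open>\<alpha> i\<close> plus \<open>r i\<close> times
  \<open>\<delta>\<close> is \<open>c\<close> times a root, so \<open>r i\<close> times the i-th
  coroot is a product of two reflections. Integer multiples and partial sums over the nodes up to
  \<open>l\<close> give the rest.\<close>

lemma L_f_translation: 
  assumes "c \<in> L\<^sub>f"
  shows "translation c \<in> W\<^sub>a"
proof -
  have neg: "translation (\<lambda>i. - c i) \<in> W\<^sub>a" if "translation c \<in> W\<^sub>a" for c
    using weyl_inv[OF that] inv_unique_comp[OF translation_inverse(1)[of c] translation_inverse(2)[of c]] by simp
  have gen: "translation (\<lambda>j. if j = i then r i else 0) \<in> W\<^sub>a" if i: "i \<in> {1..n}" for i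
  proof -
    obtain c m where cm: "sq i = c * c * m" "0 < m"
        "\<And>j. j \<le> n \<Longrightarrow> c dvd \<alpha> i j + r i * a j"
        "\<And>j. j \<le> n \<Longrightarrow> c * m dvd (\<alpha> i j + r i * a j) * sq j"
      using r_root[OF i] by blast
    have c0: "c \<noteq> 0" using cm(1) sq_pos[of i] i by auto
    define x where "x = \<alpha> i + r i *\<^sub>s \<delta>"
    define b :: root_vec where "b j = x j div c" for j
    have xj: "x j = (if j \<le> n then \<alpha> i j + r i * a j else 0)" for j
      using i by (auto simp: x_def delta_def simple_root_def)
    have x: "x = c *\<^sub>s b"
      using cm(3) by (auto simp: b_def xj fun_eq_iff)
    have "c * c * B b b = B x x" by (simp add: x)
    also have "\<dots> = c * c * (2 * m)"
      using i by (simp add: x_def form_sym[of \<delta>] form_simple pairing_simple cm(1))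
    finally have "B b b = 2 * m" using c0 by simp
    moreover have "m dvd sq j * b j" if "j \<le> n" for j
    proof -
      have "\<alpha> i j + r i * a j = c * b j" using that xj[of j] unfolding x by simp
      then have "c * m dvd c * (sq j * b j)"
        using cm(4)[OF that] by (simp only: mult_ac)
      then show ?thesis using c0 by simp
    qed
    ultimately have "root_of_norm m b"
      using cm(2) by (auto simp: root_of_norm_def b_def xj)
    then show ?thesis
      using translation_in_affine_weyl[of i "r i" c b m] i x cm(1) by (auto simp: x_def)
  qed
  have mult: "translation (\<lambda>j. if j = i then r i * x else 0) \<in> W\<^sub>a" if i: "i \<in> {1..n}" for i and x :: int
  proof -
    have nat: "translation (\<lambda>j. if j = i then r i * int y else 0) \<in> W\<^sub>a" for y
    proof (induction y)
      case 0
      have "(\<lambda>j. if j = i then r i * int 0 else 0) = (\<lambda>_. 0)" by auto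
      then show ?case by (simp only:) (subst translation_zero, rule weyl_id)
    next
      case (Suc y)
      have "translation (\<lambda>j. if j = i then r i * int (Suc y) else 0) =
          translation (\<lambda>j. if j = i then r i else 0) \<circ> translation (\<lambda>j. if j = i then r i * int y else 0)"
        unfolding translation_comp by (intro arg_cong[of _ _ translation]) (auto simp: algebra_simps)
      then show ?case using weyl_comp[OF gen[OF i] Suc] by (simp only:)
    qed
    have "(\<lambda>j. - (if j = i then r i * int y else 0)) = (\<lambda>j. if j = i then r i * - int y else 0)" for y
      by auto
    then show ?thesis
      using nat neg[OF nat] by (cases x rule: int_cases2) (simp_all only:)
  qed
  have "translation (\<lambda>i. if i \<in> {1..l} then c i else 0) \<in> W\<^sub>a" if "l \<le> n" for l
    using that
  proof (induction l)
    case 0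
    have "(\<lambda>i. if i \<in> {1..0} then c i else 0) = (\<lambda>_. 0)" by auto
    then show ?case by (simp only:) (subst translation_zero, rule weyl_id)
  next
    case (Suc l)
    have "r (Suc l) dvd c (Suc l)" using assms Suc.prems by (auto simp: L\<^sub>f_def)
    then obtain x where x: "c (Suc l) = r (Suc l) * x" by (elim dvdE)
    have "translation (\<lambda>i. if i \<in> {1..Suc l} then c i else 0) =
        translation (\<lambda>i. if i \<in> {1..l} then c i else 0) \<circ> translation (\<lambda>i. if i = Suc l then r (Suc l) * x else 0)"
      unfolding translation_comp by (intro arg_cong[of _ _ translation]) (auto simp: x)
    moreover have "translation (\<lambda>i. if i \<in> {1..l} then c i else 0) \<in> W\<^sub>a"
      "translation (\<lambda>i. if i = Suc l then r (Suc l) * x else 0) \<in> W\<^sub>a"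
      using Suc.IH Suc.prems mult[of "Suc l" x] by simp_all
    ultimately show ?case by (simp only: weyl_comp)
  qed
  from this[OF order_refl] show ?thesis
  proof -
    have "c = (\<lambda>i. if i \<in> {1..n} then c i else 0)" using assms by (auto simp: L\<^sub>f_def)
    then show ?thesis using \<open>translation (\<lambda>i. if i \<in> {1..n} then c i else 0) \<in> W\<^sub>a\<close> by argo
  qed
qed

section \<open>Factorisation through the chamber of the roots of even height\<close>

definition X :: "(root_vec \<Rightarrow> root_vec) set" where
  "X = {x \<in> W\<^sub>a. \<forall>b. pos b \<and> even (b p) \<longrightarrow> pos (inv x b)}"

text \<open>An element outside \<open>X\<close> makes the inverse image of some positive root of
  even height negative. By exchange, the reflection in that root shortens the word, and it belongs
  to T' W_sigma since the root is a root of height 0 plus a multiple of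
  \<open>\<kappa>\<close>.\<close>

lemma word_decompose:
  "set is \<subseteq> {..n} \<Longrightarrow> \<exists>c\<in>L\<^sub>0. \<exists>v\<in>W J\<^sub>0. \<exists>x\<in>X. word is = translation c \<circ> v \<circ> x"
proof (induction "is" rule: measure_induct_rule[of length])
  case (less "is")
  have w: "word is \<in> W\<^sub>a" using word_in_weyl less.prems by blast
  show ?case
  proof (cases "word is \<in> X")
    case True
    then show ?thesis
      using L_0_closed(3) weyl_id[of t J\<^sub>0] translation_zero by (metis comp_id id_comp)
  next
    case False
    then obtain b where b: "pos b" "even (b p)" "\<not> pos (inv (word is) b)" using w by (auto simp: X_def)
    then have "pos (- inv (word is) b)" using not_pos_iff w pos_root[OF b(1)] by simp
    moreover have "b = word is (inv (word is) b)" using weyl_inv_apply(2)[OF w] by simp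
    ultimately obtain js where js: "set js \<subseteq> set is" "length js < length is" "reflection b \<circ> word is = word js"
      using word_exchange[OF less.prems b(1)] by blast
    obtain c v x where cvx: "c \<in> L\<^sub>0" "v \<in> W J\<^sub>0" "x \<in> X" "word js = translation c \<circ> v \<circ> x"
      using less.IH[OF js(2)] js(1) less.prems by blast
    obtain b0 where b0: "root b0" "b0 p = 0" "b = b0 + (b p div 2) *\<^sub>s \<kappa>"
      using even_root_reduce[OF pos_root[OF b(1)] b(2)] by blast
    define q where "q = (b p div 2) * k"
    have "(b p div 2) *\<^sub>s \<kappa> = q *\<^sub>s \<delta>" by (simp add: q_def \<kappa>_def fun_eq_iff)
    then have bq: "b = b0 + q *\<^sub>s \<delta>" using b0(3) by argo
    obtain m where m: "root_of_norm m b0" using b0(1) by (auto simp: root_def)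
    obtain w0 i where "w0 \<in> W J\<^sub>0" "i \<in> J\<^sub>0" "b0 = w0 (\<alpha> i)"
      using root_conjugate[OF m, of J\<^sub>0] grade_zero_support[OF b0(1,2)] by blast
    then obtain e where e: "\<And>j. j \<notin> J\<^sub>0 \<Longrightarrow> e j = 0" "\<And>v. coroot b0 v = level_zero e v"
      using coroot_as_level_zero[of w0 J\<^sub>0 i] by auto
    have refl: "reflection b = translation (\<lambda>i. - q * e i) \<circ> reflection b0"
      using reflection_shift[OF b0(1) _ e(2)] pos_root[OF b(1)] unfolding bq by blast
    have eL: "(\<lambda>i. - q * e i) \<in> L\<^sub>0" using e(1) by (auto simp: L\<^sub>0_def q_def)
    have r0: "reflection b0 \<in> W J\<^sub>0" using reflection_in_weyl[OF b0(1), of J\<^sub>0] grade_zero_support[OF b0(1,2)] by blast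
    obtain d where d: "d \<in> L\<^sub>0" "reflection b0 \<circ> translation c = translation d \<circ> reflection b0"
      using weyl_translation[OF r0 _ L_0_twist cvx(1)] by auto
    have "reflection b (reflection b v) = v" for v
      by (simp add: reflection_def pos_root[OF b(1)] fun_eq_iff)
    then have "reflection b \<circ> reflection b = id" by (auto simp: fun_eq_iff)
    then have "word is = reflection b \<circ> word js"
      by (simp only: js(3)[symmetric] comp_assoc[symmetric] id_comp)
    also have "\<dots> = translation (\<lambda>i. - q * e i) \<circ> (reflection b0 \<circ> translation c) \<circ> v \<circ> x"
      by (simp only: cvx(4) refl comp_assoc)
    also have "\<dots> = (translation (\<lambda>i. - q * e i) \<circ> translation d) \<circ> (reflection b0 \<circ> v) \<circ> x"
      by (simp only: d(2) comp_assoc)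
    finally show ?thesis
      using L_0_closed(1)[OF eL d(1)] weyl_comp[OF r0 cvx(2)] cvx(3) unfolding translation_comp by blast
  qed
qed

lemma decompose_0: "w \<in> W\<^sub>a \<Longrightarrow> \<exists>c\<in>L\<^sub>0. \<exists>v\<in>W J\<^sub>0. \<exists>x\<in>X. w = translation c \<circ> v \<circ> x"
  using weyl_has_word[of w "{..n}"] word_decompose by blast

lemma translation_eq_id: "(\<And>v. level_zero c v = 0) \<Longrightarrow> translation c = id"
  by (rule ext) (simp add: translation_def)

text \<open>After cancelling \<open>v\<close>, the two elements of \<open>X\<close> differ by
  \<open>v0\<close> followed by \<open>translation d\<close>. Since both keep \<open>b\<close> and
  \<open>\<kappa> - b\<close> positive for positive \<open>b\<close> of height 0, \<open>d\<close>
  takes values between -k and k on roots of height 0. So \<open>d / k\<close> is minuscule, hence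
  zero, and then \<open>v0\<close> keeps simple roots positive.\<close>

lemma decompose_0_unique:
  assumes c: "c \<in> L\<^sub>0" and v: "v \<in> W J\<^sub>0" "v' \<in> W J\<^sub>0" and x: "x \<in> X" "x' \<in> X"
    and eq: "v \<circ> x = translation c \<circ> (v' \<circ> x')"
  shows "v = v' \<and> x = x'"
proof -
  have J: "J\<^sub>0 \<subseteq> {..n}" by blast
  have xW: "x \<in> W\<^sub>a" "x' \<in> W\<^sub>a" using x by (auto simp: X_def)
  obtain d where d: "d \<in> L\<^sub>0" "inv v \<circ> translation c = translation d \<circ> inv v"
    using weyl_translation[OF weyl_inv[OF v(1) J] J L_0_twist c] by auto
  define v0 where "v0 = inv v \<circ> v'"
  have v0: "v0 \<in> W J\<^sub>0" unfolding v0_def by (intro weyl_comp weyl_inv v J)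
  have "inv v \<circ> v = id" using weyl_bij[OF v(1) J] by (simp add: bij_is_inj)
  then have "x = inv v \<circ> (v \<circ> x)" by (simp only: comp_assoc[symmetric] id_comp)
  also have "\<dots> = translation d \<circ> v0 \<circ> x'"
    unfolding eq v0_def by (metis comp_assoc d(2))
  finally have x_eq: "x z = translation d (v0 (x' z))" for z by (metis comp_apply)
  have bound: "0 \<le> - level_zero d (v0 b) \<and> - level_zero d (v0 b) \<le> k \<and> pos (translation d (v0 b))"
    if b: "pos b" "b p = 0" for b
  proof -
    have rb: "root b" using b pos_root by blast
    define y where "y = inv x' b"
    have xy: "x y = translation d (v0 b)"
      using x_eq weyl_inv_apply(2)[OF xW(2)] by (simp add: y_def)
    have ypos: "pos y" using x(2) b by (auto simp: X_def y_def)
    have v0p: "v0 b p = 0" using weyl_coord[OF v0, of p] b(2) by simp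
    obtain l where l: "level_zero d (v0 b) = k * l"
    proof -
      have "k dvd level_zero d (v0 b)"
        unfolding level_zero_def using d(1) by (intro dvd_sum) (auto simp: L\<^sub>0_def)
      then show ?thesis using that by (auto simp: dvd_def)
    qed
    \<comment> \<open>As k a_p = 2, the shift by \<open>k * l\<close> times \<open>\<delta>\<close>
      changes the height by \<open>2 * l\<close>. Positivity of this root and of its complement to
      \<open>\<kappa>\<close> will leave only the heights 0 and 2.\<close>
    have xyp: "x y p = - 2 * l"
      using v0p p_le l k_label unfolding xy translation_def by (simp add: delta_def mult_ac)
    have rx: "root (x y)" using ypos xW by (auto simp: pos_def)
    \<comment> \<open>The defining property of \<open>X\<close> reversed, by applying it to
      \<open>- z\<close>.\<close>
    have pos1: "pos z" if "pos (inv x z)" "root z" "even (z p)" for z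
    proof (rule ccontr)
      assume "\<not> pos z"
      then have "pos (- z)" using that not_pos_iff by blast
      then have "pos (inv x (- z))" using x(1) that by (auto simp: X_def)
      then show False using that(1) weyl_uminus[OF weyl_inv[OF xW(1)]] not_pos_and_neg by auto
    qed
    have p1: "pos (x y)"
      using pos1[of "x y"] ypos rx xyp weyl_inv_apply(1)[OF xW(1)] by simp
    have rk: "root (\<kappa> - z)" if "root z" for z
      using root_shift[of "- z" 1] that by (simp add: add.commute)
    have kb: "pos (\<kappa> - b)" using posI[OF rk[OF rb], of p] kappa_p b by simp
    have "pos (inv x' (\<kappa> - b))" using x(2) kb b(2) kappa_p by (auto simp: X_def)
    then have "pos (\<kappa> - y)"
      using weyl_diff[OF weyl_inv[OF xW(2)]] weyl_kappa[OF weyl_inv[OF xW(2)]] by (simp add: y_def)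
    moreover have "inv x (\<kappa> - x y) = \<kappa> - y"
      using weyl_diff[OF weyl_inv[OF xW(1)]] weyl_kappa[OF weyl_inv[OF xW(1)]] weyl_inv_apply(1)[OF xW(1)] by simp
    ultimately have p2: "pos (\<kappa> - x y)"
      using pos1[of "\<kappa> - x y"] rk[OF rx] xyp kappa_p by simp
    have "0 \<le> x y p" "0 \<le> (\<kappa> - x y) p" using p1 p2 by (simp_all only: pos_def)
    then have "0 \<le> - l" "- l \<le> 1" using xyp kappa_p by auto
    then have "0 \<le> k * - l" "k * - l \<le> k * 1"
      using k_pos by (simp_all only: mult_left_mono mult_nonneg_nonneg order_less_imp_le)
    then show ?thesis using p1 xy l by simp
  qed
  have bound': "\<bar>level_zero d g\<bar> \<le> k" if g: "root g" "g p = 0" for g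
  proof -
    define b where "b = inv v0 g"
    have v0b: "v0 b = g" using weyl_inv_apply(2)[OF v0] by (auto simp: b_def)
    have b: "root b" "b p = 0"
      using root_weyl[OF weyl_inv[OF v0] _ g(1)] weyl_coord[OF weyl_inv[OF v0], of p] g(2) by (auto simp: b_def)
    consider "pos b" | "pos (- b)" using pos_or_neg b by blast
    then show ?thesis
    proof cases
      case 1
      then show ?thesis using bound[of b] b v0b by auto
    next
      case 2
      then show ?thesis using bound[of "- b"] b v0b weyl_uminus[OF v0, of b] by auto
    qed
  qed
  define e where "e i = d i div k" for i
  have de: "d i = k * e i" for i using d(1) by (simp add: e_def L\<^sub>0_def)
  then have lz: "level_zero d v = k * level_zero e v" for v
    using level_zero_coeffs(3)[of k e v] by (metis ext)
  have "level_zero e v = 0" for v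
  proof (rule no_minuscule)
    show "e i = 0" if "i \<notin> J\<^sub>0" for i using d(1) that by (auto simp: e_def L\<^sub>0_def)
  next
    fix b assume "root b" "b p = 0"
    then have "k * level_zero e b \<le> k * 1" using bound'[of b] lz[of b] by simp
    then show "level_zero e b \<le> 1" using k_pos by (simp only: mult_le_cancel_left_pos)
  qed
  then have "translation d = id" using lz by (intro translation_eq_id) simp
  moreover have "v0 = id"
  proof (rule weyl_trivial[OF v0 J])
    fix i assume i: "i \<in> J\<^sub>0"
    have "\<alpha> i p = 0" using i by (simp add: simple_root_def)
    then show "pos (v0 (\<alpha> i))" using bound[of "\<alpha> i"] i \<open>translation d = id\<close> by simp
  qed
  ultimately have "x = x'" using x_eq by auto
  moreover have "v' z = v z" for z
  proof -
    have "inv v (v' z) = z" using \<open>v0 = id\<close> by (metis comp_apply id_apply v0_def)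
    then show ?thesis using weyl_inv_apply(2)[OF v(1) J, of "v' z"] by simp
  qed
  ultimately show ?thesis by auto
qed

text \<open>The functional \<open>\<Sum> e\<^sub>i \<alpha>\<^sub>i\<^sup>\<or>\<close> vanishes; this single relation among the simple coroots lets us compare
  the lattices spanned by those with \<open>i \<noteq> 0\<close> and by those with \<open>i \<noteq> p\<close>.\<close>
definition colabel_ratio :: "nat \<Rightarrow> int" where
  "colabel_ratio i = a i * sq i div (a 0 * sq 0)"

lemma colabel_ratio_eq: "i \<le> n \<Longrightarrow> a 0 * sq 0 * colabel_ratio i = a i * sq i"
  using label_sq_dvd by (simp add: colabel_ratio_def)

lemma colabel_ratio_pos: "i \<le> n \<Longrightarrow> 0 < colabel_ratio i"
  using colabel_ratio_eq[of i] a0_sq0_pos label_pos[of i] sq_pos[of i]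
  by (metis mult_pos_pos of_nat_0_less_iff zero_less_mult_pos)

lemma colabel_ratio_0: "colabel_ratio 0 = 1"
  unfolding colabel_ratio_def by (rule div_self[OF a0_sq0_nonzero])

text \<open>Modulo T' a coordinate may change by \<open>k\<close>, but \<open>L\<^sub>0\<close>
  omits node p, so coordinate \<open>p\<close> moves only through the coroot relation. The relation
  is used in multiples of \<open>k\<close>, because its coefficient 1 at node 0 must become
  divisible by \<open>k\<close>.\<close>

definition modulus :: "nat \<Rightarrow> int" where
  "modulus i = (if i = p then k * colabel_ratio p else k)"

text \<open>The set R of the overview, one coefficient family for each class of translations modulo
  T'. An extensional product can be counted directly; \<open>extend\<close> then replaces the
  default values by 0.\<close>

definition residues :: "(nat \<Rightarrow> int) set" where
  "residues = PiE {1..n} (\<lambda>i. {x. r i dvd x \<and> 0 \<le> x \<and> x < modulus i})"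

definition extend :: "(nat \<Rightarrow> int) \<Rightarrow> nat \<Rightarrow> int" where
  "extend \<rho> i = (if i \<in> {1..n} then \<rho> i else 0)"

lemma modulus_pos: "0 < modulus i"
  using k_pos colabel_ratio_pos[OF p_le] by (simp add: modulus_def)

lemma r_dvd_modulus: "i \<in> {1..n} \<Longrightarrow> r i dvd modulus i"
  using r_dvd_twist by (simp add: modulus_def)

lemma card_residues: "card residues = (\<Prod>i\<in>{1..n}. nat (modulus i div r i))"
proof -
  have "card residues = (\<Prod>i\<in>{1..n}. card {x. r i dvd x \<and> 0 \<le> x \<and> x < modulus i})"
    unfolding residues_def by (rule card_PiE) simp
  also have "\<dots> = (\<Prod>i\<in>{1..n}. nat (modulus i div r i))"
    using r_pos r_dvd_modulus modulus_pos by (intro prod.cong refl card_multiples_below) (auto simp: less_imp_le)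
  finally show ?thesis .
qed

lemma reduce_L_f:
  assumes c: "c \<in> L\<^sub>f"
  shows "\<exists>c'\<in>L\<^sub>0. \<exists>\<rho>\<in>residues. translation c = translation c' \<circ> translation (extend \<rho>)"
proof -
  \<comment> \<open>The multiple of the relation, in units of \<open>k\<close>, that brings
    coordinate \<open>p\<close> into range. For \<open>p = 0\<close> nothing has to be reduced, as
    elements of \<open>L\<^sub>f\<close> vanish at node 0.\<close>
  define z where "z = (if p = 0 then 0 else - (c p div modulus p))"
  define \<rho> where "\<rho> = (\<lambda>i\<in>{1..n}. c i mod modulus i)"
  define c' where "c' i = (if i \<le> n then c i + k * z * colabel_ratio i - extend \<rho> i else 0)" for i
  have "\<rho> \<in> residues"
    using c r_dvd_modulus modulus_pos by (auto simp: residues_def \<rho>_def L\<^sub>f_def intro: dvd_mod)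
  have ext_eq: "extend \<rho> i = (if i \<in> {1..n} then c i mod modulus i else 0)" for i
    by (simp add: extend_def \<rho>_def)
  have c0: "c 0 = 0" using c by (auto simp: L\<^sub>f_def)
  have c'p: "c' p = 0"
  proof (cases "p = 0")
    case True
    then show ?thesis using c0 by (simp add: c'_def ext_eq z_def)
  next
    case False
    then have "c' p = c p - modulus p * (c p div modulus p) - c p mod modulus p"
      using p_le by (simp add: c'_def ext_eq z_def modulus_def)
    then show ?thesis by (simp add: minus_mult_div_eq_mod)
  qed
  have "k dvd c' i" for i
  proof (cases "i \<in> {1..n} \<and> i \<noteq> p")
    case True
    then have "c' i = k * z * colabel_ratio i + (c i - c i mod k)"
      by (simp add: c'_def ext_eq modulus_def)
    then show ?thesis by (simp add: minus_mod_eq_mult_div)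
  next
    case False
    then show ?thesis using c'p c0 by (cases "i = 0") (auto simp: c'_def ext_eq)
  qed
  then have "c' \<in> L\<^sub>0" using c'p by (auto simp: L\<^sub>0_def c'_def)
  have "level_zero (\<lambda>i. c' i + extend \<rho> i) v = level_zero c v" for v
  proof -
    have "level_zero (\<lambda>i. c' i + extend \<rho> i) v = level_zero (\<lambda>i. c i + k * z * colabel_ratio i) v"
      unfolding level_zero_def by (intro sum.cong refl) (simp add: c'_def)
    also have "\<dots> = level_zero c v + k * z * level_zero colabel_ratio v"
      by (simp only: level_zero_coeffs)
    also have "level_zero colabel_ratio v = 0"
      by (rule level_zero_label[OF colabel_ratio_eq a0_sq0_nonzero])
    finally show ?thesis by simp
  qed
  then have "translation c = translation c' \<circ> translation (extend \<rho>)"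
    unfolding translation_comp by (intro ext) (simp add: translation_def)
  then show ?thesis using \<open>c' \<in> L\<^sub>0\<close> \<open>\<rho> \<in> residues\<close> by blast
qed

lemma eq_of_congruent:
  assumes "0 \<le> x" "x < m" "0 \<le> y" "y < m" "m dvd x - y"
  shows "x = (y :: int)"
  using assms by (metis mod_eq_dvd_iff mod_pos_pos_trivial)

text \<open>\<open>u\<close> is a translation that preserves coordinate 0, hence the identity. The
  coefficient difference \<open>f\<close> is therefore \<open>f 0\<close> times the coroot relation
  with \<open>k\<close> dividing \<open>f 0\<close>, so the residues are congruent.\<close>

lemma decompose_f_unique:
  assumes c: "c \<in> L\<^sub>0" and \<rho>: "\<rho> \<in> residues" "\<rho>' \<in> residues" and y: "y \<in> W {1..n}" "y' \<in> W {1..n}"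
    and eq: "translation (extend \<rho>) \<circ> y = translation c \<circ> (translation (extend \<rho>') \<circ> y')"
  shows "\<rho> = \<rho>' \<and> y = y'"
proof -
  have J: "{1..n} \<subseteq> {..n}" by auto
  define f where "f = (\<lambda>i. - extend \<rho>' i + (- c i + extend \<rho> i))"
  have "translation f \<circ> y = translation (\<lambda>i. - extend \<rho>' i) \<circ> (translation (\<lambda>i. - c i) \<circ> (translation (extend \<rho>) \<circ> y))"
    by (simp only: f_def translation_comp[symmetric] comp_assoc)
  also have "\<dots> = translation (\<lambda>i. - extend \<rho>' i) \<circ> ((translation (\<lambda>i. - c i) \<circ> translation c) \<circ> (translation (extend \<rho>') \<circ> y'))"
    unfolding eq by (simp only: comp_assoc)
  also have "\<dots> = translation (\<lambda>i. - extend \<rho>' i) \<circ> (translation (extend \<rho>') \<circ> y')"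
    by (simp only: translation_inverse id_comp)
  also have "\<dots> = (translation (\<lambda>i. - extend \<rho>' i) \<circ> translation (extend \<rho>')) \<circ> y'"
    by (simp only: comp_assoc)
  finally have fy: "translation f \<circ> y = y'" by (simp only: translation_inverse id_comp)
  define u where "u = y' \<circ> inv y"
  have u: "u \<in> W {1..n}" unfolding u_def by (intro weyl_comp weyl_inv y J)
  have ut: "u z = translation f z" for z
  proof -
    have "u z = translation f (y (inv y z))" unfolding u_def fy[symmetric] by simp
    then show ?thesis using weyl_inv_apply(2)[OF y(1) J] by simp
  qed
  have "u = id"
  proof (rule weyl_trivial[OF u J])
    fix i assume i: "i \<in> {1..n}"
    have "u (\<alpha> i) 0 = \<alpha> i 0" by (rule weyl_coord[OF u]) simp
    then have "level_zero f (\<alpha> i) = 0"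
      using label_pos[of 0] by (simp add: ut translation_def delta_def)
    then have "u (\<alpha> i) = \<alpha> i" by (simp add: ut translation_def)
    then show "pos (u (\<alpha> i))" using i by simp
  qed
  have "level_zero f v = 0" for v
  proof -
    have "translation f v = v" using ut[of v] \<open>u = id\<close> by simp
    then have "translation f v 0 = v 0" by simp
    then show ?thesis using label_pos[of 0] by (simp add: translation_def delta_def)
  qed
  then have f: "f i = f 0 * colabel_ratio i" if "i \<le> n" for i
  proof -
    have "f i * (a 0 * sq 0) = f 0 * (a i * sq i)"
      using level_zero_null[of f i 0] that \<open>\<And>v. level_zero f v = 0\<close> by simp
    also have "\<dots> = f 0 * colabel_ratio i * (a 0 * sq 0)"
      unfolding colabel_ratio_eq[OF that, symmetric] by simp
    finally show ?thesis by (simp only: mult_right_cancel[OF a0_sq0_nonzero])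
  qed
  have kf: "k dvd f 0" using c by (auto simp: f_def extend_def L\<^sub>0_def)
  have "\<rho> i = \<rho>' i" if i: "i \<in> {1..n}" for i
  proof (rule eq_of_congruent[where m = "modulus i"])
    have \<rho>i: "\<rho> i - \<rho>' i = f 0 * colabel_ratio i + c i"
      using f[of i] i by (simp add: f_def extend_def)
    show "modulus i dvd \<rho> i - \<rho>' i"
    proof (cases "i = p")
      case True
      then have "c i = 0" using c by (auto simp: L\<^sub>0_def)
      then have "\<rho> i - \<rho>' i = f 0 * colabel_ratio p" using True \<rho>i by simp
      moreover have "k * colabel_ratio p dvd f 0 * colabel_ratio p" by (rule mult_dvd_mono[OF kf dvd_refl])
      ultimately show ?thesis by (simp add: modulus_def True)
    next
      case False
      then show ?thesis using kf c by (auto simp: \<rho>i modulus_def L\<^sub>0_def)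
    qed
  qed (use \<rho> i in \<open>auto simp: residues_def PiE_iff\<close>)
  then have "\<rho> = \<rho>'"
    by (rule PiE_ext[OF \<rho>[unfolded residues_def]])
  moreover have "y z = y' z" for z
    using \<open>u = id\<close> weyl_inv_apply(1)[OF y(1) J, of z] by (metis comp_apply id_apply u_def)
  ultimately show ?thesis by auto
qed

lemma card_X: "card (W J\<^sub>0) * card X = card residues * card (W {1..n})"
proof -
  let ?T = "translation ` L\<^sub>0"
  let ?X = "(\<lambda>(v, x). v \<circ> x) ` (W J\<^sub>0 \<times> X)"
  let ?Y = "(\<lambda>(\<rho>, y). translation (extend \<rho>) \<circ> y) ` (residues \<times> W {1..n})"
  have ext: "extend \<rho> \<in> L\<^sub>f" if "\<rho> \<in> residues" for \<rho>
    using that by (auto simp: L\<^sub>f_def extend_def residues_def PiE_iff)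
  have J: "{1..n} \<subseteq> {..n}" by auto
  have "card ?X = card ?Y"
  proof (rule transversals_same_card[of ?T ?X W\<^sub>a ?Y])
    show "id \<in> ?T" using L_0_closed(3) translation_zero by (metis imageI)
  next
    fix s t assume "s \<in> ?T" "t \<in> ?T"
    then show "s \<circ> t \<in> ?T" using L_0_closed(1) translation_comp by auto
  next
    fix t assume "t \<in> ?T"
    then show "\<exists>s\<in>?T. s \<circ> t = id" using L_0_closed(2) translation_inverse(2) by auto
  next
    show "?X \<subseteq> W\<^sub>a" using weyl_comp weyl_mono[of _ J\<^sub>0 "{..n}"] by (auto simp: X_def)
  next
    show "?Y \<subseteq> W\<^sub>a" using weyl_comp L_f_translation[OF ext] weyl_mono[OF _ J] by auto
  next
    fix g assume "g \<in> W\<^sub>a"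
    then obtain c v x where "c \<in> L\<^sub>0" "v \<in> W J\<^sub>0" "x \<in> X" "g = translation c \<circ> v \<circ> x"
      using decompose_0 by blast
    then show "\<exists>t\<in>?T. \<exists>x\<in>?X. g = t \<circ> x"
      by (intro bexI[of _ "translation c"] bexI[of _ "v \<circ> x"]) (auto simp only: comp_assoc)
  next
    fix g assume "g \<in> W\<^sub>a"
    then obtain c y where cy: "c \<in> L\<^sub>f" "y \<in> W {1..n}" "g = translation c \<circ> y" using decompose_f by blast
    obtain c' \<rho> where "c' \<in> L\<^sub>0" "\<rho> \<in> residues" "translation c = translation c' \<circ> translation (extend \<rho>)"
      using reduce_L_f[OF cy(1)] by blast
    then show "\<exists>t\<in>?T. \<exists>x\<in>?Y. g = t \<circ> x"
      using cy(2,3) by (intro bexI[of _ "translation c'"] bexI[of _ "translation (extend \<rho>) \<circ> y"]) (auto simp only: comp_assoc)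
  next
    fix x x' t assume "x \<in> ?X" "x' \<in> ?X" and t: "t \<in> ?T" "x = t \<circ> x'"
    then obtain v z v' z' where vz: "v \<in> W J\<^sub>0" "z \<in> X" "x = v \<circ> z" "v' \<in> W J\<^sub>0" "z' \<in> X" "x' = v' \<circ> z'"
      by (elim image_prodE)
    obtain c where c: "c \<in> L\<^sub>0" "t = translation c" using t(1) by blast
    have "v \<circ> z = translation c \<circ> (v' \<circ> z')" using t(2) vz(3,6) c(2) by (simp only:)
    then show "x = x'" using decompose_0_unique[OF c(1) vz(1,4,2,5)] vz(3,6) by blast
  next
    fix y y' t assume "y \<in> ?Y" "y' \<in> ?Y" and t: "t \<in> ?T" "y = t \<circ> y'"
    then obtain \<rho> z \<rho>' z' where rz: "\<rho> \<in> residues" "z \<in> W {1..n}" "y = translation (extend \<rho>) \<circ> z"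
        "\<rho>' \<in> residues" "z' \<in> W {1..n}" "y' = translation (extend \<rho>') \<circ> z'"
      by (elim image_prodE)
    obtain c where c: "c \<in> L\<^sub>0" "t = translation c" using t(1) by blast
    have "translation (extend \<rho>) \<circ> z = translation c \<circ> (translation (extend \<rho>') \<circ> z')"
      using t(2) rz(3,6) c(2) by (simp only:)
    then show "y = y'" using decompose_f_unique[OF c(1) rz(1,4,2,5)] rz(3,6) by blast
  qed
  moreover have "inj_on (\<lambda>(v, x). v \<circ> x) (W J\<^sub>0 \<times> X)"
    using decompose_0_unique[OF L_0_closed(3)] unfolding translation_zero id_comp by (auto simp: inj_on_def)
  moreover have "inj_on (\<lambda>(\<rho>, y). translation (extend \<rho>) \<circ> y) (residues \<times> W {1..n})"
    using decompose_f_unique[OF L_0_closed(3)] unfolding translation_zero id_comp by (auto simp: inj_on_def)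
  ultimately show ?thesis
    by (simp add: card_image card_cartesian_product)
qed

end

section \<open>Minuscule elements\<close>

context affine_diagram
begin

lemma linear_sum:
  assumes "\<And>u v. f (u - v) = f u - (f v :: int)" "\<And>c v. f (c *\<^sub>s v) = c * f v" "finite S"
  shows "f (\<lambda>j. \<Sum>i\<in>S. c i * u i j) = (\<Sum>i\<in>S. c i * f (u i))"
  using assms(3)
proof (induction S rule: finite_induct)
  case empty
  show ?case using assms(2)[of 0 "\<lambda>_. 0"] by (simp add: zero_fun_def)
next
  case (insert i S)
  let ?v = "\<lambda>j. \<Sum>i\<in>S. c i * u i j"
  have "(\<lambda>j. \<Sum>i\<in>insert i S. c i * u i j) = ?v - (- c i) *\<^sub>s u i"
    using insert(1,2) by (auto simp: fun_eq_iff)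
  then have "f (\<lambda>j. \<Sum>i\<in>insert i S. c i * u i j) = f ?v - (- c i) * f (u i)"
    by (simp only: assms(1,2))
  then show ?case using insert by simp
qed

lemma weyl_nonneg:
  assumes "w \<in> W J" "\<And>i. i > n \<Longrightarrow> v i = 0" "\<And>i. i \<le> n \<Longrightarrow> 0 \<le> v i"
    and "\<And>i. i \<le> n \<Longrightarrow> v i \<noteq> 0 \<Longrightarrow> pos (w (\<alpha> i))"
  shows "0 \<le> w v j"
proof -
  have "0 \<le> (\<Sum>i\<le>n. v i * w (\<alpha> i) j)"
  proof (rule sum_nonneg)
    fix i assume i: "i \<in> {..n}"
    show "0 \<le> v i * w (\<alpha> i) j"
      using assms(3,4)[of i] i by (cases "v i = 0") (auto simp: pos_def)
  qed
  then show ?thesis using weyl_expand[OF assms(1), of v] assms(2) by (simp add: fun_eq_iff)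
qed

lemma weyl_sum_list:
  assumes "w \<in> W J"
  shows "w (sum_list vs) = sum_list (map w vs)"
proof (induction vs)
  case Nil
  have "w (0 *\<^sub>s 0) = 0 *\<^sub>s w 0" by (rule weyl_smul[OF assms])
  then show ?case by (simp only: smul_simps sum_list.Nil list.map)
next
  case (Cons v vs)
  then show ?case by (simp only: sum_list.Cons list.map weyl_add[OF assms])
qed

lemma pos_of_nonneg: "root v \<Longrightarrow> (\<And>i. 0 \<le> v i) \<Longrightarrow> pos v"
  by (simp add: pos_def)

lemma pos_nonneg: "pos v \<Longrightarrow> 0 \<le> v i"
  by (simp add: pos_def)

lemma positive_roots_eq: "positive_roots t = {v. pos v} \<union> {m *\<^sub>s \<delta> | m. 0 < m}"
proof (rule set_eqI)
  fix v
  have "(\<exists>m. v = (\<lambda>i. m * \<delta> i) \<and> m \<noteq> 0) \<and> (\<forall>i. 0 \<le> v i) \<longleftrightarrow> (\<exists>m. v = m *\<^sub>s \<delta> \<and> 0 < m)" (is "?l \<longleftrightarrow> ?r")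
  proof
    assume ?l
    then obtain m where m: "v = (\<lambda>i. m * \<delta> i)" "m \<noteq> 0" "0 \<le> v 0" by blast
    then have "0 < m" using label_pos[of 0] by (simp add: delta_def zero_le_mult_iff)
    then show ?r using m by (auto simp: smul_def)
  next
    assume ?r
    then obtain m where "v = m *\<^sub>s \<delta>" "0 < m" by blast
    then show ?l by (auto simp: smul_def delta_def)
  qed
  then show "v \<in> positive_roots t \<longleftrightarrow> v \<in> {v. pos v} \<union> {m *\<^sub>s \<delta> | m. 0 < m}"
    unfolding positive_roots_def affine_roots_def real_roots_eq imaginary_roots_def pos_def by blast
qed

lemma imaginary_not_root: "\<not> root (m *\<^sub>s \<delta>)"
  by (auto simp: root_def root_of_norm_def)

text \<open>Imaginary roots are fixed by the Weyl group and so never inverted.\<close>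

lemma inversion_set_eq:
  assumes w: "w \<in> W {..n}"
  shows "inversion_set t w = {b. pos b \<and> pos (- inv w b)}"
proof -
  have delta: "inv w (m *\<^sub>s \<delta>) = m *\<^sub>s \<delta>" for m
    by (simp only: weyl_smul[OF weyl_inv[OF w order_refl]] weyl_delta[OF weyl_inv[OF w order_refl] order_refl])
  have neg: "(\<lambda>i. - inv w b i) = - inv w b" for b by (simp add: fun_eq_iff)
  have "b \<in> inversion_set t w \<longleftrightarrow> pos b \<and> pos (- inv w b)" for b
  proof
    assume "b \<in> inversion_set t w"
    then have b: "b \<in> positive_roots t" "- inv w b \<in> positive_roots t"
      by (auto simp: inversion_set_def neg)
    have "pos b"
    proof (rule ccontr)
      assume "\<not> pos b"
      then obtain m where m: "b = m *\<^sub>s \<delta>" "0 < m" using b(1) by (auto simp: positive_roots_eq)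
      have "0 \<le> (- inv w b) 0" using b(2) by (simp only: positive_roots_def mem_Collect_eq)
      then show False using m label_pos[of 0] by (simp add: delta) (simp add: delta_def mult_le_0_iff)
    qed
    moreover have "root (- inv w b)" using w pos_root[OF \<open>pos b\<close>] by simp
    then have "- inv w b \<noteq> m *\<^sub>s \<delta>" for m using imaginary_not_root by metis
    then have "pos (- inv w b)" using b(2) unfolding positive_roots_eq by blast
    ultimately show "pos b \<and> pos (- inv w b)" by blast
  next
    assume "pos b \<and> pos (- inv w b)"
    then show "b \<in> inversion_set t w" by (auto simp: inversion_set_def neg positive_roots_eq)
  qed
  then show ?thesis by blast
qed

end

context graded_diagram
begin

definition Y :: "(root_vec \<Rightarrow> root_vec) set" where
  "Y = {x \<in> X. pos (- inv x (\<kappa> + \<alpha> p))}"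

lemma kappa_nonneg: "0 \<le> \<kappa> i"
  by (simp add: \<kappa>_def delta_def)

lemma alpha_p [simp]: "\<alpha> p p = 1"
  by (simp add: simple_root_def)

lemma root_kappa_plus: "root v \<Longrightarrow> root (\<kappa> + v)" "root v \<Longrightarrow> root (\<kappa> - v)"
  using root_shift[of v 1] root_shift[of "- v" 1] by (simp_all add: add.commute)

lemma X_pos: "x \<in> X \<Longrightarrow> root b \<Longrightarrow> b p = 2 \<Longrightarrow> pos (inv x b)"
  using posI[of b p] by (auto simp: X_def)

lemma X_pos_simple:
  assumes "x \<in> X" "i \<in> J\<^sub>0"
  shows "pos (inv x (\<alpha> i))"
proof -
  have "pos (\<alpha> i)" "\<alpha> i p = 0" using assms(2) by simp (use assms(2) in \<open>simp add: simple_root_def\<close>)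
  then show ?thesis using assms(1) by (simp add: X_def)
qed

text \<open>An inverted root of odd height at least 3 is \<open>\<kappa> + \<alpha> p\<close> plus
  simple roots of height 0 and a nonnegative multiple of \<open>\<kappa>\<close>. Elements of
  \<open>X\<close> make none of the added terms negative, so \<open>\<kappa> + \<alpha> p\<close> is
  inverted as well: testing this one root suffices.\<close>

lemma W_ab_eq:
  assumes s: "\<And>i. i \<le> n \<Longrightarrow> s i = (if i = p then 1 else 0)"
  shows "W_ab t s = X - Y"
proof -
  have ht: "ht_sigma t s v = v p" for v
  proof -
    have "ht_sigma t s v = (\<Sum>i\<le>n. if i = p then v i else 0)"
      unfolding ht_sigma_def by (intro sum.cong refl) (simp add: s)
    then show ?thesis using p_le by simp
  qed
  have W_ab: "w \<in> W_ab t s \<longleftrightarrow> w \<in> W\<^sub>a \<and> (\<forall>b. pos b \<and> pos (- inv w b) \<longrightarrow> b p = 1)" for w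
    unfolding W_ab_def affine_weyl_eq ht
    by (auto simp: inversion_set_eq affine_roots_def real_roots_eq pos_root)
  show ?thesis
  proof (intro equalityI subsetI)
    fix w assume "w \<in> W_ab t s"
    then have w: "w \<in> W\<^sub>a" "\<And>b. pos b \<Longrightarrow> pos (- inv w b) \<Longrightarrow> b p = 1" unfolding W_ab by blast+
    have "pos (inv w b)" if "pos b" "even (b p)" for b
      using w(2)[OF that(1)] that not_pos_iff[of "inv w b"] w(1) pos_root[OF that(1)] by auto
    then have "w \<in> X" using w(1) by (auto simp: X_def)
    moreover have "pos (\<kappa> + \<alpha> p)"
      using posI[OF root_kappa_plus(1)[OF root_simple[OF p_le]], of p] kappa_p by simp
    then have "w \<notin> Y" using w(2)[of "\<kappa> + \<alpha> p"] kappa_p by (auto simp: Y_def)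
    ultimately show "w \<in> X - Y" by blast
  next
    fix w assume w: "w \<in> X - Y"
    then have wX: "w \<in> X" and wW: "w \<in> W\<^sub>a" by (auto simp: X_def)
    have u: "inv w \<in> W\<^sub>a" by (rule weyl_inv[OF wW order_refl])
    have "b p = 1" if b: "pos b" "pos (- inv w b)" for b
    proof (rule ccontr)
      assume "b p \<noteq> 1"
      have "odd (b p)"
        using wX b not_pos_and_neg by (auto simp: X_def)
      then have "b p \<ge> 3" using \<open>b p \<noteq> 1\<close> pos_nonneg[OF b(1), of p] by (auto elim!: oddE)
      define q where "q = b p div 2"
      have q: "q \<ge> 1" "b p = 1 + 2 * q" using \<open>odd (b p)\<close> \<open>b p \<ge> 3\<close> unfolding q_def by presburger+
      define g where "g = b + (- q) *\<^sub>s \<kappa>"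
      have g: "root g" "g p = 1"
        using root_shift[OF pos_root[OF b(1)], of "- q"] q kappa_p by (simp_all add: g_def)
      then have gpos: "pos g" using posI[of g p] by simp
      define v where "v = g - \<alpha> p"
      have v: "v p = 0" "\<And>i. 0 \<le> v i" "\<And>i. i > n \<Longrightarrow> v i = 0"
        using g pos_nonneg[OF gpos] root_beyond[OF g(1)] p_le by (auto simp: v_def simple_root_def)
      have "0 \<le> inv w v i" for i
        by (rule weyl_nonneg[OF u]) (use v X_pos_simple[OF wX] in auto)
      moreover have "inv w b = inv w (\<kappa> + \<alpha> p) + inv w v + (q - 1) *\<^sub>s \<kappa>"
      proof -
        have "b = (\<kappa> + \<alpha> p) + v + (q - 1) *\<^sub>s \<kappa>" by (simp add: v_def g_def fun_eq_iff algebra_simps)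
        then show ?thesis
          using weyl_add[OF u] weyl_smul[OF u] weyl_kappa[OF u] by metis
      qed
      moreover have "inv w b i \<le> 0" for i using pos_nonneg[OF b(2), of i] by simp
      ultimately have "0 \<le> (- inv w (\<kappa> + \<alpha> p)) i" for i
        using kappa_nonneg[of i] q(1) mult_nonneg_nonneg[of "q - 1" "\<kappa> i"]
        by (smt (verit) plus_fun_apply smul_apply uminus_vec_apply)
      moreover have "root (- inv w (\<kappa> + \<alpha> p))" using wW root_kappa_plus(1) p_le by simp
      ultimately have "w \<in> Y" using wX by (auto simp: Y_def intro: pos_of_nonneg)
      then show False using w by simp
    qed
    then show "w \<in> W_ab t s" unfolding W_ab using wW by blast
  qed
qed

text \<open>The factor \<open>c\<close> serves the case in which only twice the vector is visibly a
  sum of positive terms.\<close>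

lemma Y_empty:
  assumes "\<And>x. x \<in> X \<Longrightarrow> \<exists>c>0. \<forall>i. 0 \<le> (c *\<^sub>s inv x (\<kappa> + \<alpha> p)) i"
  shows "Y = {}"
proof (rule ccontr)
  assume "Y \<noteq> {}"
  then obtain x where x: "x \<in> X" "pos (- inv x (\<kappa> + \<alpha> p))" by (auto simp: Y_def)
  obtain c where c: "c > 0" "\<forall>i. 0 \<le> (c *\<^sub>s inv x (\<kappa> + \<alpha> p)) i" using assms[OF x(1)] by blast
  then have "0 \<le> inv x (\<kappa> + \<alpha> p) i" for i by (auto simp: zero_le_mult_iff)
  then have "pos (inv x (\<kappa> + \<alpha> p))" using x(2) by (intro pos_of_nonneg) (auto simp: pos_def)
  then show False using x(2) not_pos_and_neg by blast
qed

text \<open>Here a_p = 1, so \<open>\<alpha> p + \<delta>\<close> is a root of height 2, which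
  \<open>X\<close> keeps positive; one more \<open>\<delta>\<close> gives
  \<open>\<kappa> + \<alpha> p\<close>.\<close>

lemma Y_empty_twisted:
  assumes "twist t = 2" "sq p = 1"
  shows "Y = {}"
proof (rule Y_empty)
  fix x assume x: "x \<in> X"
  then have u: "inv x \<in> W\<^sub>a" by (auto simp: X_def intro: weyl_inv)
  have "root_of_norm 1 (\<alpha> p + \<delta>)"
  proof -
    have "\<delta> i = 0" if "i > n" for i using that by (simp add: delta_def)
    then show ?thesis using root_of_norm_simple[OF p_le] assms(2) by (simp add: root_of_norm_def)
  qed
  then have "root (\<alpha> p + \<delta>)" by (auto simp: root_def)
  moreover have "(\<alpha> p + \<delta>) p = 2" using k_label assms(1) p_le by (simp add: delta_def)
  ultimately have pos: "pos (inv x (\<alpha> p + \<delta>))" by (rule X_pos[OF x])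
  have "\<kappa> + \<alpha> p = (\<alpha> p + \<delta>) + \<delta>" using assms(1) by (simp add: \<kappa>_def fun_eq_iff)
  then have "inv x (\<kappa> + \<alpha> p) = inv x (\<alpha> p + \<delta>) + \<delta>"
    by (simp only: weyl_add[OF u] weyl_delta[OF u order_refl])
  moreover have "0 \<le> \<delta> i" for i by (simp add: delta_def)
  ultimately have "0 \<le> inv x (\<kappa> + \<alpha> p) i" for i using pos_nonneg[OF pos, of i] by simp
  then show "\<exists>c>0. \<forall>i. 0 \<le> (c *\<^sub>s inv x (\<kappa> + \<alpha> p)) i" by (intro exI[of _ 1]) auto
qed

text \<open>If \<open>\<alpha> p\<close> were orthogonal to all such \<open>b\<close>, reflecting
  \<open>b\<close> in nodes other than p would spread this orthogonality along edges to every node.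
  But \<open>\<alpha> j\<close> is itself such a \<open>b\<close>. Replacing \<open>b\<close> by
  \<open>- b\<close> fixes the sign.\<close>

lemma long_root_not_orthogonal:
  assumes "j \<le> n" "sq j = m" "j \<noteq> p"
  shows "\<exists>b. root_of_norm m b \<and> b p = 0 \<and> pairing p b < 0"
proof -
  define Z where "Z = {i. i \<le> n \<and> (\<forall>b. root_of_norm m b \<and> b p = 0 \<longrightarrow> pairing i b = 0)}"
  have "p \<notin> Z"
  proof
    assume "p \<in> Z"
    have "Z = {..n}"
    proof (rule connected)
      fix i l assume il: "i \<in> Z" "l \<le> n" "A i l \<noteq> 0"
      show "l \<in> Z"
      proof (cases "l = p")
        case False
        have "pairing l b = 0" if b: "root_of_norm m b" "b p = 0" for b
        proof -
          have "root_of_norm m (refl_simple l b)" "refl_simple l b p = 0"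
            using root_of_norm_simple_reflection[OF il(2) b(1)] b(2) False
            by (auto simp: simple_reflection_eq simple_root_def)
          then have "pairing i (refl_simple l b) = 0" "pairing i b = 0" using il(1) b by (auto simp: Z_def)
          then show ?thesis using il(2,3) by (simp add: simple_reflection_eq pairing_simple)
        qed
        then show ?thesis using il(2) by (auto simp: Z_def)
      qed (use \<open>p \<in> Z\<close> in simp)
    qed (use \<open>p \<in> Z\<close> in \<open>auto simp: Z_def\<close>)
    then have "j \<in> Z" using assms(1) by simp
    moreover have "\<alpha> j p = 0" using assms(3) by (simp add: simple_root_def)
    ultimately have "pairing j (\<alpha> j) = 0"
      using root_of_norm_simple[OF assms(1)] assms(2) by (simp add: Z_def)
    then show False using assms(1) by (simp add: pairing_simple)
  qed
  then obtain b where b: "root_of_norm m b" "b p = 0" "pairing p b \<noteq> 0" using p_le by (auto simp: Z_def)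
  then show ?thesis
    by (cases "pairing p b < 0") (auto intro: exI[of _ b] exI[of _ "- b"])
qed

text \<open>For a long root \<open>b\<close> of height 0 with pairing -2, reflection in
  \<open>\<alpha> p\<close> gives the root \<open>b + 2 \<alpha> p\<close>. It and
  \<open>\<kappa> - b\<close> have height 2, and together with \<open>\<kappa>\<close> they add up
  to twice \<open>\<kappa> + \<alpha> p\<close>.\<close>

lemma Y_empty_untwisted:
  assumes "j \<le> n" "sq j = 2 * sq p"
  shows "Y = {}"
proof (rule Y_empty)
  fix x assume x: "x \<in> X"
  then have u: "inv x \<in> W\<^sub>a" by (auto simp: X_def intro: weyl_inv)
  have sqp: "sq p > 0" using sq_pos[OF p_le] .
  obtain b where b: "root_of_norm (2 * sq p) b" "b p = 0" "pairing p b < 0"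
    using long_root_not_orthogonal[OF assms] assms(2) sqp by (cases "j = p") auto
  then have "root b" by (auto simp: root_def)
  have Bb: "B (\<alpha> p) b = sq p * pairing p b" by (rule form_simple[OF p_le])
  have "sq p * pairing p b = sq p * (2 * coroot b (\<alpha> p))"
    using root_of_norm_coroot[OF b(1), of "\<alpha> p"] Bb by (simp only: mult_ac)
  then have even: "pairing p b = 2 * coroot b (\<alpha> p)" using sqp by simp
  have "B (b + \<alpha> p) (b + \<alpha> p) = 2 * sq p * (3 + pairing p b)"
    using b(1) Bb form_sym[of b "\<alpha> p"] p_le
    by (simp add: root_of_norm_def form_simple pairing_simple algebra_simps)
  then have "0 \<le> 3 + pairing p b"
    using form_nonneg[of "b + \<alpha> p"] sqp by (simp add: zero_le_mult_iff)
  \<comment> \<open>Semidefiniteness bounds the pairing below by -3, and the length ratio 2 makes it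
    even.\<close>
  then have two: "pairing p b = -2" using even b(3) by presburger
  have s: "refl_simple p \<in> W\<^sub>a" using p_le by (intro weyl_gen) auto
  have "root (refl_simple p b)" using s \<open>root b\<close> by simp
  moreover have refl: "refl_simple p b = b + 2 *\<^sub>s \<alpha> p" by (simp add: simple_reflection_eq two fun_eq_iff)
  ultimately have p1: "pos (inv x (b + 2 *\<^sub>s \<alpha> p))" using b(2) by (intro X_pos[OF x]) simp_all
  have p2: "pos (inv x (\<kappa> - b))"
    using root_kappa_plus(2)[OF \<open>root b\<close>] b(2) kappa_p by (intro X_pos[OF x]) simp_all
  have "2 *\<^sub>s (\<kappa> + \<alpha> p) = (b + 2 *\<^sub>s \<alpha> p) + (\<kappa> - b) + \<kappa>" by (simp add: fun_eq_iff)
  then have "2 *\<^sub>s inv x (\<kappa> + \<alpha> p) = inv x (b + 2 *\<^sub>s \<alpha> p) + inv x (\<kappa> - b) + \<kappa>"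
    by (metis weyl_add[OF u] weyl_smul[OF u] weyl_kappa[OF u])
  then have "0 \<le> (2 *\<^sub>s inv x (\<kappa> + \<alpha> p)) i" for i
    using pos_nonneg[OF p1, of i] pos_nonneg[OF p2, of i] kappa_nonneg[of i] by simp
  then show "\<exists>c>0. \<forall>i. 0 \<le> (c *\<^sub>s inv x (\<kappa> + \<alpha> p)) i" by (intro exI[of _ 2]) auto
qed

end

section \<open>A long marked node: the single excluded element\<close>

locale long_node = graded_diagram +
  assumes long: "i \<le> affine_rank t \<Longrightarrow> sqlen t i \<le> sqlen t p"
    and no_half_delta: "\<not> int (label t p) * sqlen t p dvd int (label t 0) * sqlen t 0"
begin

text \<open>Since \<open>\<alpha> p\<close> is longest, semidefiniteness on
  \<open>b - \<alpha> p\<close> and \<open>b + \<alpha> p\<close> bounds the pairing; at the extreme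
  value 2 the difference is null.\<close>

lemma pairing_p_bounds:
  assumes "root b"
  shows "pairing p b \<le> 2" "-2 \<le> pairing p b"
    and "pairing p b = 2 \<Longrightarrow> root_of_norm (sq p) b \<and> B (b - \<alpha> p) (b - \<alpha> p) = 0"
proof -
  obtain m where m: "root_of_norm m b" using assms by (auto simp: root_def)
  have le: "m \<le> sq p" using root_norm_bound[OF m] long by auto
  have sqp: "sq p > 0" using sq_pos[OF p_le] .
  have e: "B (b - \<alpha> p) (b - \<alpha> p) = 2 * m + 2 * (sq p * (1 - pairing p b))"
    "B (b + \<alpha> p) (b + \<alpha> p) = 2 * m + 2 * (sq p * (1 + pairing p b))"
    using m form_sym[of b "\<alpha> p"] p_le
    by (simp_all add: root_of_norm_def form_simple pairing_simple algebra_simps)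
  show "pairing p b \<le> 2"
  proof (rule ccontr)
    assume "\<not> ?thesis"
    then have "sq p * (1 - pairing p b) \<le> sq p * (- 2)" using sqp by (intro mult_left_mono) auto
    then show False using e(1) form_nonneg[of "b - \<alpha> p"] le sqp by linarith
  qed
  show "-2 \<le> pairing p b"
  proof (rule ccontr)
    assume "\<not> ?thesis"
    then have "sq p * (1 + pairing p b) \<le> sq p * (- 2)" using sqp by (intro mult_left_mono) auto
    then show False using e(2) form_nonneg[of "b + \<alpha> p"] le sqp by linarith
  qed
  show "root_of_norm (sq p) b \<and> B (b - \<alpha> p) (b - \<alpha> p) = 0" if "pairing p b = 2"
  proof -
    have "B (b - \<alpha> p) (b - \<alpha> p) = 2 * m - 2 * sq p" using e(1) that by simp
    then have "m = sq p" "B (b - \<alpha> p) (b - \<alpha> p) = 0" using form_nonneg[of "b - \<alpha> p"] le by auto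
    then show ?thesis using m by simp
  qed
qed

text \<open>With pairing 2, \<open>b - \<alpha> p\<close> would be null with p-th coordinate -1, so
  \<open>b\<close> would be \<open>\<alpha> p\<close> minus \<open>\<delta>\<close> divided by a_p.
  Divisibility at node 0 then contradicts \<open>no_half_delta\<close>, which is made to exclude
  this root.\<close>

lemma grade_zero_pairing_le:
  assumes "root b" "b p = 0"
  shows "pairing p b \<le> 1"
proof (rule ccontr)
  assume "\<not> ?thesis"
  then have "pairing p b = 2" using pairing_p_bounds(1)[OF assms(1)] by simp
  then have b: "root_of_norm (sq p) b" "B (b - \<alpha> p) (b - \<alpha> p) = 0"
    using pairing_p_bounds(3)[OF assms(1)] by auto
  have "p \<noteq> 0" using no_half_delta by (cases "p = 0") auto
  have "(b - \<alpha> p) 0 * a p = (b - \<alpha> p) p * a 0" by (rule form_null[OF b(2)]) (use p_le in auto)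
  then have "a 0 = - (b 0 * a p)" using assms(2) \<open>p \<noteq> 0\<close> by (simp add: simple_root_def)
  moreover have "sq p dvd sq 0 * b 0" using b(1) by (simp add: root_of_norm_def)
  then have "a p * sq p dvd a p * (sq 0 * b 0)" by (intro mult_dvd_mono) auto
  ultimately have "a p * sq p dvd a 0 * sq 0" by (simp add: mult_ac)
  then show False using no_half_delta by blast
qed

lemma grade_zero_pairing:
  assumes "root b" "b p = 0"
  shows "pairing p b \<in> {-1, 0, 1}"
proof -
  have "pairing p b \<le> 1" "- pairing p b \<le> 1"
    using grade_zero_pairing_le[OF assms] grade_zero_pairing_le[of "- b"] assms by auto
  then show ?thesis by auto
qed

lemma grade_zero_pairing_nonpos:
  assumes "pos b" "b p = 0"
  shows "pairing p b \<in> {-1, 0}"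
proof -
  have "pairing p b \<le> 0"
    unfolding pairing_def
  proof (rule sum_nonpos)
    fix i assume i: "i \<in> {..n}"
    show "A p i * b i \<le> 0"
      using cartan_nonpos[OF p_le, of i] i assms pos_nonneg[OF assms(1), of i]
      by (cases "i = p") (auto simp: mult_le_0_iff)
  qed
  then show ?thesis using grade_zero_pairing[OF pos_root[OF assms(1)] assms(2)] by auto
qed

text \<open>A root of height 1 whose pairing with \<open>\<alpha>\<^sub>p\<^sup>\<or>\<close> is \<open>j\<close> differs from \<open>\<alpha>\<^sub>p\<close> by exactly \<open>2 - j\<close> roots of
  height 0. Together with the same statement for \<open>\<kappa> - b\<close> this bounds the value of \<open>b\<close> on an alcove in
  \<open>Y\<close> from both sides.\<close>
lemma height_one_decompose:
  assumes "root b" "b p = 1"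
  shows "\<exists>vs. int (length vs) = 2 - pairing p b \<and> (\<forall>v\<in>set vs. root v \<and> v p = 0) \<and> b = \<alpha> p + sum_list vs"
  using assms
proof (induction "\<Sum>i\<le>n. nat (b i)" arbitrary: b rule: less_induct)
  case less
  note b = less.prems
  have bpos: "pos b" using posI[OF b(1), of p] b(2) by simp
  define v where "v = b - \<alpha> p"
  have bv: "b = \<alpha> p + v" by (simp add: v_def)
  have v: "v p = 0" "\<And>i. 0 \<le> v i" "\<And>i. i > n \<Longrightarrow> v i = 0"
    using b pos_nonneg[OF bpos] root_beyond[OF b(1)] p_le by (auto simp: v_def simple_root_def)
  consider "pairing p b = 2" | "pairing p b = 1" | "pairing p b \<le> 0"
    using pairing_p_bounds(1)[OF b(1)] by linarith
  then show ?case
  proof cases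
    case 1
    then have "B v v = 0" using pairing_p_bounds(3)[OF b(1)] by (simp add: v_def)
    then have "v = 0" using form_null_zero[of v p] p_le v by simp
    then show ?thesis using bv 1 by (intro exI[of _ "[]"]) simp
  next
    case 2
    have "refl_simple p b = v" by (simp add: simple_reflection_eq 2 v_def)
    then have "root v" using root_weyl[OF weyl_gen[of p "{..n}"] order_refl b(1)] p_le by simp
    then show ?thesis using bv 2 v(1) by (intro exI[of _ "[v]"]) simp
  next
    case 3
    obtain m where m: "root_of_norm m b" using b(1) by (auto simp: root_def)
    have "B v b = 2 * m - sq p * pairing p b"
      using m p_le by (simp add: v_def form_simple root_of_norm_def)
    moreover have "0 \<le> sq p * - pairing p b" using 3 sq_pos[OF p_le] by (intro mult_nonneg_nonneg) auto
    ultimately have "0 < B v b" using m by (simp add: root_of_norm_def)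
    \<comment> \<open>As \<open>v\<close> vanishes at \<open>p\<close>, positivity of
      \<open>B v b\<close> yields a node other than \<open>p\<close> whose reflection lowers
      \<open>b\<close> and preserves height 1.\<close>
    have "\<exists>i\<le>n. 0 < sq i * v i * pairing i b"
    proof (rule ccontr)
      assume "\<not> ?thesis"
      then have "B v b \<le> 0" unfolding form_eq by (intro sum_nonpos) (auto simp: not_less)
      then show False using \<open>0 < B v b\<close> by simp
    qed
    then obtain i where i: "i \<le> n" "0 < sq i * v i * pairing i b" by blast
    have vi: "v i > 0" "pairing i b > 0"
      using i(2) sq_pos[OF i(1)] v(2)[of i] by (auto simp: zero_less_mult_iff mult_less_0_iff)
    have ip: "i \<noteq> p" using vi v(1) by auto
    define g where "g = refl_simple i b"
    define M where "M = pairing i b"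
    have s: "refl_simple i \<in> W\<^sub>a" using i(1) by (intro weyl_gen) auto
    have g_eq: "g = b - M *\<^sub>s \<alpha> i" by (simp add: g_def M_def simple_reflection_eq)
    have g: "root g" "g p = 1" using b s ip by (simp add: g_def) (use b ip in \<open>simp add: g_eq simple_root_def\<close>)
    have gpos: "pos g" using posI[OF g(1), of p] g(2) by simp
    have "(\<Sum>j\<le>n. nat (g j)) < (\<Sum>j\<le>n. nat (b j))"
    proof (rule sum_strict_mono_ex1)
      show "\<forall>j\<in>{..n}. nat (g j) \<le> nat (b j)" using vi(2) by (auto simp: g_eq M_def simple_root_def)
      have "nat (g i) < nat (b i)" using vi pos_nonneg[OF gpos, of i] ip
        by (simp add: g_eq M_def simple_root_def v_def)
      then show "\<exists>j\<in>{..n}. nat (g j) < nat (b j)" using i(1) by auto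
    qed simp
    then obtain vs where vs: "int (length vs) = 2 - pairing p g" "\<forall>v\<in>set vs. root v \<and> v p = 0"
        "g = \<alpha> p + sum_list vs"
      using less.hyps[OF _ g] by blast
    have pg: "pairing p g = pairing p b - M * A p i" by (simp add: g_eq pairing_simple[OF i(1)])
    have \<alpha>i: "root (\<alpha> i)" "\<alpha> i p = 0" using i(1) ip by simp (use ip in \<open>simp add: simple_root_def\<close>)
    have "pairing p (\<alpha> i) \<in> {-1, 0}"
      by (rule grade_zero_pairing_nonpos[OF pos_simple[OF i(1)] \<alpha>i(2)])
    then consider "A p i = 0" | "A p i = -1" by (auto simp: pairing_simple[OF i(1)])
    then show ?thesis
    proof cases
      case 1
      \<comment> \<open>The reflection fixes \<open>\<alpha> p\<close>, so it carries the
        decomposition of \<open>g\<close> to one of \<open>b\<close> with equally many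
        summands.\<close>
      have "A i p = 0" using cartan_sym[OF p_le i(1)] 1 sq_pos[OF i(1)] by simp
      then have "refl_simple i (\<alpha> p) = \<alpha> p" by (simp add: simple_reflection_eq pairing_simple[OF p_le])
      moreover have "b = refl_simple i g"
        using fun_cong[OF simple_reflection_invol[OF i(1)], of b] by (simp add: g_def)
      ultimately have "b = \<alpha> p + sum_list (map (refl_simple i) vs)"
        by (simp only: vs(3) weyl_add[OF s] weyl_sum_list[OF s])
      moreover have "\<forall>v\<in>set (map (refl_simple i) vs). root v \<and> v p = 0"
      proof
        fix v assume "v \<in> set (map (refl_simple i) vs)"
        then obtain z where z: "root z" "z p = 0" "v = refl_simple i z" using vs(2) by auto
        have "v p = 0" using z(2,3) ip by (simp add: simple_reflection_eq simple_root_def)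
        then show "root v \<and> v p = 0" using z s by simp
      qed
      ultimately show ?thesis using vs(1) pg 1 by (intro exI[of _ "map (refl_simple i) vs"]) auto
    next
      case 2
      \<comment> \<open>From \<open>g\<close> to \<open>b\<close> the pairing drops by
        \<open>M\<close>, which the \<open>M\<close> new summands \<open>\<alpha> i\<close> account
        for.\<close>
      define us where "us = replicate (nat M) (\<alpha> i) @ vs"
      have sum_rep: "sum_list (replicate l (\<alpha> i)) = int l *\<^sub>s \<alpha> i" for l
        by (induction l) (simp_all add: fun_eq_iff algebra_simps)
      have M: "M > 0" using vi(2) by (simp add: M_def)
      have "b = g + M *\<^sub>s \<alpha> i" by (simp add: g_eq)
      also have "\<dots> = \<alpha> p + sum_list us"
        using M by (simp add: us_def sum_rep vs(3) algebra_simps)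
      finally have "b = \<alpha> p + sum_list us" .
      moreover have "int (length us) = 2 - pairing p b" using vs(1) pg 2 M by (simp add: us_def)
      moreover have "\<forall>v\<in>set us. root v \<and> v p = 0" using vs(2) \<alpha>i by (auto simp: us_def)
      ultimately show ?thesis by blast
    qed
  qed
qed

lemma sum_list_kappa_minus: "sum_list (map (\<lambda>v. \<kappa> - v) vs) = int (length vs) *\<^sub>s \<kappa> - sum_list vs"
  by (induction vs) (simp_all add: fun_eq_iff algebra_simps)

lemma sum_list_nonneg_vec: "(\<And>v. v \<in> set vs \<Longrightarrow> 0 \<le> v i) \<Longrightarrow> 0 \<le> (sum_list vs :: root_vec) i"
  by (induction vs) auto

text \<open>Every summand \<open>v\<close> of height 0 is rewritten through
  \<open>\<kappa> - v\<close>, a root of height 2 and so positive after \<open>inv x\<close>. The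
  first claim decomposes \<open>\<kappa> - b\<close>, whose pairing is the negative, the second
  \<open>b\<close>; counting copies of \<open>\<kappa>\<close> gives the same threshold from both
  sides.\<close>

lemma Y_signs:
  assumes x: "x \<in> Y" and b: "root b" "b p = 1"
  shows "q \<ge> pairing p b \<Longrightarrow> pos (inv x (b + q *\<^sub>s \<kappa>))"
    and "q < pairing p b \<Longrightarrow> pos (- inv x (b + q *\<^sub>s \<kappa>))"
proof -
  have xX: "x \<in> X" and xW: "x \<in> W\<^sub>a" and neg: "pos (- inv x (\<kappa> + \<alpha> p))" using x by (auto simp: Y_def X_def)
  have u: "inv x \<in> W\<^sub>a" by (rule weyl_inv[OF xW order_refl])
  have nonneg: "0 \<le> inv x (sum_list (map (\<lambda>v. \<kappa> - v) vs)) i" if "\<forall>v\<in>set vs. root v \<and> v p = 0" for vs i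
    unfolding weyl_sum_list[OF u]
  proof (rule sum_list_nonneg_vec)
    fix z assume "z \<in> set (map (inv x) (map (\<lambda>v. \<kappa> - v) vs))"
    then obtain v where v: "v \<in> set vs" "z = inv x (\<kappa> - v)" by auto
    have "pos z" unfolding v(2) using root_kappa_plus(2) that v(1) kappa_p by (intro X_pos[OF xX]) auto
    then show "0 \<le> z i" by (rule pos_nonneg)
  qed
  have root_u: "root (inv x (b + q *\<^sub>s \<kappa>))" using root_shift[OF b(1)] xW by simp
  {
    assume q: "q \<ge> pairing p b"
    have kb: "root (\<kappa> - b)" "(\<kappa> - b) p = 1" using root_kappa_plus(2)[OF b(1)] b(2) kappa_p by auto
    have "pairing p \<kappa> = 0" by (simp add: \<kappa>_def p_le)
    then obtain vs where vs: "int (length vs) = 2 + pairing p b" "\<forall>v\<in>set vs. root v \<and> v p = 0"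
        "\<kappa> - b = \<alpha> p + sum_list vs"
      using height_one_decompose[OF kb] unfolding pairing_diff by (metis diff_0 diff_minus_eq_add)
    have "b = \<kappa> - \<alpha> p - sum_list vs" using vs(3) by (simp add: algebra_simps)
    then have "b + q *\<^sub>s \<kappa> = sum_list (map (\<lambda>v. \<kappa> - v) vs) - (\<kappa> + \<alpha> p) + (q - pairing p b) *\<^sub>s \<kappa>"
      unfolding sum_list_kappa_minus vs(1) by (simp add: fun_eq_iff algebra_simps)
    then have e: "inv x (b + q *\<^sub>s \<kappa>) =
        inv x (sum_list (map (\<lambda>v. \<kappa> - v) vs)) - inv x (\<kappa> + \<alpha> p) + (q - pairing p b) *\<^sub>s \<kappa>"
      by (simp only: weyl_add[OF u] weyl_diff[OF u] weyl_smul[OF u] weyl_kappa[OF u])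
    have "0 \<le> inv x (b + q *\<^sub>s \<kappa>) i" for i
      using nonneg[OF vs(2), of i] pos_nonneg[OF neg, of i] mult_nonneg_nonneg[of "q - pairing p b" "\<kappa> i"]
        q kappa_nonneg[of i] unfolding e by simp
    then show "pos (inv x (b + q *\<^sub>s \<kappa>))" by (rule pos_of_nonneg[OF root_u])
  next
    assume q: "q < pairing p b"
    obtain vs where vs: "int (length vs) = 2 - pairing p b" "\<forall>v\<in>set vs. root v \<and> v p = 0"
        "b = \<alpha> p + sum_list vs"
      using height_one_decompose[OF b] by blast
    have "b + q *\<^sub>s \<kappa> = (\<kappa> + \<alpha> p) - sum_list (map (\<lambda>v. \<kappa> - v) vs) - (pairing p b - 1 - q) *\<^sub>s \<kappa>"
      unfolding sum_list_kappa_minus vs(1) by (subst vs(3)) (simp add: fun_eq_iff algebra_simps)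
    then have e: "inv x (b + q *\<^sub>s \<kappa>) =
        inv x (\<kappa> + \<alpha> p) - inv x (sum_list (map (\<lambda>v. \<kappa> - v) vs)) - (pairing p b - 1 - q) *\<^sub>s \<kappa>"
      by (simp only: weyl_add[OF u] weyl_diff[OF u] weyl_smul[OF u] weyl_kappa[OF u])
    have "0 \<le> (- inv x (b + q *\<^sub>s \<kappa>)) i" for i
    proof -
      have "0 \<le> (pairing p b - 1 - q) * \<kappa> i"
        using q by (intro mult_nonneg_nonneg kappa_nonneg) simp
      then show ?thesis
        using nonneg[OF vs(2), of i] pos_nonneg[OF neg, of i] unfolding e by simp
    qed
    then show "pos (- inv x (b + q *\<^sub>s \<kappa>))" using root_u by (intro pos_of_nonneg) auto
  }
qed

lemma Y_unique:
  assumes "x \<in> Y" "y \<in> Y"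
  shows "x = y"
proof (rule weyl_eq_of_signs)
  show "x \<in> W\<^sub>a" "y \<in> W\<^sub>a" using assms by (auto simp: Y_def X_def)
next
  fix b assume b: "pos b"
  show "pos (inv x b) \<longleftrightarrow> pos (inv y b)"
  proof (cases "even (b p)")
    case True
    then show ?thesis using assms b by (auto simp: Y_def X_def)
  next
    case False
    define q where "q = b p div 2"
    define g where "g = b + (- q) *\<^sub>s \<kappa>"
    have g: "root g" "g p = 1"
      using root_shift[OF pos_root[OF b], of "- q"] False kappa_p by (auto simp: g_def q_def elim!: oddE)
    have "b = g + q *\<^sub>s \<kappa>" by (simp add: g_def fun_eq_iff)
    then show ?thesis
      using Y_signs[OF assms(1) g, of q] Y_signs[OF assms(2) g, of q] not_pos_and_neg
      by (metis linorder_not_less)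
  qed
qed

text \<open>A functional that is positive on the even positive roots and negative on \<open>\<kappa> + \<alpha>\<^sub>p\<close>: a perturbation of
  \<open>v p - 2 \<langle>v, \<alpha>\<^sub>p\<^sup>\<or>\<rangle>\<close>, which has these properties in the weak sense.\<close>
lemma Y_nonempty: "Y \<noteq> {}"
proof -
  define N where "N = (\<Sum>i\<le>n. 2 * sq i)"
  define V where "V = {v. root v \<and> v p \<in> {0, 1}}"
  have "V \<subseteq> {v. (\<forall>i>n. v i = 0) \<and> \<bar>v p\<bar> \<le> 1 \<and> B v v \<le> N}"
  proof
    fix v assume "v \<in> V"
    then obtain m where m: "root_of_norm m v" and v: "v p \<in> {0, 1}" by (auto simp: V_def root_def)
    obtain i where i: "i \<le> n" "sq i = m" using root_norm_bound[OF m] by blast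
    have "2 * sq i \<le> N"
      unfolding N_def using i(1) sq_pos by (intro member_le_sum) (auto simp: less_imp_le)
    then show "v \<in> {v. (\<forall>i>n. v i = 0) \<and> \<bar>v p\<bar> \<le> 1 \<and> B v v \<le> N}"
      using m v i(2) by (auto simp: root_of_norm_def)
  qed
  then have finV: "finite V" by (rule finite_subset) (rule bounded_vectors_finite[OF p_le])
  define S where "S v = (\<Sum>i\<in>J\<^sub>0. v i)" for v :: root_vec
  \<comment> \<open>\<open>M\<close> exceeds \<open>S\<close> on all roots of height 0. Its term in
    \<open>f\<close> keeps \<open>f (\<kappa> - b)\<close> positive when \<open>pairing p b\<close>
    is -1, where the leading term vanishes.\<close>
  define M where "M = 1 + (\<Sum>v\<in>V. \<bar>S v\<bar>)"
  have SM: "S v < M" if "v \<in> V" for v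
    using member_le_sum[of v V "\<lambda>v. \<bar>S v\<bar>"] that finV by (auto simp: M_def)
  have M0: "M > 0" using sum_nonneg[of V "\<lambda>v. \<bar>S v\<bar>"] unfolding M_def by linarith
  \<comment> \<open>Makes \<open>f (\<kappa> + \<alpha> p)\<close> equal to -1: the leading term
    contributes -C, the perturbation \<open>S \<kappa> + 2 * M\<close>.\<close>
  define C where "C = S \<kappa> + 2 * M + 1"
  have S\<kappa>: "S \<kappa> \<ge> 0" unfolding S_def by (intro sum_nonneg kappa_nonneg)
  define f where "f v = C * (v p - 2 * pairing p v) + S v + M * pairing p v" for v
  have S_simps: "S (u - v) = S u - S v" "S (c *\<^sub>s v) = c * S v" "S (u + v) = S u + S v" for c u v
    by (simp_all add: S_def sum_subtractf sum_distrib_left sum.distrib)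
  have f_diff: "f (u - v) = f u - f v" for u v by (simp add: f_def S_simps algebra_simps)
  have f_smul: "f (c *\<^sub>s v) = c * f v" for c v by (simp add: f_def S_simps algebra_simps)
  have f_add: "f (u + v) = f u + f v" for u v by (simp add: f_def S_simps algebra_simps)
  have f_neg: "f (- v) = - f v" for v using f_smul[of "- 1" v] by simp
  have "pairing p \<kappa> = 0" by (simp add: \<kappa>_def p_le)
  then have f\<kappa>: "f \<kappa> = 2 * C + S \<kappa>" by (simp add: f_def kappa_p)
  then have f\<kappa>_pos: "f \<kappa> > 0" using S\<kappa> M0 by (simp add: C_def)
  have "pairing p (\<alpha> p) = 2" "S (\<alpha> p) = 0" by (simp_all add: pairing_simple[OF p_le]) (simp add: S_def simple_root_def)
  then have f\<alpha>: "f (\<kappa> + \<alpha> p) < 0" by (simp add: f_add f\<kappa>) (simp add: f_def C_def)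
  have f0: "f b > 0 \<and> f (\<kappa> - b) > 0" if b: "pos b" "b p = 0" for b
  proof -
    have "b \<in> V" using b pos_root by (auto simp: V_def)
    have Sb: "S b \<ge> 0" unfolding S_def using pos_nonneg[OF b(1)] by (intro sum_nonneg)
    have "S b \<noteq> 0"
    proof
      assume "S b = 0"
      then have "\<forall>i\<in>J\<^sub>0. b i = 0" using pos_nonneg[OF b(1)] by (simp add: S_def sum_nonneg_eq_0_iff)
      then have "b i = 0" for i using grade_zero_support[OF pos_root[OF b(1)] b(2)] by blast
      then have "b = 0" by (auto simp: fun_eq_iff)
      then show False using root_nonzero[OF pos_root[OF b(1)]] by simp
    qed
    moreover have "pairing p b \<in> {-1, 0}" by (rule grade_zero_pairing_nonpos[OF b])
    ultimately show ?thesis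
      using b(2) Sb SM[OF \<open>b \<in> V\<close>] S\<kappa> M0 unfolding f_diff f\<kappa> by (auto simp: f_def C_def)
  qed
  have f_even: "f b > 0" if b: "pos b" "even (b p)" for b
  proof -
    obtain g where g: "root g" "g p = 0" "b = g + (b p div 2) *\<^sub>s \<kappa>"
      using even_root_reduce[OF pos_root[OF b(1)] b(2)] by blast
    define q where "q = b p div 2"
    have bq: "b = g + q *\<^sub>s \<kappa>" using g(3) q_def by simp
    have q: "q \<ge> 0" using pos_nonneg[OF b(1), of p] by (simp add: q_def)
    show ?thesis
    proof (cases "q = 0")
      case True
      then have "b = g" using bq by simp
      then show ?thesis using f0 b(1) g(2) by simp
    next
      case False
      have "f (\<kappa> + g) > 0"
        using pos_or_neg[OF g(1)] f0[of g] f0[of "- g"] g(2) f\<kappa>_pos by (auto simp: f_add f_diff f_neg)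
      moreover have "f b = f (\<kappa> + g) + (q - 1) * f \<kappa>" by (simp add: bq f_add f_smul algebra_simps)
      moreover have "(q - 1) * f \<kappa> \<ge> 0" using q False f\<kappa>_pos by (intro mult_nonneg_nonneg) auto
      ultimately show ?thesis by linarith
    qed
  qed
  \<comment> \<open>Each root in \<open>V\<close> has only finitely many shifts by nonnegative
    multiples of \<open>\<kappa>\<close> with negative value, because \<open>f \<kappa>\<close> is
    at least 1.\<close>
  have "{b. pos b \<and> f b < 0} \<subseteq> (\<lambda>(g, q). g + q *\<^sub>s \<kappa>) ` (SIGMA g:V. {0..\<bar>f g\<bar>})"
  proof
    fix b assume "b \<in> {b. pos b \<and> f b < 0}"
    then have b: "pos b" "f b < 0" by auto
    define q where "q = b p div 2"
    define g where "g = b + (- q) *\<^sub>s \<kappa>"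
    have bq: "b = g + q *\<^sub>s \<kappa>" by (simp add: g_def fun_eq_iff)
    have "g p = b p mod 2" by (simp add: g_def q_def kappa_p minus_div_mult_eq_mod[symmetric])
    then have gV: "g \<in> V" using root_shift[OF pos_root[OF b(1)], of "- q"] by (auto simp: V_def g_def[symmetric])
    have q: "q \<ge> 0" using pos_nonneg[OF b(1), of p] by (simp add: q_def)
    have "f g + q * f \<kappa> < 0" using b(2) by (simp add: bq f_add f_smul)
    moreover have "q * 1 \<le> q * f \<kappa>" using q f\<kappa>_pos by (intro mult_left_mono) auto
    ultimately have "q \<le> \<bar>f g\<bar>" by linarith
    then show "b \<in> (\<lambda>(g, q). g + q *\<^sub>s \<kappa>) ` (SIGMA g:V. {0..\<bar>f g\<bar>})"
      using gV q bq by (intro image_eqI[of _ _ "(g, q)"]) auto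
  qed
  then have "finite {b. pos b \<and> f b < 0}"
    by (rule finite_subset) (intro finite_imageI finite_SigmaI finV; simp)
  then obtain w where w: "w \<in> W\<^sub>a" "\<And>i. i \<le> n \<Longrightarrow> 0 \<le> f (w (\<alpha> i))"
    using dominant_conjugate[OF f_diff f_smul] by blast
  have u: "inv w \<in> W\<^sub>a" by (rule weyl_inv[OF w(1) order_refl])
  \<comment> \<open>Weak dominance is enough, since \<open>f\<close> is strictly positive on
    positive roots of even height and strictly negative on
    \<open>\<kappa> + \<alpha> p\<close>.\<close>
  have dominant: "0 \<le> f v" if "pos (inv w v)" for v
  proof -
    have "w (inv w v) = (\<lambda>j. \<Sum>i\<le>n. inv w v i * w (\<alpha> i) j)"
      by (rule weyl_expand[OF w(1)]) (rule root_beyond[OF pos_root[OF that]])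
    then have "f v = (\<Sum>i\<le>n. inv w v i * f (w (\<alpha> i)))"
      using linear_sum[OF f_diff f_smul, of "{..n}" "inv w v" "\<lambda>i. w (\<alpha> i)"]
      by (simp add: weyl_inv_apply(2)[OF w(1) order_refl])
    then show ?thesis using w(2) pos_nonneg[OF that] by (auto intro!: sum_nonneg mult_nonneg_nonneg)
  qed
  have "pos (inv w b)" if "pos b" "even (b p)" for b
  proof (rule ccontr)
    assume "\<not> ?thesis"
    then have "pos (- inv w b)" using not_pos_iff w(1) pos_root[OF that(1)] by simp
    then have "0 \<le> f (- b)" using dominant[of "- b"] weyl_uminus[OF u] by simp
    then show False using f_even[OF that] f_neg by simp
  qed
  moreover have "pos (- inv w (\<kappa> + \<alpha> p))"
    using not_pos_iff[of "inv w (\<kappa> + \<alpha> p)"] w(1) root_kappa_plus(1)[OF root_simple[OF p_le]]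
      dominant[of "\<kappa> + \<alpha> p"] f\<alpha> by auto
  ultimately have "w \<in> Y" using w(1) by (auto simp: Y_def X_def)
  then show ?thesis by blast
qed

lemma card_Y: "card Y = 1"
proof -
  obtain y where "y \<in> Y" using Y_nonempty by blast
  then have "Y = {y}" using Y_unique by blast
  then show ?thesis by simp
qed

end

section \<open>Long simple roots and the count in terms of the residues\<close>

context affine_diagram
begin

lemma long_root_simple:
  assumes "i \<le> n"
  shows "long_root t (\<alpha> i) \<longleftrightarrow> (\<forall>j\<le>n. sq j \<le> sq i)"
proof -
  have norm: "B (\<alpha> l) (\<alpha> l) = 2 * sq l" if "l \<le> n" for l
    using root_of_norm_simple[OF that] by (simp add: root_of_norm_def)
  show ?thesis
  proof
    assume "long_root t (\<alpha> i)"
    then have "B (\<alpha> j) (\<alpha> j) \<le> B (\<alpha> i) (\<alpha> i)" if "j \<le> n" for j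
      using that by (simp add: long_root_def real_roots_eq)
    then show "\<forall>j\<le>n. sq j \<le> sq i" using norm assms by auto
  next
    assume le: "\<forall>j\<le>n. sq j \<le> sq i"
    have "B b b \<le> B (\<alpha> i) (\<alpha> i)" if b: "root b" for b
    proof -
      obtain m where m: "root_of_norm m b" using b by (auto simp: root_def)
      then show ?thesis using root_norm_bound[OF m] le norm[OF assms] by (auto simp: root_of_norm_def)
    qed
    then show "long_root t (\<alpha> i)" using assms by (simp add: long_root_def real_roots_eq)
  qed
qed

lemma num_long_simple_eq: "num_long_simple t = card {i \<in> {1..n}. \<forall>j\<le>n. sq j \<le> sq i}"
proof -
  have "{v \<in> Pi_f t. long_root t v} = \<alpha> ` {i \<in> {1..n}. \<forall>j\<le>n. sq j \<le> sq i}"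
    using long_root_simple by (auto simp: Pi_f_def)
  moreover have "inj \<alpha>"
    by (rule injI) (metis simple_root_def zero_neq_one)
  ultimately show ?thesis
    by (simp add: num_long_simple_def card_image inj_on_subset)
qed

end

context graded_diagram
begin

lemma card_residues_eq: "real (card residues) = (\<Prod>i\<in>{1..n}. real_of_int (k div r i)) * real_of_int (colabel_ratio p)"
proof -
  have f: "real (nat (modulus i div r i)) = real_of_int (k div r i) * (if i = p then real_of_int (colabel_ratio p) else 1)"
    if "i \<in> {1..n}" for i
  proof -
    have "modulus i div r i = k div r i * (if i = p then colabel_ratio p else 1)"
    proof -
      have "r i dvd k" by (rule r_dvd_twist[OF that])
      then obtain x where "k = r i * x" by (elim dvdE)
      then show ?thesis using r_pos[OF that] by (cases "i = p") (auto simp: modulus_def)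
    qed
    moreover have "0 \<le> modulus i div r i"
      using modulus_pos[of i] r_pos[OF that] by (simp add: pos_imp_zdiv_nonneg_iff less_imp_le)
    ultimately show ?thesis by simp
  qed
  \<comment> \<open>For \<open>p = 0\<close> the factor is absent from the product, in agreement
    with \<open>colabel_ratio\<close> being 1 at node 0.\<close>
  have "(\<Prod>i\<in>{1..n}. if i = p then real_of_int (colabel_ratio p) else 1) = real_of_int (colabel_ratio p)"
    using p_le colabel_ratio_0 by (cases "p = 0") simp_all
  then show ?thesis
    unfolding card_residues of_nat_prod by (simp add: f prod.distrib)
qed

lemma card_W_ab:
  assumes s: "\<And>i. i \<le> n \<Longrightarrow> s i = (if i = p then 1 else 0)" and "finite Y"
  shows "real (card (W_ab t s)) =
    real (card residues) * (real (card (W_f t)) / real (card (W_sigma t s))) - real (card Y)"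
proof -
  have Wf: "W_f t = W {1..n}" by (simp add: W_f_def)
  have "{i. i \<le> n \<and> s i = 0} = J\<^sub>0" using s by auto
  then have W\<sigma>: "W_sigma t s = W J\<^sub>0" by (simp add: W_sigma_def)
  have fin: "finite (W {1..n})" "finite (W J\<^sub>0)"
    by (rule weyl_subgroup_finite[of _ 0]; auto) (rule weyl_subgroup_finite[of _ p]; use p_le in auto)
  have nonempty: "card (W {1..n}) > 0" "card (W J\<^sub>0) > 0"
    using fin weyl_id by (auto simp: card_gt_0_iff)
  have "card residues > 0"
    unfolding card_residues
  proof (rule prod_pos)
    fix i assume i: "i \<in> {1..n}"
    have "0 < modulus i div r i"
      using modulus_pos[of i] r_pos[OF i] r_dvd_modulus[OF i] by (simp add: pos_imp_zdiv_pos_iff zdvd_imp_le)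
    then show "0 < nat (modulus i div r i)" by simp
  qed
  \<comment> \<open>Positivity also supplies the finiteness of \<open>X\<close> that the cardinality
    of the difference needs.\<close>
  then have "card X > 0" using card_X nonempty by (metis mult_is_0 neq0_conv)
  moreover have "Y \<subseteq> X" by (auto simp: Y_def)
  ultimately have "real (card (X - Y)) = real (card X) - real (card Y)"
    using \<open>finite Y\<close> card_mono[of X Y] by (simp add: card_Diff_subset card_gt_0_iff)
  moreover have "real (card X) = real (card residues) * real (card (W {1..n})) / real (card (W J\<^sub>0))"
    using arg_cong[OF card_X, of real] nonempty by (simp add: field_simps)
  ultimately show ?thesis by (simp add: W_ab_eq[OF s] Wf W\<sigma>)
qed

lemma card_Y_long:
  assumes "\<And>i. i \<le> n \<Longrightarrow> sq i \<le> sq p" "\<not> a p * sq p dvd a 0 * sq 0"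
  shows "finite Y \<and> card Y = 1"
proof -
  interpret long_node t p r by unfold_locales (use assms in auto)
  show ?thesis using card_Y by (metis card.infinite zero_neq_one)
qed

end

section \<open>The formula, family by family\<close>

definition type_formula :: "affine_type \<Rightarrow> nat \<Rightarrow> (nat \<Rightarrow> nat) \<Rightarrow> bool" where
  "type_formula t p s \<longleftrightarrow> real (card (W_ab t s)) =
    real (label t 0) * (real (chi_long t (simple_root p)) + 1)
      * real (twist t) ^ (affine_rank t - num_long_simple t)
      * (real (card (W_f t)) / real (card (W_sigma t s)))
    - real (chi_long t (simple_root p))"

context affine_diagram
begin

text \<open>Every real root may be shifted by \<open>\<delta>\<close>, so \<open>r\<close> is
  constantly 1 and the index is \<open>2 * sq p\<close> divided by \<open>sq 0\<close>: 2 for a long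
  and 1 for a short marked node.\<close>

lemma untwisted_formula:
  assumes "twist t = 1" "label t 0 = 1" "p \<le> n" "label t p = 2"
    and dvd: "\<And>i. i \<le> n \<Longrightarrow> sq i dvd sq 0" "\<And>i. i \<le> n \<Longrightarrow> sq 0 dvd a i * sq i"
    and sq: "sq p = sq 0 \<or> 2 * sq p = sq 0"
    and s: "\<And>i. i \<le> n \<Longrightarrow> s i = (if i = p then 1 else 0)"
  shows "type_formula t p s"
proof -
  interpret graded_diagram t p "\<lambda>_. 1"
  proof unfold_locales
    fix i j assume "i \<le> n" "j \<le> n"
    then show "sq j dvd int (twist t) * a i * sq i"
      using dvd_trans[OF dvd(1)[of j] dvd(2)[of i]] assms by simp
  next
    fix i assume i: "i \<in> {1..n}"
    have "sq i dvd (\<alpha> i j + 1 * a j) * sq j" if "j \<le> n" for j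
      using dvd_trans[OF dvd(1)[of i] dvd(2)[of j]] i that
      by (cases "j = i") (auto simp: simple_root_def)
    then show "\<exists>c m. sq i = c * c * m \<and> 0 < m \<and>
        (\<forall>j\<le>n. c dvd \<alpha> i j + 1 * a j \<and> c * m dvd (\<alpha> i j + 1 * a j) * sq j)"
      using i sq_pos by (intro exI[of _ 1] exI[of _ "sq i"]) auto
  qed (use assms in auto)
  have sq0: "sq 0 > 0" using sq_pos by simp
  have le: "sq i \<le> sq 0" if "i \<le> n" for i using dvd(1)[OF that] sq0 by (rule zdvd_imp_le)
  have residues: "real (card residues) = real_of_int (colabel_ratio p)"
    unfolding card_residues_eq by (simp add: assms)
  have ratio: "sq 0 * colabel_ratio p = 2 * sq p" using colabel_ratio_eq[OF p_le] assms by simp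
  show ?thesis
  proof (cases "sq p = sq 0")
    case True
    have "\<not> 2 * sq 0 dvd sq 0" using sq0 by (auto dest: zdvd_imp_le)
    then have Y: "finite Y" "card Y = 1" using card_Y_long le True assms by auto
    have "chi_long t (\<alpha> p) = 1" using le True by (simp add: chi_long_def long_root_simple[OF p_le])
    moreover have "colabel_ratio p = 2" using ratio True sq0 by simp
    ultimately show ?thesis
      using card_W_ab[OF s Y(1)] Y(2) by (simp add: type_formula_def residues assms)
  next
    case False
    then have Y: "Y = {}" using sq by (intro Y_empty_untwisted[of 0]) auto
    have "\<not> sq 0 \<le> sq p" using False le[OF p_le] by simp
    then have "chi_long t (\<alpha> p) = 0" by (auto simp: chi_long_def long_root_simple[OF p_le])
    moreover have "colabel_ratio p = 1" using ratio False sq sq0 by simp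
    ultimately show ?thesis
      using card_W_ab[OF s] Y by (simp add: type_formula_def residues assms)
  qed
qed

text \<open>\<open>\<alpha> i\<close> may be shifted by \<open>sq i\<close> times
  \<open>\<delta>\<close>, hence \<open>r = sq\<close>. Each short node of \<open>\<Pi>_f\<close>
  contributes 2 to the index and each long one 1, which gives the power of 2; the coroot relation
  contributes \<open>sq p\<close>.\<close>

lemma twisted_formula:
  assumes "twist t = 2" "label t 0 = 1" "sq 0 = 1" "p \<le> n" "label t p = 1"
    and sq: "\<And>i. i \<le> n \<Longrightarrow> sq i = 1 \<or> sq i = 2" and l: "l \<le> n" "sq l = 2"
    and s: "\<And>i. i \<le> n \<Longrightarrow> s i = (if i = p then 1 else 0)"
  shows "type_formula t p s"
proof -
  interpret graded_diagram t p sq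
  proof unfold_locales
    fix i j assume "i \<le> n" "j \<le> n"
    then show "sq j dvd int (twist t) * a i * sq i"
      using sq[of j] assms(1) by auto
  next
    fix i j assume "i \<in> {1..n}" "j \<in> {1..n}"
    then show "sq j dvd sq i * A i j" by (simp add: cartan_sym[of i j])
  next
    fix i assume i: "i \<in> {1..n}"
    have "sq i dvd (\<alpha> i j + sq i * a j) * sq j" for j
      by (cases "j = i") (auto simp: simple_root_def)
    then show "\<exists>c m. sq i = c * c * m \<and> 0 < m \<and>
        (\<forall>j\<le>n. c dvd \<alpha> i j + sq i * a j \<and> c * m dvd (\<alpha> i j + sq i * a j) * sq j)"
      using i sq_pos by (intro exI[of _ 1] exI[of _ "sq i"]) auto
  next
    fix i assume "i \<in> {1..n}"
    then show "sq i dvd int (twist t)" using sq[of i] assms(1) by auto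
  qed (use assms sq_pos in auto)
  have long: "(\<forall>j\<le>n. sq j \<le> sq i) \<longleftrightarrow> sq i = 2" if "i \<le> n" for i
    using sq l that by force
  have "(\<Prod>i\<in>{1..n}. real_of_int (2 div sq i)) = (\<Prod>i\<in>{1..n}. if sq i = 2 then 1 else 2)"
    using sq by (intro prod.cong refl) force
  also have "\<dots> = 2 ^ card {i \<in> {1..n}. sq i \<noteq> 2}"
    by (simp add: prod.If_cases Int_def)
  also have "card {i \<in> {1..n}. sq i \<noteq> 2} = n - num_long_simple t"
  proof -
    have "{i \<in> {1..n}. \<forall>j\<le>n. sq j \<le> sq i} = {i \<in> {1..n}. sq i = 2}" using long by auto
    moreover have "{i \<in> {1..n}. sq i \<noteq> 2} = {1..n} - {i \<in> {1..n}. sq i = 2}" by auto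
    moreover have "card ({1..n} - {i \<in> {1..n}. sq i = 2}) = card {1..n} - card {i \<in> {1..n}. sq i = 2}"
      by (rule card_Diff_subset) auto
    ultimately show ?thesis by (simp only: num_long_simple_eq card_atLeastAtMost diff_Suc_1 flip: One_nat_def)
  qed
  finally have residues: "real (card residues) = 2 ^ (n - num_long_simple t) * real_of_int (sq p)"
    unfolding card_residues_eq by (simp add: assms colabel_ratio_def)
  show ?thesis
  proof (cases "sq p = 2")
    case True
    then have Y: "finite Y" "card Y = 1" using card_Y_long long[OF p_le] assms by auto
    have "chi_long t (\<alpha> p) = 1" using long[OF p_le] True by (simp add: chi_long_def long_root_simple[OF p_le])
    then show ?thesis
      using card_W_ab[OF s Y(1)] Y(2) True by (simp add: type_formula_def residues assms)
  next
    case False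
    then have "sq p = 1" using sq[OF p_le] by simp
    then have Y: "Y = {}" using assms(1) by (intro Y_empty_twisted)
    have "chi_long t (\<alpha> p) = 0" using long[OF p_le] False by (simp add: chi_long_def long_root_simple[OF p_le])
    then show ?thesis
      using card_W_ab[OF s] Y \<open>sq p = 1\<close> by (simp add: type_formula_def residues assms)
  qed
qed

end

text \<open>\<open>r\<close> is 1 even at the longest node, because
  \<open>\<alpha> n + \<delta>\<close> is twice a root of half norm 1. The index 2^n times 2
  regroups as a_0 = 2, times 2 for the long node, times 2^(n-1).\<close>

lemma twisted_A_even_formula:
  assumes "affine_diagram (TwistedA_even n)" "1 \<le> n"
    and s: "\<And>i. i \<le> n \<Longrightarrow> s i = (if i = n then 1 else 0)"
  shows "type_formula (TwistedA_even n) n s"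
proof -
  interpret affine_diagram "TwistedA_even n" by fact
  interpret graded_diagram "TwistedA_even n" n "\<lambda>_. 1"
  proof unfold_locales
    fix i assume i: "i \<in> {1..affine_rank (TwistedA_even n)}"
    show "\<exists>c m. sq i = c * c * m \<and> 0 < m \<and>
        (\<forall>j\<le>affine_rank (TwistedA_even n). c dvd \<alpha> i j + 1 * a j \<and> c * m dvd (\<alpha> i j + 1 * a j) * sq j)"
    proof (cases "i = n")
      case True
      then show ?thesis using assms(2)
        by (intro exI[of _ 2] exI[of _ 1]) (auto simp: simple_root_def)
    next
      case False
      then show ?thesis using i
        by (intro exI[of _ 1] exI[of _ 2]) (auto simp: simple_root_def)
    qed
  qed (use assms(2) in auto)
  have long: "(\<forall>j\<le>n. sq j \<le> sq i) \<longleftrightarrow> i = n" if "i \<le> n" for i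
    using that assms(2) by (auto dest: spec[of _ n] split: if_splits)
  have Y: "finite Y" "card Y = 1" using card_Y_long assms(2) by auto
  have "{i \<in> {1..n}. \<forall>j\<le>n. sq j \<le> sq i} = {n}" using long assms(2) by auto
  then have L: "num_long_simple (TwistedA_even n) = 1" by (simp add: num_long_simple_eq)
  have chi: "chi_long (TwistedA_even n) (\<alpha> n) = 1" using long[of n] by (simp add: chi_long_def long_root_simple)
  have "real (card residues) = 2 ^ n * 2"
    unfolding card_residues_eq using assms(2) by (simp add: colabel_ratio_def)
  also have "\<dots> = 2 * 2 * 2 ^ (n - 1)" using assms(2) by (cases n) simp_all
  finally show ?thesis
    using card_W_ab[OF _ Y(1), of s] s Y(2) assms(2) by (simp add: type_formula_def L chi)
qed

section \<open>The affine diagrams\<close>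

definition adjacent :: "affine_type \<Rightarrow> nat \<Rightarrow> nat \<Rightarrow> bool" where
  "adjacent t i j \<longleftrightarrow> i \<noteq> j \<and> ((i, j) \<in> affine_edges t \<or> (j, i) \<in> affine_edges t)"

lemma cartan_adjacent:
  "i \<noteq> j \<Longrightarrow> cartan t i j = (if adjacent t i j then
     (if t = Untwisted (TypeA 1) then -2 else - (max (sqlen t i) (sqlen t j) div sqlen t i)) else 0)"
  by (simp add: cartan_def adjacent_def)

lemma adjacent_sym: "adjacent t i j \<longleftrightarrow> adjacent t j i"
  by (auto simp: adjacent_def)

text \<open>Turns the row condition into the rule that twice a label is the weighted sum of its
  neighbours' labels.\<close>

lemma cartan_row_sum:
  assumes "t \<noteq> Untwisted (TypeA 1)" "i \<le> affine_rank t"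
    and N: "\<And>j. j \<in> N \<longleftrightarrow> j \<le> affine_rank t \<and> adjacent t i j"
    and sum: "(\<Sum>j\<in>N. max (sqlen t i) (sqlen t j) div sqlen t i * int (label t j)) = 2 * int (label t i)"
  shows "(\<Sum>j\<le>affine_rank t. cartan t i j * int (label t j)) = 0"
proof -
  have sub: "N \<subseteq> {..affine_rank t} - {i}" using N by (auto simp: adjacent_def)
  have "(\<Sum>j\<le>affine_rank t. cartan t i j * int (label t j)) =
      cartan t i i * int (label t i) + (\<Sum>j\<in>{..affine_rank t} - {i}. cartan t i j * int (label t j))"
    using assms(2) by (intro sum.remove) auto
  also have "(\<Sum>j\<in>{..affine_rank t} - {i}. cartan t i j * int (label t j)) = (\<Sum>j\<in>N. cartan t i j * int (label t j))"
    using N sub by (intro sum.mono_neutral_right) (auto simp: cartan_adjacent)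
  also have "\<dots> = (\<Sum>j\<in>N. - (max (sqlen t i) (sqlen t j) div sqlen t i * int (label t j)))"
  proof (intro sum.cong refl)
    fix j assume "j \<in> N"
    then show "cartan t i j * int (label t j) = - (max (sqlen t i) (sqlen t j) div sqlen t i * int (label t j))"
      using N[of j] assms(1) by (simp add: cartan_adjacent adjacent_def)
  qed
  also have "\<dots> = - (2 * int (label t i))" unfolding sum_negf sum ..
  finally show ?thesis by (simp add: cartan_def)
qed

text \<open>Of any two lengths in \<open>L\<close> one divides the other, so the division in
  \<open>cartan\<close> is exact and the symmetrised matrix symmetric. \<open>rank\<close> decreases
  along some edge towards \<open>c\<close>, which certifies connectedness.\<close>

lemma affine_diagramI:
  assumes sq: "\<And>i. i \<le> affine_rank t \<Longrightarrow> 0 < sqlen t i"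
    and lab: "\<And>i. i \<le> affine_rank t \<Longrightarrow> 0 < label t i"
    and lengths: "\<And>i. i \<le> affine_rank t \<Longrightarrow> sqlen t i \<in> L" "L = {1, 2, 4} \<or> L = {1, 3}"
    and row: "\<And>i. i \<le> affine_rank t \<Longrightarrow> (\<Sum>j\<le>affine_rank t. cartan t i j * int (label t j)) = 0"
    and tree: "c \<le> affine_rank t"
      "\<And>i. i \<le> affine_rank t \<Longrightarrow> i \<noteq> c \<Longrightarrow> \<exists>j\<le>affine_rank t. adjacent t i j \<and> rank j < (rank i :: nat)"
  shows "affine_diagram t"
proof
  have dvd: "sqlen t i dvd sqlen t j \<or> sqlen t j dvd sqlen t i" if "i \<le> affine_rank t" "j \<le> affine_rank t" for i j
    using lengths(1)[OF that(1)] lengths(1)[OF that(2)] lengths(2) by auto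
  fix i j assume ij: "i \<le> affine_rank t" "j \<le> affine_rank t"
  show "cartan t i j \<le> 0" if "i \<noteq> j"
    using sq[OF ij(1)] by (auto simp: cartan_adjacent[OF that] pos_imp_zdiv_nonneg_iff)
  show "sqlen t i * cartan t i j = sqlen t j * cartan t j i"
  proof (cases "i = j")
    case False
    have m: "sqlen t i * (max (sqlen t i) (sqlen t j) div sqlen t i) = max (sqlen t i) (sqlen t j)"
      if "i \<le> affine_rank t" "j \<le> affine_rank t" for i j
      using dvd[OF that] sq[OF that(1)] sq[OF that(2)] by (auto simp: max_def dest: zdvd_imp_le)
    show ?thesis
      using False m[OF ij] m[OF ij(2,1)]
      by (auto simp: cartan_adjacent adjacent_sym[of t j i] max.commute)
  qed simp
next
  fix S assume S: "S \<subseteq> {..affine_rank t}" "S \<noteq> {}"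
    and closed: "\<And>i j. i \<in> S \<Longrightarrow> j \<le> affine_rank t \<Longrightarrow> cartan t i j \<noteq> 0 \<Longrightarrow> j \<in> S"
  have step: "j \<in> S" if "i \<in> S" "j \<le> affine_rank t" "adjacent t i j" for i j
  proof (rule closed[OF that(1,2)])
    have "i \<le> affine_rank t" "i \<noteq> j" using that S by (auto simp: adjacent_def)
    moreover have "0 < max (sqlen t i) (sqlen t j) div sqlen t i"
      using sq[OF \<open>i \<le> affine_rank t\<close>] by (simp add: pos_imp_zdiv_pos_iff)
    ultimately show "cartan t i j \<noteq> 0" using that(3) by (simp add: cartan_adjacent)
  qed
  have down: "i \<in> S \<Longrightarrow> c \<in> S" for i
  proof (induction "rank i" arbitrary: i rule: less_induct)
    case less
    show ?case
    proof (cases "i = c")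
      case False
      then obtain j where "j \<le> affine_rank t" "adjacent t i j" "rank j < rank i"
        using tree(2)[of i] less.prems S by auto
      then show ?thesis using less.hyps[of j] step[OF less.prems] by blast
    qed (use less.prems in simp)
  qed
  then have "c \<in> S" using S(2) by blast
  have "i \<le> affine_rank t \<Longrightarrow> i \<in> S" for i
  proof (induction "rank i" arbitrary: i rule: less_induct)
    case less
    show ?case
    proof (cases "i = c")
      case False
      then obtain j where "j \<le> affine_rank t" "adjacent t i j" "rank j < rank i"
        using tree(2)[of i] less.prems by auto
      then show ?thesis using less.hyps[of j] step[of j i] less.prems by (simp add: adjacent_sym)
    qed (use \<open>c \<in> S\<close> in simp)
  qed
  then show "S = {..affine_rank t}" using S(1) by blast
qed (use assms in auto)

lemma path_edges_iff: "(i, j) \<in> path_edges b c \<longleftrightarrow> b \<le> i \<and> i < c \<and> j = Suc i"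
  by (auto simp: path_edges_def)

lemmas adjacent_defs = adjacent_def path_edges_iff

lemma affine_diagram_chain:
  assumes "t = Untwisted (TypeC n) \<and> 2 \<le> n \<or> t = TwistedA_even n \<and> 1 \<le> n \<or> t = TwistedD n \<and> 2 \<le> n"
  shows "affine_diagram t"
proof (rule affine_diagramI[where c = 0 and rank = id and L = "{1, 2, 4}"])
  have adj: "adjacent t i j \<longleftrightarrow> j = Suc i \<and> i < n \<or> i = Suc j \<and> j < n" for i j
    using assms by (auto simp: adjacent_defs)
  have rank: "affine_rank t = n" using assms by auto
  fix i assume "i \<le> affine_rank t"
  then have i: "i \<le> n" using rank by simp
  show "(\<Sum>j\<le>affine_rank t. cartan t i j * int (label t j)) = 0"
  proof (rule cartan_row_sum[where N = "(if i = 0 then {} else {i - 1}) \<union> (if i = n then {} else {i + 1})"])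
    fix j
    show "j \<in> (if i = 0 then {} else {i - 1}) \<union> (if i = n then {} else {i + 1}) \<longleftrightarrow> j \<le> affine_rank t \<and> adjacent t i j"
      unfolding adj rank using i by auto
  next
    show "(\<Sum>j\<in>(if i = 0 then {} else {i - 1}) \<union> (if i = n then {} else {i + 1}).
        max (sqlen t i) (sqlen t j) div sqlen t i * int (label t j)) = 2 * int (label t i)"
      using i assms by (auto simp: card_insert_if)
  qed (use i rank assms in auto)
  show "\<exists>j\<le>affine_rank t. adjacent t i j \<and> id j < id i" if "i \<noteq> 0"
    unfolding adj rank using i that by (intro exI[of _ "i - 1"]) auto
qed (use assms in \<open>auto split: if_splits\<close>)

lemma affine_diagram_fork:
  assumes "t = Untwisted (TypeB n) \<or> t = TwistedA_odd n" "3 \<le> n"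
  shows "affine_diagram t"
proof (rule affine_diagramI[where c = 2 and rank = "\<lambda>i. if i \<le> 1 then 1 else i - 2" and L = "{1, 2, 4}"])
  have adj: "adjacent t i j \<longleftrightarrow> j = Suc i \<and> 1 \<le> i \<and> i < n \<or> i = Suc j \<and> 1 \<le> j \<and> j < n \<or>
      i = 0 \<and> j = 2 \<or> i = 2 \<and> j = 0" for i j
  proof -
    have edges: "affine_edges t = path_edges 1 n \<union> {(0, 2)}" using assms(1) by auto
    show ?thesis unfolding adjacent_def edges Un_iff path_edges_iff singleton_iff prod.inject by presburger
  qed
  have rank: "affine_rank t = n" using assms by auto
  fix i assume "i \<le> affine_rank t"
  then have i: "i \<le> n" using rank by simp
  define N where "N = (if i \<le> 1 then {2} else if i = 2 then {0, 1, 3} else if i = n then {n - 1} else {i - 1, i + 1})"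
  show "(\<Sum>j\<le>affine_rank t. cartan t i j * int (label t j)) = 0"
  proof (rule cartan_row_sum[where N = N])
    fix j
    show "j \<in> N \<longleftrightarrow> j \<le> affine_rank t \<and> adjacent t i j"
      unfolding adj rank N_def using i assms(2) by auto
  next
    show "(\<Sum>j\<in>N. max (sqlen t i) (sqlen t j) div sqlen t i * int (label t j)) = 2 * int (label t i)"
      using i assms by (auto simp: N_def)
  qed (use i rank assms in auto)
  show "\<exists>j\<le>affine_rank t. adjacent t i j \<and>
      (if j \<le> 1 then 1 else j - 2) < (if i \<le> 1 then 1 else i - 2)" if "i \<noteq> 2"
    unfolding adj rank using i that assms(2)
    by (intro exI[of _ "if i \<le> 1 then 2 else i - 1"]) auto
qed (use assms in \<open>auto split: if_splits\<close>)

lemma affine_diagram_D: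
  assumes "4 \<le> n"
  shows "affine_diagram (Untwisted (TypeD n))"
proof -
  \<comment> \<open>Writing \<open>m + 4\<close> keeps subtraction of natural numbers out of the
    adjacency analysis.\<close>
  obtain m where n: "n = m + 4" using assms by (metis le_iff_add add.commute)
  let ?t = "Untwisted (TypeD (m + 4))"
  have adj: "adjacent ?t i j \<longleftrightarrow> j = Suc i \<and> 1 \<le> i \<and> i < m + 3 \<or> i = Suc j \<and> 1 \<le> j \<and> j < m + 3 \<or>
      i = 0 \<and> j = 2 \<or> i = 2 \<and> j = 0 \<or> i = m + 4 \<and> j = m + 2 \<or> i = m + 2 \<and> j = m + 4" for i j
  proof -
    have edges: "affine_edges ?t = path_edges 1 (m + 3) \<union> {(m + 2, m + 4)} \<union> {(0, 2)}" by (simp add: add.commute)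
    show ?thesis unfolding adjacent_def edges Un_iff path_edges_iff singleton_iff prod.inject by auto
  qed
  have "affine_diagram ?t"
  proof (rule affine_diagramI[where c = 2 and rank = "\<lambda>i. if i \<le> 1 then 1 else i - 2" and L = "{1, 2, 4}"])
    fix i assume "i \<le> affine_rank ?t"
    then have i: "i \<le> m + 4" by simp
    have rowI: "(\<Sum>j\<le>affine_rank ?t. cartan ?t i j * int (label ?t j)) = 0"
      if "\<And>j. j \<in> N \<longleftrightarrow> j \<le> m + 4 \<and> adjacent ?t i j"
        "(\<Sum>j\<in>N. int (label ?t j)) = 2 * int (label ?t i)" for N
      by (rule cartan_row_sum[where N = N]) (use that i in auto)
    consider "i \<le> 1" | "i = 2" "m = 0" | "i = 2" "0 < m" | l where "i = Suc (Suc (Suc l))" "l + 1 < m"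
      | "i = m + 2" "0 < m" | "i = m + 3" | "i = m + 4"
      using i by (cases "i \<le> 2"; cases "i = m + 2"; atomize_elim) (auto, presburger+)
    then show "(\<Sum>j\<le>affine_rank ?t. cartan ?t i j * int (label ?t j)) = 0"
    proof cases
      case 1
      show ?thesis by (rule rowI[of "{2}"]) (use 1 in \<open>auto simp: adj\<close>)
    next
      case 2
      show ?thesis by (rule rowI[of "{0, 1, 3, 4}"]) (use 2 in \<open>auto simp: adjacent_defs\<close>)
    next
      case 3
      show ?thesis by (rule rowI[of "{0, 1, 3}"]) (use 3 in \<open>auto simp: adj\<close>)
    next
      case (4 l)
      show ?thesis by (rule rowI[of "{l + 2, l + 4}"]) (use 4 in \<open>auto simp: adj\<close>)
    next
      case 5
      show ?thesis by (rule rowI[of "{m + 1, m + 3, m + 4}"]) (use 5 in \<open>auto simp: adj\<close>)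
    next
      case 6
      show ?thesis by (rule rowI[of "{m + 2}"]) (use 6 in \<open>auto simp: adj\<close>)
    next
      case 7
      show ?thesis by (rule rowI[of "{m + 2}"]) (use 7 in \<open>auto simp: adj\<close>)
    qed
    show "\<exists>j\<le>affine_rank ?t. adjacent ?t i j \<and>
        (if j \<le> 1 then 1 else j - 2) < (if i \<le> 1 then 1 else i - 2)" if "i \<noteq> 2"
      unfolding adj using i that
      by (intro exI[of _ "if i \<le> 1 then 2 else if i = m + 4 then m + 2 else i - 1"]) auto
  qed auto
  then show ?thesis by (simp only: n)
qed

text \<open>For a concrete diagram all conditions become finite checks by evaluation;
  \<open>nb\<close> lists the neighbours and \<open>rank\<close> plays the role of the distance to
  \<open>c\<close>.\<close>

lemma affine_diagram_of_tables:
  fixes t :: affine_type and nb :: "nat list list" and rank :: "nat list"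
  defines "nodes \<equiv> [0..<Suc (affine_rank t)]"
  assumes "t \<noteq> Untwisted (TypeA 1)" and L: "L = {1, 2, 4} \<or> L = {1, 3}" and "c \<le> affine_rank t"
    and pos: "list_all (\<lambda>i. 0 < sqlen t i \<and> 0 < label t i \<and> sqlen t i \<in> L) nodes"
    and nb: "list_all (\<lambda>i. distinct (nb ! i) \<and> list_all (\<lambda>j. j \<le> affine_rank t) (nb ! i)) nodes"
      "list_all (\<lambda>i. list_all (\<lambda>j. j \<in> set (nb ! i) \<longleftrightarrow> adjacent t i j) nodes) nodes"
    and sum: "list_all (\<lambda>i. (\<Sum>j\<leftarrow>nb ! i. max (sqlen t i) (sqlen t j) div sqlen t i * int (label t j)) =
      2 * int (label t i)) nodes"
    and tree: "list_all (\<lambda>i. i \<noteq> c \<longrightarrow> list_ex (\<lambda>j. rank ! j < rank ! i) (nb ! i)) nodes"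
  shows "affine_diagram t"
proof (rule affine_diagramI[where c = c and rank = "\<lambda>i. rank ! i" and L = L])
  have nodes: "list_all P nodes \<longleftrightarrow> (\<forall>i\<le>affine_rank t. P i)" for P
    by (simp only: nodes_def list_all_iff set_upt Ball_def atLeastLessThan_iff less_Suc_eq_le) simp
  have nb': "j \<in> set (nb ! i) \<longleftrightarrow> j \<le> affine_rank t \<and> adjacent t i j" if "i \<le> affine_rank t" for i j
    using nb[unfolded nodes] that unfolding list_all_iff by metis
  fix i assume i: "i \<le> affine_rank t"
  show "0 < sqlen t i" "0 < label t i" "sqlen t i \<in> L" using pos i unfolding nodes by blast+
  have "distinct (nb ! i)" using nb(1) i unfolding nodes by blast
  moreover have "(\<Sum>j\<leftarrow>nb ! i. max (sqlen t i) (sqlen t j) div sqlen t i * int (label t j)) = 2 * int (label t i)"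
    using sum i unfolding nodes by blast
  ultimately have "(\<Sum>j\<in>set (nb ! i). max (sqlen t i) (sqlen t j) div sqlen t i * int (label t j)) = 2 * int (label t i)"
    by (simp only: sum_list_distinct_conv_sum_set)
  then show "(\<Sum>j\<le>affine_rank t. cartan t i j * int (label t j)) = 0"
    by (rule cartan_row_sum[OF assms(2) i nb'[OF i]])
  show "\<exists>j\<le>affine_rank t. adjacent t i j \<and> rank ! j < rank ! i" if "i \<noteq> c"
    using tree i that nb'[OF i] unfolding nodes list_ex_iff by blast
qed (use L assms(4) in auto)

lemma affine_diagram_exceptional:
  assumes "t \<in> {Untwisted (TypeE 6), Untwisted (TypeE 7), Untwisted (TypeE 8), Untwisted TypeF4, Untwisted TypeG2, TwistedE6}"
  shows "affine_diagram t"
proof -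
  consider "t = Untwisted (TypeE 6)" | "t = Untwisted (TypeE 7)" | "t = Untwisted (TypeE 8)"
    | "t = Untwisted TypeF4" | "t = TwistedE6" | "t = Untwisted TypeG2"
    using assms by blast
  then show ?thesis
  proof cases
    case 1
    show ?thesis unfolding 1
      by (rule affine_diagram_of_tables[where c = 4 and L = "{1, 2, 4}" and rank = "[2, 2, 1, 1, 0, 1, 2]"
            and nb = "[[2], [3], [0, 4], [1, 4], [2, 3, 5], [4, 6], [5]]"])
        (simp_all add: adjacent_defs upt_rec)
  next
    case 2
    show ?thesis unfolding 2
      by (rule affine_diagram_of_tables[where c = 4 and L = "{1, 2, 4}" and rank = "[3, 2, 1, 1, 0, 1, 2, 3]"
            and nb = "[[1], [0, 3], [4], [1, 4], [2, 3, 5], [4, 6], [5, 7], [6]]"])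
        (simp_all add: adjacent_defs upt_rec)
  next
    case 3
    show ?thesis unfolding 3
      by (rule affine_diagram_of_tables[where c = 4 and L = "{1, 2, 4}" and rank = "[5, 2, 1, 1, 0, 1, 2, 3, 4]"
            and nb = "[[8], [3], [4], [1, 4], [2, 3, 5], [4, 6], [5, 7], [6, 8], [7, 0]]"])
        (simp_all add: adjacent_defs upt_rec)
  next
    case 4
    show ?thesis unfolding 4
      by (rule affine_diagram_of_tables[where c = 0 and L = "{1, 2, 4}" and rank = "[0, 1, 2, 3, 4]"
            and nb = "[[1], [0, 2], [1, 3], [2, 4], [3]]"])
        (simp_all add: adjacent_defs upt_rec)
  next
    case 5
    show ?thesis unfolding 5
      by (rule affine_diagram_of_tables[where c = 0 and L = "{1, 2, 4}" and rank = "[0, 1, 2, 3, 4]"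
            and nb = "[[1], [0, 2], [1, 3], [2, 4], [3]]"])
        (simp_all add: adjacent_defs upt_rec)
  next
    case 6
    show ?thesis unfolding 6
      by (rule affine_diagram_of_tables[where c = 0 and L = "{1, 3}" and rank = "[0, 1, 2]"
            and nb = "[[1], [0, 2], [1]]"])
        (simp_all add: adjacent_defs upt_rec)
  qed
qed

text \<open>In the untwisted case the label at \<open>p\<close> is 2, which rules out type A and
  with it the exceptional matrix with both entries -2. For \<open>TwistedA_even\<close> the label
  condition leaves only the node \<open>n\<close>.\<close>

lemma type_formula_holds:
  assumes valid: "valid_affine_type t" and p: "p \<le> affine_rank t" "twist t * label t p = 2"
    and s: "\<And>i. i \<le> affine_rank t \<Longrightarrow> s i = (if i = p then 1 else 0)"
  shows "type_formula t p s"
proof (cases t)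
  case (Untwisted X)
  then have lab: "label t p = 2" using p(2) by simp
  have le4: "i \<le> 4 \<longleftrightarrow> i \<in> {0, 1, 2, 3, 4}" and le2: "i \<le> 2 \<longleftrightarrow> i \<in> {0, 1, 2}" for i :: nat
    by (simp_all add: numeral_eq_Suc le_Suc_eq disj_ac)
  have "affine_diagram t \<and> label t 0 = 1 \<and>
      (\<forall>i\<le>affine_rank t. sqlen t i dvd sqlen t 0 \<and> sqlen t 0 dvd int (label t i) * sqlen t i) \<and>
      (sqlen t p = sqlen t 0 \<or> 2 * sqlen t p = sqlen t 0)"
  proof (cases X)
    case (TypeA n)
    then show ?thesis using Untwisted lab by simp
  next
    case (TypeB n)
    have "affine_diagram t" by (rule affine_diagram_fork[of t n]) (use valid Untwisted TypeB in auto)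
    then show ?thesis using valid Untwisted TypeB by simp
  next
    case (TypeC n)
    have "affine_diagram t" by (rule affine_diagram_chain[of t n]) (use valid Untwisted TypeC in auto)
    then show ?thesis using valid lab Untwisted TypeC by (auto split: if_splits)
  next
    case (TypeD n)
    have "affine_diagram t" using valid Untwisted TypeD affine_diagram_D[of n] by simp
    then show ?thesis using Untwisted TypeD by simp
  next
    case (TypeE n)
    have "affine_diagram t" by (rule affine_diagram_exceptional) (use valid Untwisted TypeE in auto)
    then show ?thesis using valid Untwisted TypeE by auto
  next
    case TypeF4
    have "affine_diagram t" by (rule affine_diagram_exceptional) (use Untwisted TypeF4 in auto)
    then show ?thesis using p Untwisted TypeF4 by (auto simp: le4)
  next
    case TypeG2
    have "affine_diagram t" by (rule affine_diagram_exceptional) (use Untwisted TypeG2 in auto)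
    then show ?thesis using p Untwisted TypeG2 by (auto simp: le2)
  qed
  then show ?thesis
    using Untwisted p(1) lab s by (intro affine_diagram.untwisted_formula) auto
next
  case (TwistedA_even n)
  have "affine_diagram t" by (rule affine_diagram_chain[of t n]) (use valid TwistedA_even in auto)
  moreover have "p = n" using p(2) TwistedA_even by (simp split: if_splits)
  ultimately show ?thesis
    using twisted_A_even_formula[of n s] valid s TwistedA_even by simp
next
  case (TwistedA_odd n)
  have "affine_diagram t" by (rule affine_diagram_fork[of t n]) (use valid TwistedA_odd in auto)
  then show ?thesis
    by (rule affine_diagram.twisted_formula[where l = n]) (use valid p s TwistedA_odd in auto)
next
  case (TwistedD n)
  have "affine_diagram t" by (rule affine_diagram_chain[of t n]) (use valid TwistedD in auto)
  then show ?thesis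
    by (rule affine_diagram.twisted_formula[where l = 1]) (use valid p s TwistedD in auto)
next
  case TwistedE6
  have "affine_diagram t" by (rule affine_diagram_exceptional) (use TwistedE6 in auto)
  then show ?thesis
    by (rule affine_diagram.twisted_formula[where l = 3]) (use p s TwistedE6 in auto)
qed

theorem theorem5p11:
  fixes scale :: "complex \<Rightarrow> 'g::ab_group_add \<Rightarrow> 'g"
    and bracket :: "'g \<Rightarrow> 'g \<Rightarrow> 'g"
    and \<sigma> :: "'g \<Rightarrow> 'g"
    and t :: affine_type
    and s :: "nat \<Rightarrow> nat"
    and n k p :: nat
  assumes lie: "complex_lie_algebra scale bracket"
    and simple_g: "complex_lie_algebra.finite_dim_simple scale bracket"
    and aut: "complex_lie_algebra.automorphism scale bracket \<sigma>"
    and order_two: "complex_lie_algebra.has_order \<sigma> 2"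
    and valid: "valid_affine_type t"
    and n: "n = affine_rank t"
    and k: "k = twist t"
    and k_least: "complex_lie_algebra.least_inner_power scale bracket \<sigma> k"
    and type_s: "complex_lie_algebra.automorphism_of_type scale bracket t s \<sigma>"
    and coprime_s: "Gcd (s ` {0..n}) = 1"
    and sum_s: "k * (\<Sum>i\<le>n. label t i * s i) = 2"
    and semisimple_g0: "complex_lie_algebra.semisimple scale bracket
                          (complex_lie_algebra.fixed_points \<sigma>)"
    and p: "p \<le> n" "s p \<noteq> 0" "\<And>i. i \<le> n \<Longrightarrow> s i \<noteq> 0 \<Longrightarrow> i = p"
  shows "real (card (W_ab t s)) =
    real (label t 0) * (real (chi_long t (simple_root p)) + 1)
      * real k ^ (n - num_long_simple t)
      * (real (card (W_f t)) / real (card (W_sigma t s)))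
    - real (chi_long t (simple_root p))"
proof -
  have zero: "s i = 0" if "i \<le> n" "i \<noteq> p" for i
    using p(3) that by blast
  \<comment> \<open>All other entries of \<open>s\<close> are 0, so coprimality forces
    \<open>s p = 1\<close>.\<close>
  then have "s p dvd Gcd (s ` {0..n})"
    by (intro Gcd_greatest) (metis atLeastAtMost_iff dvd_0_right dvd_refl imageE)
  then have "s p = 1" using coprime_s by simp
  have "(\<Sum>i\<le>n. label t i * s i) = (\<Sum>i\<le>n. if i = p then label t i * s i else 0)"
    by (intro sum.cong refl) (use zero in auto)
  also have "\<dots> = label t p" using p(1) \<open>s p = 1\<close> by simp
  finally have "type_formula t p s"
    using valid p(1) sum_s zero \<open>s p = 1\<close> n k by (intro type_formula_holds) auto
  then show ?thesis
    by (simp only: type_formula_def n k)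
qed

end
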